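(* Let $J=\mathbb{N}$ or $J=\mathbb{Z}$. Let $T$ be a self-adjoint (possibly unbounded) operator on a Hilbert space $\mathcal{H}$. Assume that the spectrum of $T$ is contained in the union $\Delta:=\bigcup_{j\in J}\Delta_j$ of segments $\Delta_j=[\alpha_j,\beta_j]\subset\mathbb{R}$ such that $\alpha_{j+1}>\beta_j$ for all $j\in J$, and assume in addition that $$\inf_{j\in J}\left(\alpha_{j+1}-\beta_j\right)=d>0.$$ Let $B$ be a bounded (in general non-self-adjoint) operator on $\mathcal{H}$ with $b:=\|B\|<d/2$. Then the spectrum of the operator $A=T+B$ lies in the union $\bigcup_{j\in J}U_b(\Delta_j)$ of the mutually disjoint closed $b$-neighborhoods $U_b(\Delta_j)$ of the segments $\Delta_j$ in $\mathbb{C}$. Moreover, if for each $j\in J$ we denote by $Q_j$ the Riesz projection of $A$ corresponding to the part of the spectrum of $A$ lying in $U_b(\Delta_j)$, then the invariant subspaces $\mathcal{L}_j=Q_j(\mathcal{H})$, $j\in J$, of $A$ form an unconditional basis of subspaces in $\mathcal{H}$.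
   Context: $\mathcal{H}$ is a complex Hilbert space. The operator $A=T+B$ has domain $\mathrm{Dom}(A)=\mathrm{Dom}(T)$. For a set $S\subset\mathbb{R}$ and $r\ge 0$, the closed $r$-neighborhood of $S$ in $\mathbb{C}$ is $U_r(S)=\{\lambda\in\mathbb{C}:\operatorname{dist}(\lambda,S)\le r\}$. The Riesz projection $Q_j$ is $$Q_j=-\frac{1}{2\pi i}\int_{\Gamma_j}(A-\lambda)^{-1}\,d\lambda,\qquad \Gamma_j=\partial U_{b'}(\Delta_j),$$ with any $b'\in(b,d/2)$, the contour being traversed anti-clockwise. A family of subspaces $\{\mathcal{L}_j\}_{j\in J}$ of $\mathcal{H}$ is a basis (of subspaces) if every $x\in\mathcal{H}$ is uniquely represented by a series $x=\sum_{j\in J}x_j$ with $x_j\in\mathcal{L}_j$, converging in the norm of $\mathcal{H}$ (for $J=\mathbb{Z}$ the sum is understood as $\lim_{n\to\infty}\sum_{j=-n}^{n}x_j$). The basis is unconditional (also called a Riesz basis of subspaces) if, for every $x$, this series converges to $x$ after any rearrangement of its terms. Zero subspaces are allowed in the family. *)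

theory Defs
  imports "HOL-Complex_Analysis.Complex_Analysis" "HOL-Library.Disjoint_Sets"
begin

section \<open>Complex Hilbert spaces\<close>

text \<open>The inner product is linear in its first argument.\<close>

class complex_hilbert_space = banach +
  fixes scaleC :: "complex \<Rightarrow> 'a \<Rightarrow> 'a" (infixr "*\<^sub>C" 75)
    and cinner :: "'a \<Rightarrow> 'a \<Rightarrow> complex"
  assumes scaleC_add_right: "c *\<^sub>C (x + y) = c *\<^sub>C x + c *\<^sub>C y"
    and scaleC_add_left: "(c + c') *\<^sub>C x = c *\<^sub>C x + c' *\<^sub>C x"
    and scaleC_scaleC: "c *\<^sub>C (c' *\<^sub>C x) = (c * c') *\<^sub>C x"
    and scaleR_scaleC: "r *\<^sub>R x = complex_of_real r *\<^sub>C x"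
    and cinner_commute: "cinner x y = cnj (cinner y x)"
    and cinner_add_left: "cinner (x + y) z = cinner x z + cinner y z"
    and cinner_scaleC_left: "cinner (c *\<^sub>C x) y = c * cinner x y"
    and cinner_ge_zero: "0 \<le> Re (cinner x x)"
    and cinner_eq_zero_iff: "cinner x x = 0 \<longleftrightarrow> x = 0"
    and norm_eq_sqrt_cinner: "norm x = sqrt (Re (cinner x x))"

instantiation complex :: complex_hilbert_space
begin

definition "scaleC_complex (c :: complex) (x :: complex) = c * x"
definition "cinner_complex (x :: complex) (y :: complex) = x * cnj y"

instance
  by standard
    (auto simp: scaleC_complex_def cinner_complex_def algebra_simps scaleR_conv_of_real
      cmod_def power2_eq_square)

end

lemma norm_scaleC:
  fixes x :: "'a::complex_hilbert_space"
  shows "norm (c *\<^sub>C x) = cmod c * norm x"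
proof -
  have "cinner (c *\<^sub>C x) (c *\<^sub>C x) = c * cnj (c * cinner x x)"
    by (metis cinner_commute cinner_scaleC_left)
  also have "\<dots> = of_real ((cmod c)\<^sup>2) * cinner x x"
    by (metis cinner_commute complex_cnj_mult complex_norm_square mult.assoc of_real_power)
  finally have "Re (cinner (c *\<^sub>C x) (c *\<^sub>C x)) = (cmod c)\<^sup>2 * Re (cinner x x)"
    by simp
  then show ?thesis
    by (simp add: norm_eq_sqrt_cinner[where 'a = 'a] real_sqrt_mult)
qed

lemma bounded_linear_scaleC: "bounded_linear (\<lambda>x :: 'a::complex_hilbert_space. c *\<^sub>C x)"
  by (rule bounded_linear_intro[where K = "cmod c"])
    (simp_all add: scaleC_add_right scaleR_scaleC scaleC_scaleC norm_scaleC mult.commute)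

definition csubspace :: "'a::complex_hilbert_space set \<Rightarrow> bool" where
  "csubspace M \<longleftrightarrow>
     0 \<in> M \<and> (\<forall>x\<in>M. \<forall>y\<in>M. x + y \<in> M) \<and> (\<forall>c. \<forall>x\<in>M. c *\<^sub>C x \<in> M)"

definition bounded_clinear :: "('a::complex_hilbert_space \<Rightarrow> 'a) \<Rightarrow> bool" where
  "bounded_clinear B \<longleftrightarrow> bounded_linear B \<and> (\<forall>c x. B (c *\<^sub>C x) = c *\<^sub>C B x)"


section \<open>Unbounded operators\<close>

text \<open>
  An operator is a pair of a domain \<open>D\<close> and a function \<open>T\<close>; the values of \<open>T\<close> outside
  \<open>D\<close> play no role.
\<close>

definition linear_operator :: "'a::complex_hilbert_space set \<Rightarrow> ('a \<Rightarrow> 'a) \<Rightarrow> bool" where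
  "linear_operator D T \<longleftrightarrow> csubspace D \<and>
     (\<forall>x\<in>D. \<forall>y\<in>D. T (x + y) = T x + T y) \<and> (\<forall>c. \<forall>x\<in>D. T (c *\<^sub>C x) = c *\<^sub>C T x)"

definition adjoint_graph ::
  "'a::complex_hilbert_space set \<Rightarrow> ('a \<Rightarrow> 'a) \<Rightarrow> ('a \<times> 'a) set" where
  "adjoint_graph D T = {(y, z). \<forall>x\<in>D. cinner (T x) y = cinner x z}"

definition self_adjoint_operator ::
  "'a::complex_hilbert_space set \<Rightarrow> ('a \<Rightarrow> 'a) \<Rightarrow> bool" where
  "self_adjoint_operator D T \<longleftrightarrow>
     linear_operator D T \<and> closure D = UNIV \<and> adjoint_graph D T = {(x, T x) | x. x \<in> D}"

definition resolvent_set ::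
  "'a::complex_hilbert_space set \<Rightarrow> ('a \<Rightarrow> 'a) \<Rightarrow> complex set" where
  "resolvent_set D A =
     {z. bij_betw (\<lambda>x. A x - z *\<^sub>C x) D UNIV \<and>
         bounded_linear (inv_into D (\<lambda>x. A x - z *\<^sub>C x))}"

definition op_spectrum ::
  "'a::complex_hilbert_space set \<Rightarrow> ('a \<Rightarrow> 'a) \<Rightarrow> complex set" where
  "op_spectrum D A = - resolvent_set D A"

text \<open>\<open>(A - z)\<^sup>-\<^sup>1\<close>, meaningful for \<open>z\<close> in the resolvent set.\<close>

definition resolvent ::
  "'a::complex_hilbert_space set \<Rightarrow> ('a \<Rightarrow> 'a) \<Rightarrow> complex \<Rightarrow> 'a \<Rightarrow>\<^sub>L 'a" where
  "resolvent D A z = Blinfun (inv_into D (\<lambda>x. A x - z *\<^sub>C x))"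

definition invariant_subspace ::
  "'a::complex_hilbert_space set \<Rightarrow> ('a \<Rightarrow> 'a) \<Rightarrow> 'a set \<Rightarrow> bool" where
  "invariant_subspace D A M \<longleftrightarrow> csubspace M \<and> closed M \<and> A ` (M \<inter> D) \<subseteq> M"


section \<open>Neighbourhoods, contours and Riesz projections\<close>

text \<open>Intended for nonempty \<open>S\<close> only, since \<open>infdist z {} = 0\<close>.\<close>

definition cnbhd :: "real \<Rightarrow> real set \<Rightarrow> complex set" where
  "cnbhd r S = {z. infdist z (complex_of_real ` S) \<le> r}"

text \<open>The boundary of \<open>cnbhd r {p..q}\<close>, traversed once anti-clockwise from \<open>p - \<i> r\<close>.\<close>

definition stadium_path :: "real \<Rightarrow> real \<Rightarrow> real \<Rightarrow> real \<Rightarrow> complex" where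
  "stadium_path p q r =
     linepath (Complex p (- r)) (Complex q (- r)) +++
     part_circlepath (complex_of_real q) r (- pi / 2) (pi / 2) +++
     linepath (Complex q r) (Complex p r) +++
     part_circlepath (complex_of_real p) r (pi / 2) (3 * pi / 2)"

lift_definition scaleC_blinfun ::
  "complex \<Rightarrow> ('a::complex_hilbert_space \<Rightarrow>\<^sub>L 'a) \<Rightarrow> ('a \<Rightarrow>\<^sub>L 'a)"
  is "\<lambda>c F x. c *\<^sub>C F x"
  by (rule bounded_linear_compose[OF bounded_linear_scaleC])

text \<open>
  As in \<^const>\<open>has_contour_integral\<close>, but for operator-valued functions; the integral is taken
  in the Banach space of bounded operators with the operator norm.
\<close>

definition op_contour_integral ::
  "(real \<Rightarrow> complex) \<Rightarrow> (complex \<Rightarrow> 'a::complex_hilbert_space \<Rightarrow>\<^sub>L 'a) \<Rightarrow> 'a \<Rightarrow>\<^sub>L 'a" where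
  "op_contour_integral g F =
     integral {0..1} (\<lambda>t. scaleC_blinfun (vector_derivative g (at t within {0..1})) (F (g t)))"

definition riesz_projection ::
  "'a::complex_hilbert_space set \<Rightarrow> ('a \<Rightarrow> 'a) \<Rightarrow> (real \<Rightarrow> complex) \<Rightarrow> 'a \<Rightarrow>\<^sub>L 'a" where
  "riesz_projection D A g =
     scaleC_blinfun (- 1 / (2 * of_real pi * \<i>)) (op_contour_integral g (resolvent D A))"


section \<open>Bases of subspaces\<close>

text \<open>
  The index set is a set \<open>J\<close> of integers, in practice \<open>\<nat>\<close> or \<open>\<int>\<close>; for these
  \<open>J \<inter> {- n..n}\<close> is \<open>{0..n}\<close> and \<open>{- n..n}\<close>, respectively.
  The coefficient families are normalised outside \<open>J\<close> by \<^const>\<open>PiE\<close>, so that uniqueness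
  concerns indices in \<open>J\<close> only.
\<close>

definition represents ::
  "int set \<Rightarrow> (int \<Rightarrow> 'a::complex_hilbert_space set) \<Rightarrow> 'a \<Rightarrow> (int \<Rightarrow> 'a) \<Rightarrow> bool" where
  "represents J L x f \<longleftrightarrow>
     f \<in> Pi\<^sub>E J L \<and> (\<lambda>n. \<Sum>j\<in>J \<inter> {- int n..int n}. f j) \<longlonglongrightarrow> x"

definition subspace_basis ::
  "int set \<Rightarrow> (int \<Rightarrow> 'a::complex_hilbert_space set) \<Rightarrow> bool" where
  "subspace_basis J L \<longleftrightarrow>
     (\<forall>j\<in>J. csubspace (L j) \<and> closed (L j)) \<and> (\<forall>x. \<exists>!f. represents J L x f)"

definition unconditional_subspace_basis ::
  "int set \<Rightarrow> (int \<Rightarrow> 'a::complex_hilbert_space set) \<Rightarrow> bool" where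
  "unconditional_subspace_basis J L \<longleftrightarrow> subspace_basis J L \<and>
     (\<forall>x f. represents J L x f \<longrightarrow>
        (\<forall>\<sigma> :: nat \<Rightarrow> int. bij_betw \<sigma> UNIV J \<longrightarrow> (\<lambda>k. f (\<sigma> k)) sums x))"

end

theory Submission
  imports Defs
begin

text \<open>
  For \<open>z\<close> at distance \<open>e > b\<close> from the segments, \<open>\<parallel>(T - z)\<^sup>-\<^sup>1\<parallel> \<le> 1/e\<close> and a fixed-point argument
  inverts \<open>A - z\<close>. On the contours, \<open>(A - z)\<^sup>-\<^sup>1 - (T - z)\<^sup>-\<^sup>1\<close> is dominated as a form by
  \<open>\<parallel>(T - z)\<^sup>-\<^sup>1 x\<parallel> \<parallel>(T - z)\<^sup>-\<^sup>1 y\<parallel>\<close>. Sampling every contour at points \<open>a + \<i> b'\<close> whose real parts are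
  globally \<open>d\<close>-separated, the square sums of \<open>\<parallel>(T - z)\<^sup>-\<^sup>1 x\<parallel>\<close> over all sample points are bounded by
  a multiple of \<open>\<parallel>x\<parallel>\<^sup>2\<close>. Since the Riesz projections of \<open>T\<close> are orthogonal, this bounds
  \<open>\<Sum>\<bar>\<langle>Q\<^sub>j x, y\<rangle>\<bar>\<close>, hence all signed sums \<open>\<Sum>\<plusminus>Q\<^sub>j\<close>, uniformly, and \<open>\<Sum>Q\<^sub>j x\<close> converges unconditionally.
  If every \<open>Q\<^sub>j u\<close> vanishes, then \<open>(A - z)\<^sup>-\<^sup>1 u\<close> extends to a bounded entire function that decays
  along the imaginary axis, so \<open>u = 0\<close>; applied to \<open>u = x - \<Sum>Q\<^sub>j x\<close> this gives the expansion.
\<close>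

section \<open>Complex Hilbert spaces and symmetric operators\<close>

text \<open>The segments may be arbitrarily long, so no bound of the form length times supremum
  controls the contours uniformly, and norm bounds on the single \<open>Q j\<close> would not be
  summable over j anyway. The second resolvent identity, however, leaves one resolvent of T next to
  x and, after passing to the adjoint, one next to y. Two square sums are then enough, and these
  depend only on the sample points being separated on one horizontal line, not on how they are
  distributed over the segments. Only the difference from the unperturbed projections is treated
  this way; those projections themselves are not small and are handled by Bessel's inequality. No
  spectral measure enters: identities for symmetric operators, above all |(T - z) x|^2 = |(T - Re z)
  x|^2 + (Im z)^2 |x|^2, and contour calculus with the resolvent identity replace it. The condition
  b < d/2 leaves room for a radius r between b and d/2: contours of this radius are disjoint and
  keep distance r > b from all segments, so one bound 1/(r - b) for the perturbed resolvent serves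
  every j. The same uniformity makes the entire function bounded.\<close>

lemma scaleC_simps [simp]:
  fixes x :: "'a::complex_hilbert_space"
  shows "c *\<^sub>C (0::'a) = 0" "0 *\<^sub>C x = 0" "1 *\<^sub>C x = x" "(- c) *\<^sub>C x = - (c *\<^sub>C x)"
    "c *\<^sub>C (- x) = - (c *\<^sub>C x)"
proof -
  interpret bounded_linear "\<lambda>x :: 'a. c *\<^sub>C x" by (rule bounded_linear_scaleC)
  show "c *\<^sub>C (0::'a) = 0" "c *\<^sub>C (- x) = - (c *\<^sub>C x)" by (rule zero, rule neg)
  show z: "0 *\<^sub>C x = 0" using scaleC_add_left[of 0 0 x] by simp
  show "1 *\<^sub>C x = x" using scaleR_scaleC[of 1 x] by simp
  show "(- c) *\<^sub>C x = - (c *\<^sub>C x)"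
    using scaleC_add_left[of c "-c" x] z by (simp add: eq_neg_iff_add_eq_0 add.commute)
qed

lemma scaleC_diff_left: "(c - c') *\<^sub>C x = c *\<^sub>C x - c' *\<^sub>C (x::'a::complex_hilbert_space)"
  using scaleC_add_left[of c "-c'" x] by simp

lemma scaleC_diff_right: "c *\<^sub>C (x - y) = c *\<^sub>C x - c *\<^sub>C (y::'a::complex_hilbert_space)"
  using scaleC_add_right[of c x "-y"] by simp

lemma scaleC_left_cancel:
  assumes "c \<noteq> 0" "c *\<^sub>C x = c *\<^sub>C (y::'a::complex_hilbert_space)"
  shows "x = y"
proof -
  have "inverse c *\<^sub>C c *\<^sub>C x = inverse c *\<^sub>C c *\<^sub>C y" by (simp only: assms(2))
  then show ?thesis using assms(1) by (simp add: scaleC_scaleC)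
qed

lemma cinner_add_right: "cinner x (y + z) = cinner x y + cinner x (z::'a::complex_hilbert_space)"
  by (metis cinner_add_left cinner_commute complex_cnj_add)

lemma cinner_scaleC_right: "cinner x (c *\<^sub>C y) = cnj c * cinner x (y::'a::complex_hilbert_space)"
  by (metis cinner_commute cinner_scaleC_left complex_cnj_mult)

lemma cinner_simps [simp]:
  fixes x y :: "'a::complex_hilbert_space"
  shows "cinner 0 x = 0" "cinner x 0 = 0" "cinner (- x) y = - cinner x y"
    "cinner x (- y) = - cinner x y"
proof -
  show "cinner 0 x = 0" using cinner_scaleC_left[of 0 0 x] by simp
  show "cinner x 0 = 0" using cinner_scaleC_right[of x 0 0] by simp
  show "cinner (- x) y = - cinner x y" using cinner_scaleC_left[of "-1" x y] by simp
  show "cinner x (- y) = - cinner x y" using cinner_scaleC_right[of x "-1" y] by simp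
qed

lemma cinner_diff_left: "cinner (x - y) z = cinner x z - cinner y (z::'a::complex_hilbert_space)"
  using cinner_add_left[of x "-y" z] by simp

lemma cinner_diff_right: "cinner x (y - z) = cinner x y - cinner x (z::'a::complex_hilbert_space)"
  using cinner_add_right[of x y "-z"] by simp

lemma cinner_sum_left: "cinner (\<Sum>i\<in>F. f i) y = (\<Sum>i\<in>F. cinner (f i) (y::'a::complex_hilbert_space))"
  by (induction F rule: infinite_finite_induct) (auto simp: cinner_add_left)

lemma cinner_sum_right: "cinner y (\<Sum>i\<in>F. f i) = (\<Sum>i\<in>F. cinner (y::'a::complex_hilbert_space) (f i))"
  by (induction F rule: infinite_finite_induct) (auto simp: cinner_add_right)

lemma norm_power2_eq_cinner: "(norm x)\<^sup>2 = Re (cinner x (x::'a::complex_hilbert_space))"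
  by (simp add: norm_eq_sqrt_cinner[of x] cinner_ge_zero)

lemma cinner_self: "cinner x x = of_real ((norm (x::'a::complex_hilbert_space))\<^sup>2)"
proof -
  have "Im (cinner x x) = 0" using cinner_commute[of x x] by (metis Reals_cnj_iff complex_is_Real_iff)
  then show ?thesis by (simp add: complex_eq_iff norm_power2_eq_cinner)
qed

lemma norm_add_power2:
  "(norm (x + y))\<^sup>2 = (norm x)\<^sup>2 + 2 * Re (cinner x y) + (norm (y::'a::complex_hilbert_space))\<^sup>2"
proof -
  have "Re (cinner y x) = Re (cinner x y)" by (subst cinner_commute) simp
  then show ?thesis by (simp add: norm_power2_eq_cinner cinner_add_left cinner_add_right)
qed

lemma norm_diff_power2:
  "(norm (x - y))\<^sup>2 = (norm x)\<^sup>2 - 2 * Re (cinner x y) + (norm (y::'a::complex_hilbert_space))\<^sup>2"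
  using norm_add_power2[of x "-y"] by simp

lemma cinner_cauchy_schwarz: "cmod (cinner x y) \<le> norm x * norm (y::'a::complex_hilbert_space)"
proof (cases "y = 0")
  case False
  define u where "u = (cinner x y / cinner y y) *\<^sub>C y"
  have y: "cinner y y \<noteq> 0" using False by (simp add: cinner_eq_zero_iff)
  have "cinner x u = cnj (cinner x y / cinner y y) * cinner x y"
    by (simp add: u_def cinner_scaleC_right)
  also have "\<dots> = of_real ((cmod (cinner x y))\<^sup>2 / (norm y)\<^sup>2)"
    by (simp add: cinner_self complex_norm_square mult.commute del: of_real_power)
  finally have 1: "Re (cinner x u) = (cmod (cinner x y))\<^sup>2 / (norm y)\<^sup>2" by (metis Re_complex_of_real)
  have 2: "(norm u)\<^sup>2 = (cmod (cinner x y))\<^sup>2 / (norm y)\<^sup>2"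
    using False
    by (simp add: u_def norm_scaleC norm_divide cinner_self power_mult_distrib power_divide norm_power
        power2_eq_square norm_mult)
  have "0 \<le> (norm (x - u))\<^sup>2" by simp
  also have "\<dots> = (norm x)\<^sup>2 - (cmod (cinner x y))\<^sup>2 / (norm y)\<^sup>2"
    using 1 2 by (simp add: norm_diff_power2)
  finally have "(cmod (cinner x y))\<^sup>2 \<le> (norm x * norm y)\<^sup>2"
    using False by (simp add: field_simps power_mult_distrib)
  then show ?thesis by (rule power2_le_imp_le) simp
qed simp

lemma bounded_linear_cinner_left: "bounded_linear (\<lambda>x::'a::complex_hilbert_space. cinner x y)"
  by (rule bounded_linear_intro[where K = "norm y"])
    (simp_all add: cinner_add_left scaleR_scaleC[where 'a = 'a] cinner_scaleC_left
      scaleR_conv_of_real cinner_cauchy_schwarz)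

lemma cinner_eqI: "(\<And>z. cinner x z = cinner y z) \<Longrightarrow> x = (y::'a::complex_hilbert_space)"
  by (metis cinner_diff_left cinner_eq_zero_iff eq_iff_diff_eq_0)

lemma csubspace_diff: "csubspace M \<Longrightarrow> x \<in> M \<Longrightarrow> y \<in> M \<Longrightarrow> x - y \<in> M"
  unfolding csubspace_def by (metis add_uminus_conv_diff scaleC_simps(3,4))

lemma linear_operator_shift:
  assumes "linear_operator D T" "x \<in> D" "y \<in> D"
  shows "T (x + y) - z *\<^sub>C (x + y) = (T x - z *\<^sub>C x) + (T y - z *\<^sub>C y)"
    and "T (x - y) - z *\<^sub>C (x - y) = (T x - z *\<^sub>C x) - (T y - z *\<^sub>C y)"
    and "T (c *\<^sub>C x) - z *\<^sub>C (c *\<^sub>C x) = c *\<^sub>C (T x - z *\<^sub>C x)"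
    and "x + y \<in> D" "c *\<^sub>C x \<in> D" "x - y \<in> D"
proof -
  have s: "csubspace D" and add: "\<And>x y. x \<in> D \<Longrightarrow> y \<in> D \<Longrightarrow> T (x + y) = T x + T y"
    and sc: "\<And>c x. x \<in> D \<Longrightarrow> T (c *\<^sub>C x) = c *\<^sub>C T x"
    using assms(1) by (auto simp: linear_operator_def)
  show "x + y \<in> D" "c *\<^sub>C x \<in> D" "x - y \<in> D"
    using s assms csubspace_diff[OF s] by (auto simp: csubspace_def)
  have yD: "(-1) *\<^sub>C y \<in> D" using s assms(3) by (auto simp only: csubspace_def)
  have m: "T (x - y) = T x - T y" using add[OF assms(2) yD] sc[OF assms(3), of "-1"] by simp
  show "T (x + y) - z *\<^sub>C (x + y) = (T x - z *\<^sub>C x) + (T y - z *\<^sub>C y)"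
    using assms add by (simp add: scaleC_add_right)
  show "T (x - y) - z *\<^sub>C (x - y) = (T x - z *\<^sub>C x) - (T y - z *\<^sub>C y)"
    by (simp add: m scaleC_diff_right)
  show "T (c *\<^sub>C x) - z *\<^sub>C (c *\<^sub>C x) = c *\<^sub>C (T x - z *\<^sub>C x)"
    using assms sc by (simp add: scaleC_diff_right scaleC_scaleC mult.commute)
qed

section \<open>Symmetric operators: lower bounds by the distance to the spectrum\<close>

lemma self_adjoint_symmetric:
  assumes "self_adjoint_operator D T" "x \<in> D" "y \<in> D"
  shows "cinner (T x) y = cinner x (T y)"
  using assms unfolding self_adjoint_operator_def adjoint_graph_def by blast

text \<open>Since <T x, x> is real, (T - Re z) x and (i Im z) x are orthogonal for the real part of
  the inner product, and Pythagoras applies. Horizontal and vertical distance to the spectrum can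
  therefore be treated separately.\<close>

lemma norm_shift_power2:
  fixes T :: "'a::complex_hilbert_space \<Rightarrow> 'a"
  assumes T: "self_adjoint_operator D T" and x: "x \<in> D"
  shows "(norm (T x - z *\<^sub>C x))\<^sup>2 =
    (norm (T x - of_real (Re z) *\<^sub>C x))\<^sup>2 + (Im z)\<^sup>2 * (norm x)\<^sup>2"
proof -
  have "cinner (T x) x = cnj (cinner (T x) x)"
    using self_adjoint_symmetric[OF T x x] cinner_commute[of "T x" x] by simp
  then have im: "Im (cinner (T x) x) = 0" by (metis Reals_cnj_iff complex_is_Real_iff)
  have z: "z *\<^sub>C x = of_real (Re z) *\<^sub>C x + (\<i> * of_real (Im z)) *\<^sub>C x"
    by (subst (1) complex_eq[of z]) (simp add: scaleC_add_left)
  have "Re (cinner (T x - of_real (Re z) *\<^sub>C x) ((\<i> * of_real (Im z)) *\<^sub>C x)) = 0"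
    using im by (simp add: cinner_diff_left cinner_scaleC_left cinner_scaleC_right cinner_self)
  then have "(norm ((T x - of_real (Re z) *\<^sub>C x) - (\<i> * of_real (Im z)) *\<^sub>C x))\<^sup>2 =
    (norm (T x - of_real (Re z) *\<^sub>C x))\<^sup>2 + (norm ((\<i> * of_real (Im z)) *\<^sub>C x))\<^sup>2"
    by (simp add: norm_diff_power2)
  then show ?thesis by (simp add: z algebra_simps norm_scaleC norm_mult power_mult_distrib)
qed

lemma resolvent_set_bounded_below:
  assumes "z \<in> resolvent_set D A"
  shows "\<exists>c>0. \<forall>x\<in>D. c * norm x \<le> norm (A x - z *\<^sub>C x)"
proof -
  define S where "S = inv_into D (\<lambda>x. A x - z *\<^sub>C x)"
  have inj: "inj_on (\<lambda>x. A x - z *\<^sub>C x) D" and S: "bounded_linear S"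
    using assms by (auto simp: resolvent_set_def S_def bij_betw_def)
  obtain K where K: "K > 0" "\<And>x. norm (S x) \<le> norm x * K"
    using bounded_linear.pos_bounded[OF S] by blast
  have "(1/K) * norm x \<le> norm (A x - z *\<^sub>C x)" if "x \<in> D" for x
    using K(2)[of "A x - z *\<^sub>C x"] K(1) inv_into_f_f[OF inj that] by (simp add: S_def field_simps)
  then show ?thesis using K(1) by (intro exI[of _ "1/K"]) auto
qed

text \<open>With \<open>S = (T - l)\<^sup>-\<^sup>1\<close> and \<open>s = \<parallel>S\<parallel> > 1/e\<close>, both \<open>S - s\<close> and \<open>S + s\<close> would be bounded below, since
  \<open>l \<plusminus> 1/s\<close> lie in the resolvent set; but \<open>(S\<^sup>2 - s\<^sup>2) u\<close> is small when \<open>u\<close> almost attains the norm.\<close>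

lemma symmetric_norm_attained:
  fixes S :: "'a::complex_hilbert_space \<Rightarrow> 'a"
  assumes S: "bounded_linear S" and sym: "\<And>u v. cinner (S u) v = cinner u (S v)"
    and c: "c > 0" and s: "s = onorm S" "s > 0"
    and p: "\<And>u. c * norm (S u) \<le> norm (S u - of_real s *\<^sub>C u)"
    and m: "\<And>u. c * norm (S u) \<le> norm (S u + of_real s *\<^sub>C u)"
  shows False
proof -
  interpret bounded_linear S by fact
  have lin: "S (of_real r *\<^sub>C u) = of_real r *\<^sub>C S u" for r u
    using scaleR[of r u] by (simp add: scaleR_scaleC)
  have bd: "norm (S u) \<le> s * norm u" for u using onorm[OF S] s by simp
  \<comment> \<open>\<open>M\<close> is chosen for |(S^2 - s^2) u| >= s^2 |u| / M: factoring S^2 -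
    s^2 and using both lower bounds gives |S S u| <= |w| / c^2, while s^2 |u| <= |S S u| +
    |w|.\<close>
  define M where "M = 1 + 1 / c\<^sup>2"
  have M: "M > 1" using c by (simp add: M_def)
  have key: "(norm (S u))\<^sup>2 \<le> s\<^sup>2 * (1 - 1/M\<^sup>2) * (norm u)\<^sup>2" for u
  proof -
    define w where "w = S (S u) - of_real (s\<^sup>2) *\<^sub>C u"
    define v where "v = S u + of_real s *\<^sub>C u"
    have w: "w = S v - of_real s *\<^sub>C v"
      by (simp add: w_def v_def add lin scaleC_add_right scaleC_scaleC power2_eq_square)
    have "c\<^sup>2 * norm (S (S u)) \<le> c * norm (S (S u) + of_real s *\<^sub>C S u)"
      using mult_left_mono[OF m[of "S u"], of c] c by (simp add: power2_eq_square)
    also have "\<dots> = c * norm (S v)" by (simp add: v_def add lin)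
    also have "\<dots> \<le> norm w" using p[of v] w by simp
    finally have 1: "norm (S (S u)) \<le> norm w / c\<^sup>2" using c by (simp add: field_simps)
    have "s\<^sup>2 * norm u = norm (of_real (s\<^sup>2) *\<^sub>C u)"
      by (simp add: norm_scaleC norm_power s del: of_real_power)
    also have "\<dots> = norm (S (S u) - w)" by (simp add: w_def)
    also have "\<dots> \<le> norm w / c\<^sup>2 + norm w" using norm_triangle_ineq4[of "S (S u)" w] 1 by linarith
    also have "\<dots> = M * norm w" by (simp add: M_def field_simps)
    finally have 2: "(s\<^sup>2 * norm u)\<^sup>2 \<le> M\<^sup>2 * (norm w)\<^sup>2"
      by (metis power_mono power_mult_distrib mult_nonneg_nonneg norm_ge_zero zero_le_power2)
    have "Re (cinner (S (S u)) (of_real (s\<^sup>2) *\<^sub>C u)) = s\<^sup>2 * (norm (S u))\<^sup>2"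
      by (simp add: sym cinner_scaleC_right sym[symmetric, of "S u" u] cinner_self del: of_real_power)
    then have "(norm w)\<^sup>2 = (norm (S (S u)))\<^sup>2 - 2 * s\<^sup>2 * (norm (S u))\<^sup>2 + (s\<^sup>2 * norm u)\<^sup>2"
      by (simp add: w_def norm_diff_power2 norm_scaleC power_mult_distrib norm_power)
    also have "\<dots> \<le> s\<^sup>2 * (s\<^sup>2 * (norm u)\<^sup>2 - (norm (S u))\<^sup>2)"
      using power_mono[OF bd[of "S u"], of 2] by (simp add: power2_eq_square algebra_simps)
    finally have 3: "M\<^sup>2 * (norm w)\<^sup>2 \<le> M\<^sup>2 * (s\<^sup>2 * (s\<^sup>2 * (norm u)\<^sup>2 - (norm (S u))\<^sup>2))"
      by (intro mult_left_mono) auto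
    have "s\<^sup>2 * (s\<^sup>2 * (norm u)\<^sup>2) \<le> s\<^sup>2 * (M\<^sup>2 * (s\<^sup>2 * (norm u)\<^sup>2 - (norm (S u))\<^sup>2))"
      using 2 3 by (simp add: power_mult_distrib algebra_simps power2_eq_square)
    then have "s\<^sup>2 * (norm u)\<^sup>2 \<le> M\<^sup>2 * (s\<^sup>2 * (norm u)\<^sup>2 - (norm (S u))\<^sup>2)"
      by (rule mult_left_le_imp_le) (use s(2) in simp)
    then show ?thesis using M by (simp add: field_simps)
  qed
  \<comment> \<open>The square root of the factor in \<open>key\<close> yields a bound q < s for the
    norm of S, although s is the operator norm.\<close>
  define q where "q = s * sqrt (1 - 1/M\<^sup>2)"
  have M1: "0 \<le> 1 - 1/M\<^sup>2" "1 - 1/M\<^sup>2 < 1" using M by (auto simp: field_simps)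
  have "norm (S u) \<le> q * norm u" for u
    by (rule power2_le_imp_le) (use key[of u] M1 s in \<open>auto simp: q_def power_mult_distrib\<close>)
  then have "s \<le> q" unfolding s(1) by (rule onorm_bound[rotated]) (use M1 s in \<open>auto simp: q_def\<close>)
  moreover have "sqrt (1 - 1/M\<^sup>2) < 1" using M1(2) by simp
  ultimately show False using s(2) by (simp add: q_def)
qed

text \<open>A bounded symmetric operator has its norm or minus its norm in the spectrum. Under
  inversion about l, such a point of modulus above 1/e would become a spectral point of T closer to
  l than e.\<close>

lemma self_adjoint_gap_bound:
  fixes T :: "'a::complex_hilbert_space \<Rightarrow> 'a"
  assumes T: "self_adjoint_operator D T" and e: "e > 0"
    and gap: "\<And>t. \<bar>t - l\<bar> < e \<Longrightarrow> complex_of_real t \<in> resolvent_set D T" and x: "x \<in> D"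
  shows "e * norm x \<le> norm (T x - of_real l *\<^sub>C x)"
proof -
  define f where "f = (\<lambda>x. T x - of_real l *\<^sub>C x)"
  define S where "S = inv_into D f"
  have lo: "linear_operator D T" using T by (simp add: self_adjoint_operator_def)
  have "complex_of_real l \<in> resolvent_set D T" using gap[of l] e by simp
  then have bij: "bij_betw f D UNIV" and S: "bounded_linear S"
    by (auto simp: resolvent_set_def f_def S_def)
  have Sf: "S (f x) = x" if "x \<in> D" for x
    using bij that by (auto simp: S_def bij_betw_def)
  have fS: "f (S u) = u" and SD: "S u \<in> D" for u
    using bij by (auto simp: S_def bij_betw_def f_inv_into_f inv_into_into)
  have symf: "cinner (f x) y = cinner x (f y)" if "x \<in> D" "y \<in> D" for x y
    using self_adjoint_symmetric[OF T that]
    by (simp add: f_def cinner_diff_left cinner_diff_right cinner_scaleC_left cinner_scaleC_right)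
  have sym: "cinner (S u) v = cinner u (S v)" for u v
    using symf[OF SD[of u] SD[of v]] by (simp add: fS)
  define s where "s = onorm S"
  have s0: "s \<ge> 0" using S by (simp add: s_def onorm_pos_le)
  have bd: "norm (S u) \<le> s * norm u" for u using onorm[OF S] by (simp add: s_def)
  have "s \<le> 1/e"
  proof (rule ccontr)
    assume "\<not> s \<le> 1/e"
    then have s: "s > 1/e" by simp
    then have sp: "s > 0" using e by (metis divide_pos_pos less_trans zero_less_one)
    have "1/s < e" using s sp e by (simp add: field_simps)
    then have "complex_of_real (l + 1/s) \<in> resolvent_set D T" "complex_of_real (l - 1/s) \<in> resolvent_set D T"
      using gap[of "l + 1/s"] gap[of "l - 1/s"] sp by auto
    then obtain c1 c2 where c: "c1 > 0" "\<forall>x\<in>D. c1 * norm x \<le> norm (T x - of_real (l + 1/s) *\<^sub>C x)"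
      "c2 > 0" "\<forall>x\<in>D. c2 * norm x \<le> norm (T x - of_real (l - 1/s) *\<^sub>C x)"
      using resolvent_set_bounded_below by meson
    have sS: "s * norm (u - of_real (1/s) *\<^sub>C S u) = norm (S u - of_real s *\<^sub>C u)"
      "s * norm (u + of_real (1/s) *\<^sub>C S u) = norm (S u + of_real s *\<^sub>C u)" for u
    proof -
      have "s * norm v = norm (of_real s *\<^sub>C v)" for v :: 'a using sp by (simp add: norm_scaleC)
      then show "s * norm (u - of_real (1/s) *\<^sub>C S u) = norm (S u - of_real s *\<^sub>C u)"
      "s * norm (u + of_real (1/s) *\<^sub>C S u) = norm (S u + of_real s *\<^sub>C u)"
        using sp by (simp_all add: scaleC_diff_right scaleC_add_right scaleC_scaleC norm_minus_commute add.commute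
            flip: of_real_mult)
    qed
    \<comment> \<open>T - (l +- 1/s) applied to \<open>S u\<close> is u -+ \<open>S u\<close> / s.
      Lower bounds for T at l +- 1/s thus become, after multiplication by s, lower bounds for S at
      +-s.\<close>
    have 1: "T (S u) - of_real (l + 1/s) *\<^sub>C S u = u - of_real (1/s) *\<^sub>C S u"
      "T (S u) - of_real (l - 1/s) *\<^sub>C S u = u + of_real (1/s) *\<^sub>C S u" for u
      using fS[of u] by (auto simp: f_def scaleC_add_left scaleC_diff_left algebra_simps)
    show False
    proof (rule symmetric_norm_attained[OF S sym _ s_def sp])
      show "0 < s * min c1 c2" using sp c by simp
      fix u
      have "min c1 c2 * norm (S u) \<le> c1 * norm (S u)" "min c1 c2 * norm (S u) \<le> c2 * norm (S u)"
        by (auto intro: mult_right_mono)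
      moreover have "c1 * norm (S u) \<le> norm (u - of_real (1/s) *\<^sub>C S u)"
        "c2 * norm (S u) \<le> norm (u + of_real (1/s) *\<^sub>C S u)"
        using c(2,4) SD[of u] 1[of u] by metis+
      ultimately have "min c1 c2 * norm (S u) \<le> norm (u - of_real (1/s) *\<^sub>C S u)"
        "min c1 c2 * norm (S u) \<le> norm (u + of_real (1/s) *\<^sub>C S u)" by linarith+
      then show "s * min c1 c2 * norm (S u) \<le> norm (S u - of_real s *\<^sub>C u)"
        "s * min c1 c2 * norm (S u) \<le> norm (S u + of_real s *\<^sub>C u)"
        unfolding sS[symmetric] using sp by (simp_all add: mult.assoc)
    qed
  qed
  then have "e * s \<le> 1" using e by (simp add: field_simps)
  have "e * norm x = e * norm (S (f x))" using Sf[OF x] by simp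
  also have "\<dots> \<le> (e * s) * norm (f x)" using bd[of "f x"] e by (simp add: mult.assoc)
  also have "\<dots> \<le> 1 * norm (f x)" by (rule mult_right_mono) (use \<open>e * s \<le> 1\<close> in auto)
  finally show ?thesis by (simp add: f_def)
qed

text \<open>If the open disc of radius e about z meets the real axis, it cuts out an interval of
  half-length sqrt (e^2 - (Im z)^2) around Re z that is free of spectrum; the squares of the gap
  bound there and of the vertical part add up to e^2. Otherwise Im z alone suffices, which also
  covers e <= 0.\<close>

lemma self_adjoint_resolvent_bound:
  fixes T :: "'a::complex_hilbert_space \<Rightarrow> 'a"
  assumes T: "self_adjoint_operator D T" and spec: "op_spectrum D T \<subseteq> complex_of_real ` \<Delta>"
    and e: "\<And>t. t \<in> \<Delta> \<Longrightarrow> e \<le> cmod (z - of_real t)" and x: "x \<in> D"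
  shows "e * norm x \<le> norm (T x - z *\<^sub>C x)"
proof (cases "e \<le> \<bar>Im z\<bar>")
  case True
  have "(\<bar>Im z\<bar> * norm x)\<^sup>2 \<le> (norm (T x - z *\<^sub>C x))\<^sup>2"
    unfolding norm_shift_power2[OF T x, of z] by (simp add: power_mult_distrib)
  then have "\<bar>Im z\<bar> * norm x \<le> norm (T x - z *\<^sub>C x)" by (rule power2_le_imp_le) simp
  then show ?thesis using mult_right_mono[OF True, of "norm x"] by simp
next
  case False
  then have e0: "e > 0" by linarith
  define r where "r = sqrt (e\<^sup>2 - (Im z)\<^sup>2)"
  have "(Im z)\<^sup>2 < e\<^sup>2" using False by (metis abs_le_square_iff abs_of_pos e0 not_le)
  then have r0: "r > 0" and r2: "r\<^sup>2 = e\<^sup>2 - (Im z)\<^sup>2" by (auto simp: r_def)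
  have "r * norm x \<le> norm (T x - of_real (Re z) *\<^sub>C x)"
  proof (rule self_adjoint_gap_bound[OF T r0 _ x])
    fix t assume t: "\<bar>t - Re z\<bar> < r"
    have "(t - Re z)\<^sup>2 < r\<^sup>2" using t r0 by (metis abs_ge_zero power2_abs power_strict_mono pos2)
    then have "(cmod (z - of_real t))\<^sup>2 < e\<^sup>2"
      using r2 by (simp add: cmod_power2 power2_commute)
    then have "cmod (z - of_real t) < e" using e0 by (simp add: power2_less_imp_less)
    then have "t \<notin> \<Delta>" using e[of t] by auto
    then show "complex_of_real t \<in> resolvent_set D T" using spec by (auto simp: op_spectrum_def)
  qed
  then have "(r * norm x)\<^sup>2 \<le> (norm (T x - of_real (Re z) *\<^sub>C x))\<^sup>2" using r0 by (intro power_mono) auto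
  then have "(e * norm x)\<^sup>2 \<le> (norm (T x - z *\<^sub>C x))\<^sup>2"
    unfolding norm_shift_power2[OF T x, of z] by (simp add: power_mult_distrib r2 algebra_simps)
  then show ?thesis by (rule power2_le_imp_le) simp
qed

section \<open>Bounded perturbations, resolvents and the resolvent identity\<close>

lemma bounded_below_inverse:
  fixes A :: "'a::complex_hilbert_space \<Rightarrow> 'a"
  assumes A: "linear_operator D A" and surj: "\<And>u. \<exists>x\<in>D. A x - z *\<^sub>C x = u"
    and c: "c > 0" and bd: "\<And>x. x \<in> D \<Longrightarrow> c * norm x \<le> norm (A x - z *\<^sub>C x)"
  shows "z \<in> resolvent_set D A"
proof -
  define g where "g = (\<lambda>x. A x - z *\<^sub>C x)"
  have sub: "csubspace D" using A by (simp add: linear_operator_def)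
  have inj: "inj_on g D"
  proof (rule inj_onI)
    fix x y assume xy: "x \<in> D" "y \<in> D" "g x = g y"
    have "c * norm (x - y) \<le> norm (g (x - y))"
      using bd[OF linear_operator_shift(6)[OF A xy(1,2)]] by (simp add: g_def)
    also have "g (x - y) = 0" using linear_operator_shift(2)[OF A xy(1,2), of z] xy(3) by (simp add: g_def)
    finally show "x = y" using c by (simp add: mult_le_0_iff)
  qed
  have bij: "bij_betw g D UNIV"
    unfolding bij_betw_def using inj surj by (auto simp: g_def image_def) (metis)
  have gS: "g (inv_into D g u) = u" and SD: "inv_into D g u \<in> D" for u
    using bij by (auto simp: bij_betw_def f_inv_into_f inv_into_into)
  have "bounded_linear (inv_into D g)"
  proof (rule bounded_linear_intro[where K = "1/c"])
    fix x y :: 'a and r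
    show "inv_into D g (x + y) = inv_into D g x + inv_into D g y"
      using linear_operator_shift(1)[OF A SD[of x] SD[of y], of z] linear_operator_shift(4)[OF A SD[of x] SD[of y]] gS[of x] gS[of y]
      by (intro inv_into_f_eq[OF inj]) (auto simp: g_def)
    show "inv_into D g (r *\<^sub>R x) = r *\<^sub>R inv_into D g x"
      using linear_operator_shift(3)[OF A SD[of x] SD[of x], of "of_real r" z]
        linear_operator_shift(5)[OF A SD[of x] SD[of x], of "of_real r"] gS[of x]
      by (intro inv_into_f_eq[OF inj]) (auto simp: g_def scaleR_scaleC[where 'a = 'a])
    show "norm (inv_into D g x) \<le> norm x * (1/c)"
      using bd[OF SD[of x]] gS[of x] c by (simp add: g_def field_simps)
  qed
  then show ?thesis using bij by (auto simp: resolvent_set_def g_def)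
qed

lemma resolvent_set_perturbed:
  fixes T :: "'a::complex_hilbert_space \<Rightarrow> 'a"
  assumes T: "linear_operator D T" and B: "bounded_clinear B"
    and b: "\<And>x. norm (B x) \<le> b * norm x" and be: "0 \<le> b" "b < e"
    and z: "z \<in> resolvent_set D T" and e: "\<And>x. x \<in> D \<Longrightarrow> e * norm x \<le> norm (T x - z *\<^sub>C x)"
  shows "linear_operator D (\<lambda>x. T x + B x)" (is ?lin)
    and "z \<in> resolvent_set D (\<lambda>x. T x + B x)" (is ?res)
    and "\<And>x. x \<in> D \<Longrightarrow> (e - b) * norm x \<le> norm (T x + B x - z *\<^sub>C x)"
proof -
  have Bl: "bounded_linear B" and Bs: "\<And>c x. B (c *\<^sub>C x) = c *\<^sub>C B x"
    using B by (auto simp: bounded_clinear_def)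
  interpret B: bounded_linear B by fact
  show lin: ?lin
    using T by (auto simp: linear_operator_def B.add Bs scaleC_add_right)
  show low: "(e - b) * norm x \<le> norm (T x + B x - z *\<^sub>C x)" if "x \<in> D" for x
  proof -
    have "norm (T x - z *\<^sub>C x) \<le> norm (T x + B x - z *\<^sub>C x) + norm (B x)"
      using norm_triangle_ineq4[of "T x + B x - z *\<^sub>C x" "B x"] by (simp add: algebra_simps)
    then show ?thesis using e[OF that] b[of x] by (simp add: algebra_simps)
  qed
  define S where "S = inv_into D (\<lambda>x. T x - z *\<^sub>C x)"
  have S: "bounded_linear S" and bij: "bij_betw (\<lambda>x. T x - z *\<^sub>C x) D UNIV"
    using z by (auto simp: resolvent_set_def S_def)
  interpret S: bounded_linear S by fact
  have TS: "T (S u) - z *\<^sub>C S u = u" and SD: "S u \<in> D" for u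
  proof -
    have u: "u \<in> (\<lambda>x. T x - z *\<^sub>C x) ` D" using bij by (auto simp: bij_betw_def)
    show "T (S u) - z *\<^sub>C S u = u" using f_inv_into_f[OF u] by (simp add: S_def)
    show "S u \<in> D" using inv_into_into[OF u] by (simp add: S_def)
  qed
  have Sn: "e * norm (S u) \<le> norm u" for u using e[OF SD[of u]] TS[of u] by simp
  show ?res
  proof (rule bounded_below_inverse[OF lin _ _ low])
    fix u
    \<comment> \<open>A solution of (T + B - z) x = u is a fixed point of this map. It contracts
      with ratio b/e on the whole, complete space and takes its values in D, so the fixed point lies
      in D.\<close>
    have "\<exists>!x. S (u - B x) = x"
    proof (rule banach_fix_type[of "b/e"])
      show "\<forall>x y. dist (S (u - B x)) (S (u - B y)) \<le> b/e * dist x y"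
      proof (intro allI)
        fix x y
        have "e * dist (S (u - B x)) (S (u - B y)) = e * norm (S (B (y - x)))"
          by (simp add: dist_norm S.diff B.diff)
        also have "\<dots> \<le> b * dist x y" using Sn[of "B (y - x)"] b[of "y - x"]
          by (simp add: dist_norm norm_minus_commute)
        finally show "dist (S (u - B x)) (S (u - B y)) \<le> b/e * dist x y"
          using be by (simp add: field_simps)
      qed
    qed (use be in auto)
    then obtain x where x: "S (u - B x) = x" by blast
    have "T x + B x - z *\<^sub>C x = u" using TS[of "u - B x"] x by (simp add: algebra_simps)
    then show "\<exists>x\<in>D. T x + B x - z *\<^sub>C x = u" using SD[of "u - B x"] x by auto
  qed (use be in auto)
qed

lemma resolvent_props:
  fixes A :: "'a::complex_hilbert_space \<Rightarrow> 'a"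
  assumes A: "linear_operator D A" and z: "z \<in> resolvent_set D A"
  shows resolvent_in_dom: "resolvent D A z u \<in> D"
    and resolvent_right: "A (resolvent D A z u) - z *\<^sub>C resolvent D A z u = u"
    and resolvent_left: "x \<in> D \<Longrightarrow> resolvent D A z (A x - z *\<^sub>C x) = x"
    and resolvent_scaleC: "resolvent D A z (c *\<^sub>C u) = c *\<^sub>C resolvent D A z u"
    and resolvent_norm: "\<lbrakk>0 < e; \<And>x. x \<in> D \<Longrightarrow> e * norm x \<le> norm (A x - z *\<^sub>C x)\<rbrakk> \<Longrightarrow>
      norm (resolvent D A z) \<le> 1 / e"
proof -
  define f where "f = (\<lambda>x. A x - z *\<^sub>C x)"
  have S: "bounded_linear (inv_into D f)" and bij: "bij_betw f D UNIV"
    using z by (auto simp: resolvent_set_def f_def)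
  have ap: "resolvent D A z u = inv_into D f u" for u
    unfolding resolvent_def f_def[symmetric] by (simp add: bounded_linear_Blinfun_apply[OF S])
  have u: "u \<in> f ` D" for u using bij by (auto simp: bij_betw_def)
  show dom: "resolvent D A z u \<in> D" for u by (simp add: ap inv_into_into[OF u])
  show right: "A (resolvent D A z u) - z *\<^sub>C resolvent D A z u = u" for u
    using f_inv_into_f[OF u, of u] by (simp add: ap f_def)
  show left: "resolvent D A z (A x - z *\<^sub>C x) = x" if "x \<in> D" for x
    using bij that inv_into_f_f[of f D x] by (simp add: ap f_def bij_betw_def)
  show "resolvent D A z (c *\<^sub>C u) = c *\<^sub>C resolvent D A z u"
    using left[OF linear_operator_shift(5)[OF A dom[of u] dom[of u], of c]]
      linear_operator_shift(3)[OF A dom[of u] dom[of u], of c z] by (simp add: right)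
  show "norm (resolvent D A z) \<le> 1 / e"
    if e: "0 < e" and l: "\<And>x. x \<in> D \<Longrightarrow> e * norm x \<le> norm (A x - z *\<^sub>C x)"
    by (rule norm_blinfun_bound) (use e l[OF dom] right in \<open>auto simp: field_simps\<close>)
qed

lemma resolvent_identity:
  fixes A :: "'a::complex_hilbert_space \<Rightarrow> 'a"
  assumes A: "linear_operator D A" and z: "z \<in> resolvent_set D A" and w: "w \<in> resolvent_set D A"
  shows "resolvent D A z u - resolvent D A w u = (z - w) *\<^sub>C resolvent D A z (resolvent D A w u)"
proof -
  define v where "v = resolvent D A w u"
  have v: "v \<in> D" "A v - w *\<^sub>C v = u" using resolvent_props[OF A w] by (auto simp: v_def)
  have "u = (A v - z *\<^sub>C v) + (z - w) *\<^sub>C v" using v(2) by (simp add: scaleC_diff_left)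
  then have "resolvent D A z u = resolvent D A z (A v - z *\<^sub>C v) + resolvent D A z ((z - w) *\<^sub>C v)"
    by (simp add: blinfun.add_right)
  then show ?thesis using resolvent_props[OF A z] v by (simp add: v_def)
qed

section \<open>The stadium contour\<close>

lemma exp_quarter_turns:
  "exp (\<i> * of_real pi / 2) = \<i>" "exp (- (\<i> * of_real pi / 2)) = - \<i>" "exp (\<i> * (3 * of_real pi) / 2) = - \<i>"
proof -
  show 1: "exp (\<i> * of_real pi / 2) = \<i>" using cis_conv_exp[of "pi/2"] by simp
  show "exp (- (\<i> * of_real pi / 2)) = - \<i>" by (simp add: exp_minus 1)
  have 2: "\<i> * (3 * of_real pi) / 2 = of_real pi * \<i> + \<i> * of_real pi / 2" by (simp add: field_simps)
  show "exp (\<i> * (3 * of_real pi) / 2) = - \<i>" unfolding 2 exp_add 1 by simp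
qed

lemma valid_stadium_path [simp]: "valid_path (stadium_path p q r)"
  unfolding stadium_path_def by (intro valid_path_join) (simp_all add: exp_quarter_turns complex_eq_iff)

lemma path_stadium_path [simp]: "path (stadium_path p q r)"
  by (rule valid_path_imp_path) simp

lemma stadium_path_loop [simp]: "pathfinish (stadium_path p q r) = pathstart (stadium_path p q r)"
  unfolding stadium_path_def by (simp add: exp_quarter_turns complex_eq_iff)

lemma stadium_corners:
  "pathstart (part_circlepath (of_real q) r (- pi/2) (pi/2)) = Complex q (- r)"
  "pathfinish (part_circlepath (of_real q) r (- pi/2) (pi/2)) = Complex q r"
  "pathstart (part_circlepath (of_real p) r (pi/2) (3*pi/2)) = Complex p r"
  "pathfinish (part_circlepath (of_real p) r (pi/2) (3*pi/2)) = Complex p (- r)"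
  by (simp_all add: exp_quarter_turns complex_eq_iff)

lemma path_image_stadium_path:
  "path_image (stadium_path p q r) = closed_segment (Complex p (- r)) (Complex q (- r)) \<union>
    (path_image (part_circlepath (of_real q) r (- pi/2) (pi/2)) \<union>
    (closed_segment (Complex q r) (Complex p r) \<union>
    path_image (part_circlepath (of_real p) r (pi/2) (3*pi/2))))"
proof -
  note c = pathstart_linepath pathfinish_linepath pathstart_join stadium_corners path_image_linepath
  have 3: "path_image (linepath (Complex q r) (Complex p r) +++ part_circlepath (of_real p) r (pi/2) (3*pi/2)) =
    closed_segment (Complex q r) (Complex p r) \<union> path_image (part_circlepath (of_real p) r (pi/2) (3*pi/2))"
    by (subst path_image_join) (simp_all only: c)
  have 2: "path_image (part_circlepath (of_real q) r (- pi/2) (pi/2) +++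
      linepath (Complex q r) (Complex p r) +++ part_circlepath (of_real p) r (pi/2) (3*pi/2)) =
    path_image (part_circlepath (of_real q) r (- pi/2) (pi/2)) \<union>
    (closed_segment (Complex q r) (Complex p r) \<union> path_image (part_circlepath (of_real p) r (pi/2) (3*pi/2)))"
    by (subst path_image_join) (simp_all only: c 3)
  show ?thesis unfolding stadium_path_def by (subst path_image_join) (simp_all only: c 2)
qed

text \<open>The cross term in the law of cosines is nonnegative: the radius vector at angle \<theta>
  does not point from the centre c towards s.\<close>

lemma circle_point_dist:
  assumes "0 \<le> (c - s) * (r * cos \<theta>)" "r \<ge> 0"
  shows "r \<le> cmod (of_real c + of_real r * cis \<theta> - of_real s)"
proof (rule power2_le_imp_le)
  have "(c + r * cos \<theta> - s)\<^sup>2 + (r * sin \<theta>)\<^sup>2 =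
    (c - s)\<^sup>2 + 2 * ((c - s) * (r * cos \<theta>)) + r\<^sup>2 * ((cos \<theta>)\<^sup>2 + (sin \<theta>)\<^sup>2)"
    by algebra
  moreover have "(cos \<theta>)\<^sup>2 + (sin \<theta>)\<^sup>2 = 1" by simp
  ultimately have "(c + r * cos \<theta> - s)\<^sup>2 + (r * sin \<theta>)\<^sup>2 = (c - s)\<^sup>2 + 2 * ((c - s) * (r * cos \<theta>)) + r\<^sup>2"
    by simp
  then have "r\<^sup>2 \<le> (c + r * cos \<theta> - s)\<^sup>2 + (r * sin \<theta>)\<^sup>2"
    using assms(1) zero_le_power2[of "c - s"] by linarith
  then show "r\<^sup>2 \<le> (cmod (of_real c + of_real r * cis \<theta> - of_real s))\<^sup>2"
    by (simp add: cmod_power2)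
qed simp

text \<open>A nearest point of the segment is Re z on the straight sides and the centre of the half
  circle on the arcs. The half circles bulge outwards, so no other point of the segment is
  nearer.\<close>

lemma stadium_path_image:
  assumes pq: "p \<le> q" and r: "r > 0" and z: "z \<in> path_image (stadium_path p q r)"
  shows stadium_dist_le: "\<And>s. s \<in> {p..q} \<Longrightarrow> r \<le> cmod (z - of_real s)"
    and stadium_dist_ex: "\<exists>s\<in>{p..q}. cmod (z - of_real s) = r"
proof -
  have arcq: "(\<forall>s\<in>{p..q}. r \<le> cmod (z - of_real s)) \<and> (\<exists>s\<in>{p..q}. cmod (z - of_real s) = r)"
    if z: "z \<in> path_image (part_circlepath (of_real q) r (- pi/2) (pi/2))"
  proof -
    obtain \<theta> where th: "-pi/2 \<le> \<theta>" "\<theta> \<le> pi/2" "z = of_real q + r * cis \<theta>"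
      using z by (auto simp: path_image_part_circlepath' closed_segment_eq_real_ivl)
    have c: "cos \<theta> \<ge> 0" using th by (intro cos_ge_zero) auto
    have "r \<le> cmod (z - of_real s)" if "s \<in> {p..q}" for s
      using circle_point_dist[of q s r \<theta>] that c r by (simp add: th)
    moreover have "cmod (z - of_real q) = r" using th r by (simp add: norm_mult)
    ultimately show ?thesis using pq by auto
  qed
  have arcp: "(\<forall>s\<in>{p..q}. r \<le> cmod (z - of_real s)) \<and> (\<exists>s\<in>{p..q}. cmod (z - of_real s) = r)"
    if z: "z \<in> path_image (part_circlepath (of_real p) r (pi/2) (3*pi/2))"
  proof -
    obtain \<theta> where th: "pi/2 \<le> \<theta>" "\<theta> \<le> 3*pi/2" "z = of_real p + r * cis \<theta>"
      using z by (auto simp: path_image_part_circlepath' closed_segment_eq_real_ivl)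
    have "cos (\<theta> - pi) \<ge> 0" using th by (intro cos_ge_zero) auto
    then have c: "cos \<theta> \<le> 0" by simp
    have "r \<le> cmod (z - of_real s)" if "s \<in> {p..q}" for s
      using circle_point_dist[of p s r \<theta>] that c r by (simp add: th mult_nonpos_nonpos mult_le_0_iff)
    moreover have "cmod (z - of_real p) = r" using th r by (simp add: norm_mult)
    ultimately show ?thesis using pq by auto
  qed
  have line: "(\<forall>s\<in>{p..q}. r \<le> cmod (z - of_real s)) \<and> (\<exists>s\<in>{p..q}. cmod (z - of_real s) = r)"
    if "Re z \<in> {p..q}" "\<bar>Im z\<bar> = r"
  proof -
    have "r \<le> cmod (z - of_real s)" for s using abs_Im_le_cmod[of "z - of_real s"] that by simp
    moreover have "cmod (z - of_real (Re z)) = r" using that by (simp add: cmod_def)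
    ultimately show ?thesis using that by blast
  qed
  have seg: "Re z \<in> {p..q} \<and> Im z = y"
    if "z \<in> closed_segment (Complex p y) (Complex q y) \<or> z \<in> closed_segment (Complex q y) (Complex p y)"
      for y
  proof -
    have "z \<in> closed_segment (Complex p y) (Complex q y)" using that by (metis closed_segment_commute)
    then show ?thesis using pq by (simp add: closed_segment_same_Im closed_segment_eq_real_ivl)
  qed
  consider "z \<in> closed_segment (Complex p (- r)) (Complex q (- r))"
    | "z \<in> path_image (part_circlepath (of_real q) r (- pi/2) (pi/2))"
    | "z \<in> closed_segment (Complex q r) (Complex p r)"
    | "z \<in> path_image (part_circlepath (of_real p) r (pi/2) (3*pi/2))"
    using z unfolding path_image_stadium_path by blast
  then have "(\<forall>s\<in>{p..q}. r \<le> cmod (z - of_real s)) \<and> (\<exists>s\<in>{p..q}. cmod (z - of_real s) = r)"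
  proof cases
    case 1
    then show ?thesis using line seg[of "-r"] r by simp
  next
    case 3
    then show ?thesis using line seg[of r] r by simp
  qed (use arcp arcq in blast)+
  then show "\<And>s. s \<in> {p..q} \<Longrightarrow> r \<le> cmod (z - of_real s)" "\<exists>s\<in>{p..q}. cmod (z - of_real s) = r"
    by auto
qed

lemma contour_integral_stadium:
  assumes "continuous_on (path_image (stadium_path p q r)) f"
  shows "f contour_integrable_on stadium_path p q r"
    and "contour_integral (stadium_path p q r) f =
      contour_integral (linepath (Complex p (- r)) (Complex q (- r))) f +
      contour_integral (part_circlepath (of_real q) r (- pi/2) (pi/2)) f +
      contour_integral (linepath (Complex q r) (Complex p r)) f +
      contour_integral (part_circlepath (of_real p) r (pi/2) (3*pi/2)) f"
    and "f contour_integrable_on linepath (Complex p (- r)) (Complex q (- r))"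
    and "f contour_integrable_on part_circlepath (of_real q) r (- pi/2) (pi/2)"
    and "f contour_integrable_on linepath (Complex q r) (Complex p r)"
    and "f contour_integrable_on part_circlepath (of_real p) r (pi/2) (3*pi/2)"
proof -
  have 1: "f contour_integrable_on linepath (Complex p (- r)) (Complex q (- r))"
    "f contour_integrable_on linepath (Complex q r) (Complex p r)"
    by (auto intro!: contour_integrable_continuous_linepath continuous_on_subset[OF assms]
        simp: path_image_stadium_path)
  have 2: "f contour_integrable_on part_circlepath (of_real q) r (- pi/2) (pi/2)"
    "f contour_integrable_on part_circlepath (of_real p) r (pi/2) (3*pi/2)"
    by (auto intro!: contour_integrable_continuous_part_circlepath continuous_on_subset[OF assms]
        simp: path_image_stadium_path)
  show "f contour_integrable_on linepath (Complex p (- r)) (Complex q (- r))"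
    "f contour_integrable_on linepath (Complex q r) (Complex p r)"
    "f contour_integrable_on part_circlepath (of_real q) r (- pi/2) (pi/2)"
    "f contour_integrable_on part_circlepath (of_real p) r (pi/2) (3*pi/2)"
    using 1 2 by auto
  show "f contour_integrable_on stadium_path p q r"
    using 1 2 unfolding stadium_path_def
    by (simp add: contour_integrable_join valid_path_join exp_quarter_turns complex_eq_iff)
  show "contour_integral (stadium_path p q r) f =
      contour_integral (linepath (Complex p (- r)) (Complex q (- r))) f +
      contour_integral (part_circlepath (of_real q) r (- pi/2) (pi/2)) f +
      contour_integral (linepath (Complex q r) (Complex p r)) f +
      contour_integral (part_circlepath (of_real p) r (pi/2) (3*pi/2)) f"
    using 1 2 unfolding stadium_path_def
    by (simp add: contour_integrable_join valid_path_join exp_quarter_turns complex_eq_iff)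
qed

text \<open>Reflection in the real axis maps the stadium onto itself but reverses its orientation,
  hence the minus sign. This symmetry is what makes the Riesz projections of T self-adjoint.\<close>

lemma contour_integral_stadium_cnj:
  assumes "continuous_on (path_image (stadium_path p q r)) f"
    and "continuous_on (path_image (stadium_path p q r)) (cnj \<circ> f \<circ> cnj)"
  shows "contour_integral (stadium_path p q r) (cnj \<circ> f \<circ> cnj) =
    - cnj (contour_integral (stadium_path p q r) f)"
proof -
  have L: "contour_integral (linepath a b) (cnj \<circ> f \<circ> cnj) =
    - cnj (contour_integral (linepath (cnj b) (cnj a)) f)" for a b
  proof -
    have "cnj \<circ> linepath a b = linepath (cnj a) (cnj b)" by (auto simp: linepath_def fun_eq_iff)
    then have "contour_integral (linepath (cnj a) (cnj b)) f =
      cnj (contour_integral (linepath a b) (cnj \<circ> f \<circ> cnj))"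
      using contour_integral_cnj[of "linepath a b" f] by simp
    then show ?thesis
      by (metis complex_cnj_cnj complex_cnj_minus contour_integral_reversepath reversepath_linepath valid_path_linepath)
  qed
  have C: "contour_integral (part_circlepath c r a b) (cnj \<circ> f \<circ> cnj) =
    - cnj (contour_integral (part_circlepath (cnj c) r (-b) (-a)) f)" for a b c
  proof -
    have "cnj \<circ> part_circlepath c r a b = part_circlepath (cnj c) r (-a) (-b)"
      by (simp add: part_circlepath_cnj fun_eq_iff)
    then have "contour_integral (part_circlepath (cnj c) r (-a) (-b)) f =
      cnj (contour_integral (part_circlepath c r a b) (cnj \<circ> f \<circ> cnj))"
      using contour_integral_cnj[of "part_circlepath c r a b" f] by simp
    then show ?thesis
      by (metis complex_cnj_cnj complex_cnj_minus contour_integral_part_circlepath_reverse)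
  qed
  \<comment> \<open>Reflected and reversed, the left half circle runs from -3 pi/2 to -pi/2: the
    original arc with all angles shifted by 2 pi.\<close>
  have P: "part_circlepath (of_real p) r (- (3*pi/2)) (- (pi/2)) =
    part_circlepath (of_real p) r (pi/2) (3*pi/2)"
  proof
    fix x
    have "\<i> * linepath (of_real (pi/2)) (of_real (3*pi/2)) x =
      \<i> * linepath (of_real (- (3*pi/2))) (of_real (- (pi/2))) x + 2 * of_real pi * \<i>"
      by (simp add: linepath_def scaleR_conv_of_real field_simps)
    then have "exp (\<i> * linepath (of_real (pi/2)) (of_real (3*pi/2)) x) =
      exp (\<i> * linepath (of_real (- (3*pi/2))) (of_real (- (pi/2))) x)"
      by (simp only: exp_add exp_two_pi_i mult_1_right)
    then show "part_circlepath (of_real p) r (- (3*pi/2)) (- (pi/2)) x =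
      part_circlepath (of_real p) r (pi/2) (3*pi/2) x"
      by (simp add: part_circlepath_def linepath_def scaleR_conv_of_real)
  qed
  have c: "cnj (Complex a b) = Complex a (-b)" for a b by (simp add: complex_eq_iff)
  show ?thesis
    unfolding contour_integral_stadium(2)[OF assms(1)] contour_integral_stadium(2)[OF assms(2)]
    using P by (simp add: L C c algebra_simps)
qed

section \<open>Winding numbers and deformation of the stadium\<close>

lemma stadium_path_Re:
  assumes "p \<le> q" "r > 0" "z \<in> path_image (stadium_path p q r)"
  shows "p - r \<le> Re z" "Re z \<le> q + r"
proof -
  obtain s where s: "s \<in> {p..q}" "cmod (z - of_real s) = r" using stadium_dist_ex[OF assms] by blast
  then show "p - r \<le> Re z" "Re z \<le> q + r" using abs_Re_le_cmod[of "z - of_real s"] by auto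
qed

text \<open>Two branches of the logarithm serve as primitives: \<open>Ln (z - p)\<close> on the
  three pieces with Re z >= p and \<open>Ln (p - z)\<close> on the left half circle. They change
  over at p +- i r, and each contributes pi i.\<close>

lemma winding_number_stadium_endpoint:
  assumes pq: "p \<le> q" and r: "r > 0"
  shows "winding_number (stadium_path p q r) (of_real p) = 1"
proof -
  define f where "f = (\<lambda>z. 1 / (z - complex_of_real p))"
  have ne: "z \<noteq> of_real p" if "z \<in> path_image (stadium_path p q r)" for z
    using stadium_dist_le[OF pq r that, of p] pq r by auto
  then have notin: "of_real p \<notin> path_image (stadium_path p q r)" by blast
  have cont: "continuous_on (path_image (stadium_path p q r)) f"
    unfolding f_def using ne by (intro continuous_intros) auto
  have right: "contour_integral g f = Ln (pathfinish g - of_real p) - Ln (pathstart g - of_real p)"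
    if g: "valid_path g" "path_image g \<subseteq> path_image (stadium_path p q r)" "\<And>z. z \<in> path_image g \<Longrightarrow> p \<le> Re z"
      for g
  proof (rule contour_integral_unique, rule contour_integral_primitive[OF _ g(1) order_refl])
    fix z assume z: "z \<in> path_image g"
    have "z - of_real p \<notin> \<real>\<^sub>\<le>\<^sub>0"
      using g(3)[OF z] ne[of z] g(2) z by (auto simp: complex_nonpos_Reals_iff complex_eq_iff)
    then show "((\<lambda>z. Ln (z - of_real p)) has_field_derivative f z) (at z within path_image g)"
      unfolding f_def by (auto intro!: derivative_eq_intros simp: inverse_eq_divide)
  qed
  have left: "contour_integral g f = Ln (of_real p - pathfinish g) - Ln (of_real p - pathstart g)"
    if g: "valid_path g" "path_image g \<subseteq> path_image (stadium_path p q r)" "\<And>z. z \<in> path_image g \<Longrightarrow> Re z \<le> p"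
      for g
  proof (rule contour_integral_unique, rule contour_integral_primitive[OF _ g(1) order_refl])
    fix z assume z: "z \<in> path_image g"
    have "of_real p - z \<notin> \<real>\<^sub>\<le>\<^sub>0"
      using g(3)[OF z] ne[of z] g(2) z by (auto simp: complex_nonpos_Reals_iff complex_eq_iff)
    then show "((\<lambda>z. Ln (of_real p - z)) has_field_derivative f z) (at z within path_image g)"
      unfolding f_def using ne[of z] g(2) z by (auto intro!: derivative_eq_intros simp: field_simps)
  qed
  have seg: "p \<le> Re z" if "z \<in> closed_segment (Complex a y) (Complex b y)" "p \<le> a" "p \<le> b" for z a b y
    using that by (auto simp: closed_segment_same_Im closed_segment_eq_real_ivl split: if_splits)
  have I1: "contour_integral (linepath (Complex p (- r)) (Complex q (- r))) f =
      Ln (Complex q (- r) - of_real p) - Ln (Complex p (- r) - of_real p)"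
    by (subst right) (use pq in \<open>auto simp: path_image_stadium_path intro: seg\<close>)
  have I3: "contour_integral (linepath (Complex q r) (Complex p r)) f =
      Ln (Complex p r - of_real p) - Ln (Complex q r - of_real p)"
    by (subst right) (use pq in \<open>auto simp: path_image_stadium_path intro: seg\<close>)
  have I2: "contour_integral (part_circlepath (of_real q) r (- pi/2) (pi/2)) f =
      Ln (Complex q r - of_real p) - Ln (Complex q (- r) - of_real p)"
  proof (subst right)
    fix z assume "z \<in> path_image (part_circlepath (of_real q) r (- pi/2) (pi/2))"
    then obtain \<theta> where th: "-pi/2 \<le> \<theta>" "\<theta> \<le> pi/2" "z = of_real q + r * cis \<theta>"
      by (auto simp: path_image_part_circlepath' closed_segment_eq_real_ivl)
    have "cos \<theta> \<ge> 0" using th by (intro cos_ge_zero) auto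
    then show "p \<le> Re z" using th pq r by (simp add: add_increasing2)
  qed (auto simp only: stadium_corners path_image_stadium_path valid_path_part_circlepath)
  have I4: "contour_integral (part_circlepath (of_real p) r (pi/2) (3*pi/2)) f =
      Ln (of_real p - Complex p (- r)) - Ln (of_real p - Complex p r)"
  proof (subst left)
    fix z assume "z \<in> path_image (part_circlepath (of_real p) r (pi/2) (3*pi/2))"
    then obtain \<theta> where th: "pi/2 \<le> \<theta>" "\<theta> \<le> 3*pi/2" "z = of_real p + r * cis \<theta>"
      by (auto simp: path_image_part_circlepath' closed_segment_eq_real_ivl)
    have "cos (\<theta> - pi) \<ge> 0" using th by (intro cos_ge_zero) auto
    then show "Re z \<le> p" using th r by (simp add: mult_le_0_iff)
  qed (auto simp only: stadium_corners path_image_stadium_path valid_path_part_circlepath)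
  have c: "Complex p r - of_real p = of_real r * \<i>" "Complex p (- r) - of_real p = of_real r * (- \<i>)"
    "of_real p - Complex p (- r) = of_real r * \<i>" "of_real p - Complex p r = of_real r * (- \<i>)"
    by (auto simp: complex_eq_iff)
  have L: "Ln (of_real r * \<i>) - Ln (of_real r * (- \<i>)) = of_real pi * \<i>"
    using r by (subst (1 2) Ln_times_of_real) (auto simp: field_simps)
  have "contour_integral (stadium_path p q r) f = 2 * of_real pi * \<i>"
    unfolding contour_integral_stadium(2)[OF cont] I1 I2 I3 I4 c using L by simp
  then show ?thesis
    by (subst winding_number_valid_path) (use notin in \<open>auto simp: f_def\<close>)
qed

text \<open>The ball around s joins w to s, and the segment joins s to p, both without meeting the
  contour; the winding number is constant along the way.\<close>

lemma winding_number_stadium_inside: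
  assumes pq: "p \<le> q" and r: "r > 0" and s: "s \<in> {p..q}" and w: "cmod (w - of_real s) < r"
  shows "winding_number (stadium_path p q r) w = 1"
proof -
  have "winding_number (stadium_path p q r) w = winding_number (stadium_path p q r) (of_real s)"
  proof (rule winding_number_eq[where S = "ball (of_real s) r"])
    show "ball (of_real s) r \<inter> path_image (stadium_path p q r) = {}"
      using stadium_dist_le[OF pq r _ s] by (fastforce simp: dist_norm norm_minus_commute)
  qed (use w r in \<open>auto simp: dist_norm norm_minus_commute\<close>)
  also have "\<dots> = winding_number (stadium_path p q r) (of_real p)"
  proof (rule winding_number_eq[where S = "complex_of_real ` {p..q}"])
    show "connected (complex_of_real ` {p..q})"
      by (intro connected_continuous_image continuous_intros) auto
    show "complex_of_real ` {p..q} \<inter> path_image (stadium_path p q r) = {}"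
      using stadium_dist_le[OF pq r] r by fastforce
  qed (use s pq in auto)
  also have "\<dots> = 1" by (rule winding_number_stadium_endpoint[OF pq r])
  finally show ?thesis .
qed

lemma winding_number_stadium_outside:
  assumes pq: "p \<le> q" and r: "r > 0" and w: "Re w < p - r \<or> q + r < Re w"
  shows "winding_number (stadium_path p q r) w = 0"
proof (rule winding_number_zero_outside[where s = "{z. p - r \<le> Re z} \<inter> {z. Re z \<le> q + r}"])
  show "convex ({z. p - r \<le> Re z} \<inter> {z. Re z \<le> q + r})"
    by (intro convex_Int convex_halfspace_Re_ge convex_halfspace_Re_le)
qed (use stadium_path_Re[OF pq r] w in auto)

text \<open>Because the parametrisation is affine in the radius, the linear homotopy between two
  stadia passes exactly through the stadia of intermediate radii. Controlling those is enough for
  deforming the contour.\<close>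

lemma stadium_path_affine:
  "stadium_path p q ((1 - u) * r + u * r') t =
    (1 - u) *\<^sub>R stadium_path p q r t + u *\<^sub>R stadium_path p q r' t"
  unfolding stadium_path_def joinpaths_def part_circlepath_def linepath_def
  by (auto simp: complex_eq_iff algebra_simps)

lemma contour_integral_stadium_radius:
  assumes S: "open S" "f holomorphic_on S"
    and sub: "\<And>\<rho>. \<rho> \<in> closed_segment r r' \<Longrightarrow> path_image (stadium_path p q \<rho>) \<subseteq> S"
  shows "contour_integral (stadium_path p q r) f = contour_integral (stadium_path p q r') f"
proof (rule Cauchy_theorem_homotopic_loops[OF _ S valid_stadium_path valid_stadium_path])
  show "homotopic_loops S (stadium_path p q r) (stadium_path p q r')"
  proof (rule homotopic_loops_linear)
    fix t :: real assume t: "t \<in> {0..1}"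
    show "closed_segment (stadium_path p q r t) (stadium_path p q r' t) \<subseteq> S"
    proof
      fix z assume "z \<in> closed_segment (stadium_path p q r t) (stadium_path p q r' t)"
      then obtain u where u: "0 \<le> u" "u \<le> 1" "z = stadium_path p q ((1 - u) * r + u * r') t"
        by (auto simp: closed_segment_def stadium_path_affine)
      have "(1 - u) * r + u * r' \<in> closed_segment r r'" using u by (auto simp: closed_segment_def)
      moreover have "z \<in> path_image (stadium_path p q ((1 - u) * r + u * r'))" using u t
        by (auto simp: path_image_def)
      ultimately show "z \<in> S" using sub by blast
    qed
  qed auto
qed

text \<open>The inside of the contour, written as a union of balls so that openness is immediate;
  its convexity makes Cauchy's theorem for convex sets applicable.\<close>

definition open_stadium :: "real \<Rightarrow> real \<Rightarrow> real \<Rightarrow> complex set" where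
  "open_stadium p q r = (\<Union>s\<in>{p..q}. ball (complex_of_real s) r)"

lemma mem_open_stadium: "w \<in> open_stadium p q r \<longleftrightarrow> (\<exists>s\<in>{p..q}. cmod (w - of_real s) < r)"
  by (auto simp: open_stadium_def dist_norm norm_minus_commute)

lemma open_open_stadium: "open (open_stadium p q r)"
  by (auto simp: open_stadium_def)

lemma convex_open_stadium: "convex (open_stadium p q r)"
proof (rule convexI)
  fix x y u v :: complex and a b :: real
  assume x: "x \<in> open_stadium p q r" and y: "y \<in> open_stadium p q r" and ab: "0 \<le> a" "0 \<le> b" "a + b = 1"
  obtain s t where s: "s \<in> {p..q}" "cmod (x - of_real s) < r" and t: "t \<in> {p..q}" "cmod (y - of_real t) < r"
    using x y by (auto simp: mem_open_stadium)
  have st: "a * s + b * t \<in> {p..q}"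
    using convexD[OF convex_real_interval(5)[of p q] s(1) t(1) ab] by simp
  have "a *\<^sub>R x + b *\<^sub>R y - of_real (a * s + b * t) = a *\<^sub>R (x - of_real s) + b *\<^sub>R (y - of_real t)"
    by (simp add: scaleR_conv_of_real algebra_simps)
  also have "cmod \<dots> \<le> a * cmod (x - of_real s) + b * cmod (y - of_real t)"
    using norm_triangle_ineq[of "a *\<^sub>R (x - of_real s)" "b *\<^sub>R (y - of_real t)"] ab by simp
  also have "\<dots> < r" using convex_bound_lt[OF s(2) t(2) ab] by simp
  finally show "a *\<^sub>R x + b *\<^sub>R y \<in> open_stadium p q r" using st unfolding mem_open_stadium by blast
qed

section \<open>Operator-valued integration and Cauchy transforms along the stadium\<close>

lemma bounded_bilinear_scaleC_blinfun:
  "bounded_bilinear (scaleC_blinfun :: complex \<Rightarrow> ('a::complex_hilbert_space \<Rightarrow>\<^sub>L 'a) \<Rightarrow> _)"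
proof (rule bounded_bilinear.intro)
  fix a a' :: complex and F F' :: "'a \<Rightarrow>\<^sub>L 'a" and r :: real
  show "scaleC_blinfun (a + a') F = scaleC_blinfun a F + scaleC_blinfun a' F"
    by (rule blinfun_eqI) (simp add: scaleC_blinfun.rep_eq plus_blinfun.rep_eq scaleC_add_left)
  show "scaleC_blinfun a (F + F') = scaleC_blinfun a F + scaleC_blinfun a F'"
    by (rule blinfun_eqI) (simp add: scaleC_blinfun.rep_eq plus_blinfun.rep_eq scaleC_add_right)
  show "scaleC_blinfun (r *\<^sub>R a) F = r *\<^sub>R scaleC_blinfun a F"
    by (rule blinfun_eqI)
      (simp add: scaleC_blinfun.rep_eq scaleR_blinfun.rep_eq scaleR_scaleC[where 'a =
        'a] scaleC_scaleC scaleR_conv_of_real)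
  show "scaleC_blinfun a (r *\<^sub>R F) = r *\<^sub>R scaleC_blinfun a F"
    by (rule blinfun_eqI)
      (simp add: scaleC_blinfun.rep_eq scaleR_blinfun.rep_eq scaleR_scaleC[where 'a =
        'a] scaleC_scaleC mult.commute)
next
  show "\<exists>K. \<forall>a (F :: 'a \<Rightarrow>\<^sub>L 'a). norm (scaleC_blinfun a F) \<le> norm a * norm F * K"
  proof (intro exI[of _ 1] allI)
    fix a and F :: "'a \<Rightarrow>\<^sub>L 'a"
    show "norm (scaleC_blinfun a F) \<le> norm a * norm F * 1"
    proof (rule norm_blinfun_bound)
      fix x
      show "norm (scaleC_blinfun a F x) \<le> norm a * norm F * 1 * norm x"
        using mult_left_mono[OF norm_blinfun[of F x], of "norm a"]
        by (simp add: scaleC_blinfun.rep_eq norm_scaleC mult.assoc)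
    qed simp
  qed
qed

lemma has_vector_derivative_joinpaths_left:
  assumes "(g1 has_vector_derivative v) (at (2 * t))" "t < 1/2"
  shows "((g1 +++ g2) has_vector_derivative 2 *\<^sub>R v) (at t)"
proof (rule has_vector_derivative_transform_within_open[where S = "{..<1/2}"])
  have "((\<lambda>x. 2 * x) has_vector_derivative 2) (at t)" by (auto intro!: derivative_eq_intros)
  from vector_diff_chain_at[OF this assms(1)]
  show "((\<lambda>x. g1 (2 * x)) has_vector_derivative 2 *\<^sub>R v) (at t)" by (simp add: o_def)
qed (use assms in \<open>auto simp: joinpaths_def\<close>)

lemma has_vector_derivative_joinpaths_right:
  assumes "(g2 has_vector_derivative v) (at (2 * t - 1))" "1/2 < t"
  shows "((g1 +++ g2) has_vector_derivative 2 *\<^sub>R v) (at t)"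
proof (rule has_vector_derivative_transform_within_open[where S = "{1/2<..}"])
  have "((\<lambda>x. 2 * x - 1) has_vector_derivative 2) (at t)" by (auto intro!: derivative_eq_intros)
  from vector_diff_chain_at[OF this assms(1)]
  show "((\<lambda>x. g2 (2 * x - 1)) has_vector_derivative 2 *\<^sub>R v) (at t)" by (simp add: o_def)
qed (use assms in \<open>auto simp: joinpaths_def\<close>)

text \<open>The joins are nested to the right, so each piece takes half of the remaining parameter
  interval: hence the breakpoints 1/2, 3/4, 7/8 and the speed factors 2, 4, 8, 8.\<close>

lemma stadium_piece_derivative:
  assumes "(u, v) \<in> {(0, 1/2), (1/2, 3/4), (3/4, 7/8), (7/8, 1)}"
  shows "\<exists>c. continuous_on {u..v} c \<and> (\<forall>t\<in>{u<..<v}. (stadium_path p q r has_vector_derivative c t) (at t))"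
proof -
  note join = has_vector_derivative_joinpaths_left has_vector_derivative_joinpaths_right
  define e where "e c s t x = \<i> * complex_of_real r * (of_real t - of_real s) * exp (\<i> * linepath s t x)"
    for c :: complex and s t :: real and x
  have ec: "continuous_on A (\<lambda>x. e c s t (a * x - b))" for A c s t and a b :: real
    unfolding e_def linepath_def by (intro continuous_intros)
  consider "u = 0" "v = 1/2" | "u = 1/2" "v = 3/4" | "u = 3/4" "v = 7/8" | "u = 7/8" "v = 1" using assms
    by auto
  then show ?thesis
  proof cases
    case 1
    show ?thesis unfolding stadium_path_def
      by (rule exI[of _ "\<lambda>_. 2 *\<^sub>R (Complex q (- r) - Complex p (- r))"], intro conjI ballI continuous_intros,
          rule join(1), rule has_vector_derivative_linepath_within)
        (use 1 in auto)
  next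
    case 2
    show ?thesis unfolding stadium_path_def
      by (rule exI[of _ "\<lambda>x. 2 *\<^sub>R (2 *\<^sub>R (e (of_real q) (-pi/2) (pi/2) (4 * x - 2)))"], intro conjI ballI continuous_intros ec,
          rule join(2), rule join(1))
        (use 2 in \<open>auto simp: e_def algebra_simps intro!: has_vector_derivative_eq_rhs[OF has_vector_derivative_part_circlepath]\<close>)
  next
    case 3
    show ?thesis unfolding stadium_path_def
      by (rule exI[of _ "\<lambda>_. 2 *\<^sub>R (2 *\<^sub>R (2 *\<^sub>R (Complex p r - Complex q r)))"], intro conjI ballI continuous_intros,
          rule join(2), rule join(2), rule join(1), rule has_vector_derivative_linepath_within)
        (use 3 in auto)
  next
    case 4
    show ?thesis unfolding stadium_path_def
      by (rule exI[of _ "\<lambda>x. 2 *\<^sub>R (2 *\<^sub>R (2 *\<^sub>R (e (of_real p) (pi/2) (3*pi/2) (8 * x - 7))))"], intro conjI ballI continuous_intros ec,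
          rule join(2), rule join(2), rule join(2))
        (use 4 in \<open>auto simp: e_def algebra_simps intro!: has_vector_derivative_eq_rhs[OF has_vector_derivative_part_circlepath]\<close>)
  qed
qed

text \<open>\<open>op_contour_integral\<close> is defined through \<open>integral\<close>, which
  returns a default value for non-integrable functions; integrability is what allows functionals to
  be moved under it. On each piece the integrand agrees with a continuous function except at the
  ends.\<close>

lemma stadium_op_integrable:
  fixes F :: "complex \<Rightarrow> 'a::complex_hilbert_space \<Rightarrow>\<^sub>L 'a"
  assumes F: "continuous_on (path_image (stadium_path p q r)) F"
  shows "(\<lambda>t. scaleC_blinfun (vector_derivative (stadium_path p q r) (at t within {0..1})) (F (stadium_path p q r t)))
    integrable_on {0..1}" (is "?h integrable_on _")
proof -
  have Fg: "continuous_on {0..1} (\<lambda>t. F (stadium_path p q r t))"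
    by (rule continuous_on_compose2[OF F]) (use path_stadium_path in \<open>auto simp: path_def path_image_def\<close>)
  have piece: "?h integrable_on {u..v}" if uv: "(u, v) \<in> {(0, 1/2), (1/2, 3/4), (3/4, 7/8), (7/8, 1)}"
    for u v
  proof -
    obtain c where c: "continuous_on {u..v} c"
      and d: "\<And>t. t \<in> {u<..<v} \<Longrightarrow> (stadium_path p q r has_vector_derivative c t) (at t)"
      using stadium_piece_derivative[OF uv] by blast
    have sub: "{u..v} \<subseteq> {0..1}" using uv by auto
    have "(\<lambda>t. scaleC_blinfun (c t) (F (stadium_path p q r t))) integrable_on {u..v}"
      by (intro integrable_continuous_real bounded_bilinear.continuous_on[OF bounded_bilinear_scaleC_blinfun] c
          continuous_on_subset[OF Fg sub])
    moreover have "vector_derivative (stadium_path p q r) (at t within {0..1}) = c t" if "t \<in> {u<..<v}"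
      for t
      using vector_derivative_at_within_ivl[OF d[OF that], of 0 1] that sub by auto
    ultimately show ?thesis
      unfolding box_real(2)[symmetric] by (elim integrable_spike_interior[rotated]) auto
  qed
  have "?h integrable_on {7/8..1}" "?h integrable_on {3/4..7/8}" "?h integrable_on {1/2..3/4}" "?h integrable_on {0..1/2}"
    by (auto intro: piece)
  then have "?h integrable_on {3/4..1}" "?h integrable_on {1/2..3/4}" "?h integrable_on {0..1/2}"
    by (auto intro: Henstock_Kurzweil_Integration.integrable_combine[where c = "7/8"])
  then have "?h integrable_on {1/2..1}" "?h integrable_on {0..1/2}"
    by (auto intro: Henstock_Kurzweil_Integration.integrable_combine[where c = "3/4"])
  then show ?thesis
    by (auto intro: Henstock_Kurzweil_Integration.integrable_combine[where c = "1/2"])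
qed

lemma stadium_derivative_bounded:
  "\<exists>B. \<forall>t\<in>{0..1}. norm (vector_derivative (stadium_path p q r) (at t)) \<le> B"
proof -
  define N where "N t = norm (vector_derivative (stadium_path p q r) (at t))" for t
  have "\<exists>B. \<forall>t\<in>{u<..<v}. N t \<le> B" if uv: "(u, v) \<in> {(0, 1/2), (1/2, 3/4), (3/4, 7/8), (7/8, 1)}" for u v
  proof -
    obtain c where c: "continuous_on {u..v} c"
      and d: "\<And>t. t \<in> {u<..<v} \<Longrightarrow> (stadium_path p q r has_vector_derivative c t) (at t)"
      using stadium_piece_derivative[OF uv] by blast
    have "bounded (c ` {u..v})" by (intro compact_imp_bounded compact_continuous_image c) simp
    then obtain B where "\<forall>t\<in>{u..v}. norm (c t) \<le> B" by (auto simp: bounded_iff)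
    then show ?thesis by (intro exI[of _ B]) (auto simp: N_def vector_derivative_at[OF d])
  qed
  then obtain B where B: "\<And>u v t. (u, v) \<in> {(0, 1/2), (1/2, 3/4), (3/4, 7/8), (7/8, 1)} \<Longrightarrow> t \<in> {u<..<v} \<Longrightarrow>
    N t \<le> B u v"
    by metis
  \<comment> \<open>The derivative is not computed at the breakpoints. They are finitely many, so
    whatever the values are, \<open>sum N S\<close> dominates them.\<close>
  define S where "S = {0, 1/2, 3/4, 7/8, 1::real}"
  define M where "M = \<bar>B 0 (1/2)\<bar> + \<bar>B (1/2) (3/4)\<bar> + \<bar>B (3/4) (7/8)\<bar> + \<bar>B (7/8) 1\<bar>"
  have S0: "0 \<le> sum N S" by (auto simp: N_def intro: sum_nonneg)
  have "N t \<le> M + sum N S" if "t \<in> {0..1}" for t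
  proof -
    consider "t \<in> S" | "t \<in> {0<..<1/2}" | "t \<in> {1/2<..<3/4}" | "t \<in> {3/4<..<7/8}" | "t \<in> {7/8<..<1}"
      using \<open>t \<in> {0..1}\<close> unfolding S_def by force
    then show ?thesis
    proof cases
      case 1
      have "N t \<le> sum N S" by (rule member_le_sum[OF 1]) (auto simp: N_def S_def)
      then show ?thesis by (simp add: M_def)
    next
      case 2
      then show ?thesis using B[of 0 "1/2" t] S0 by (auto simp: M_def)
    next
      case 3
      then show ?thesis using B[of "1/2" "3/4" t] S0 by (auto simp: M_def)
    next
      case 4
      then show ?thesis using B[of "3/4" "7/8" t] S0 by (auto simp: M_def)
    next
      case 5
      then show ?thesis using B[of "7/8" 1 t] S0 by (auto simp: M_def)
    qed
  qed
  then show ?thesis unfolding N_def[symmetric] by blast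
qed

lemma stadium_cauchy_transform_holomorphic:
  assumes f: "continuous_on (path_image (stadium_path p q r)) f"
  shows "(\<lambda>w. contour_integral (stadium_path p q r) (\<lambda>z. f z / (z - w))) holomorphic_on - path_image (stadium_path p q r)"
proof (rule holomorphic_onI)
  fix w assume w: "w \<in> - path_image (stadium_path p q r)"
  obtain B where B: "\<And>t. t \<in> {0..1} \<Longrightarrow> norm (vector_derivative (stadium_path p q r) (at t)) \<le> B"
    using stadium_derivative_bounded by blast
  have "((\<lambda>w. contour_integral (stadium_path p q r) (\<lambda>z. f z / (z - w))) has_field_derivative
      (of_nat 1 * contour_integral (stadium_path p q r) (\<lambda>z. f z / (z - w) ^ Suc 1))) (at w)"
  proof (rule Cauchy_next_derivative(2)[OF f B, where S = UNIV])
    fix w assume w: "w \<in> UNIV - path_image (stadium_path p q r)"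
    show "((\<lambda>z. f z / (z - w) ^ 1) has_contour_integral contour_integral (stadium_path p q r) (\<lambda>z. f z / (z - w)))
      (stadium_path p q r)"
      unfolding power_one_right using w
      by (intro has_contour_integral_integral contour_integral_stadium(1) continuous_intros f) auto
  qed (use w in auto)
  then show "(\<lambda>w. contour_integral (stadium_path p q r) (\<lambda>z. f z / (z - w))) field_differentiable at w within - path_image (stadium_path p q r)"
    using field_differentiable_at_within field_differentiable_def by blast
qed

section \<open>Pseudo-resolvents and their Riesz projections\<close>

text \<open>\<open>bounded_linear\<close> is only real-linear, so complex homogeneity is a clause of
  its own. Testing with such functionals reduces operator-valued integrals to scalar contour
  integrals.\<close>

definition cfunctional :: "('a::complex_hilbert_space \<Rightarrow> complex) \<Rightarrow> bool" where
  "cfunctional \<phi> \<longleftrightarrow> bounded_linear \<phi> \<and> (\<forall>c x. \<phi> (c *\<^sub>C x) = c * \<phi> x)"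

lemma cfunctional_cinner: "cfunctional (\<lambda>x. cinner x y)"
  by (simp add: cfunctional_def bounded_linear_cinner_left cinner_scaleC_left)

text \<open>The contour calculus needs nothing about an operator beyond its resolvent identity and
  complex homogeneity. The abstraction lets T on \<open>Om 0\<close> and A on \<open>Om b\<close>
  share it.\<close>

locale pseudo_resolvent =
  fixes Om :: "complex set" and R :: "complex \<Rightarrow> 'a::complex_hilbert_space \<Rightarrow>\<^sub>L 'a"
  assumes open_Om: "open Om"
    and R_scaleC: "z \<in> Om \<Longrightarrow> R z (c *\<^sub>C x) = c *\<^sub>C R z x"
    and R_diff: "z \<in> Om \<Longrightarrow> w \<in> Om \<Longrightarrow> R z x - R w x = (z - w) *\<^sub>C R z (R w x)"
begin

lemma cfunctional_R: "cfunctional \<phi> \<Longrightarrow> w \<in> Om \<Longrightarrow> cfunctional (\<lambda>x. \<phi> (R w x))"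
  by (auto simp: cfunctional_def R_scaleC intro: bounded_linear_compose blinfun.bounded_linear_right)

lemma R_commute:
  assumes "z \<in> Om" "w \<in> Om"
  shows "R z (R w x) = R w (R z x)"
proof (cases "z = w")
  case False
  have "(z - w) *\<^sub>C R z (R w x) = - ((w - z) *\<^sub>C R w (R z x))"
    using R_diff[OF assms, of x] R_diff[OF assms(2,1), of x] by (metis minus_diff_eq)
  also have "\<dots> = (z - w) *\<^sub>C R w (R z x)" by (metis minus_diff_eq scaleC_simps(4))
  finally show ?thesis by (rule scaleC_left_cancel[rotated]) (use False in simp)
qed simp

lemma R_lipschitz:
  assumes "z \<in> Om" "w \<in> Om"
  shows "norm (R z - R w) \<le> cmod (z - w) * norm (R z) * norm (R w)"
proof (rule norm_blinfun_bound)
  fix x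
  have "norm ((R z - R w) x) = cmod (z - w) * norm (R z (R w x))"
    by (simp add: minus_blinfun.rep_eq R_diff[OF assms] norm_scaleC)
  also have "\<dots> \<le> cmod (z - w) * (norm (R z) * (norm (R w) * norm x))"
    by (intro mult_left_mono order_trans[OF norm_blinfun] norm_blinfun) auto
  finally show "norm ((R z - R w) x) \<le> cmod (z - w) * norm (R z) * norm (R w) * norm x"
    by (simp add: mult.assoc)
qed simp

text \<open>This compares resolvents vector by vector, not only in norm: it later replaces the
  resolvent at a contour point by the one at a nearby sample point, applied to the same x.\<close>

lemma R_apply_near:
  assumes "z \<in> Om" "w \<in> Om"
  shows "norm (R z x) \<le> (1 + cmod (z - w) * norm (R z)) * norm (R w x)"
proof -
  have "R z x = R w x + (z - w) *\<^sub>C R z (R w x)" using R_diff[OF assms, of x] by (simp add: algebra_simps)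
  then have "norm (R z x) \<le> norm (R w x) + cmod (z - w) * norm (R z (R w x))"
    using norm_triangle_ineq[of "R w x" "(z - w) *\<^sub>C R z (R w x)"] by (simp add: norm_scaleC)
  also have "\<dots> \<le> norm (R w x) + cmod (z - w) * (norm (R z) * norm (R w x))"
    by (intro add_left_mono mult_left_mono norm_blinfun) auto
  finally show ?thesis by (simp add: algebra_simps)
qed

lemma R_continuous: "continuous_on Om R"
proof -
  have "(R \<longlongrightarrow> R w) (at w within Om)" if w: "w \<in> Om" for w
  proof (rule iffD2[OF Lim_null], rule Lim_null_comparison)
    define K where "K = norm (R w)"
    \<comment> \<open>With this radius |z - w| |R w| <= 1/2, so the Lipschitz estimate, which
      contains the unknown |R z| on its right, can be absorbed and gives |R z| <= 2 |R w|.\<close>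
    define e where "e = 1 / (2 * (K + 1))"
    have K: "K \<ge> 0" by (simp add: K_def)
    then have e: "e > 0" by (simp add: e_def)
    have "norm (R z - R w) \<le> cmod (z - w) * (2 * K * K)" if z: "z \<in> Om" "cmod (z - w) < e" for z
    proof -
      have "cmod (z - w) * K \<le> e * K" using z K by (intro mult_right_mono) auto
      also have "e * K \<le> 1/2" using K by (simp add: e_def field_simps)
      finally have 1: "cmod (z - w) * K \<le> 1/2" .
      have "norm (R z) \<le> K + norm (R z - R w)" unfolding K_def
        by (metis add.commute diff_add_cancel norm_triangle_ineq)
      also have "\<dots> \<le> K + norm (R z) * (cmod (z - w) * K)"
        using R_lipschitz[OF z(1) w] by (simp add: K_def mult_ac)
      also have "\<dots> \<le> K + norm (R z) * (1/2)" using 1 by (intro add_left_mono mult_left_mono) auto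
      finally have "norm (R z) \<le> 2 * K" by simp
      then have "cmod (z - w) * norm (R z) * K \<le> cmod (z - w) * (2 * K) * K"
        using K by (intro mult_right_mono mult_left_mono) auto
      then show ?thesis using R_lipschitz[OF z(1) w] by (simp add: K_def mult_ac)
    qed
    then show "\<forall>\<^sub>F z in at w within Om. norm (R z - R w) \<le> cmod (z - w) * (2 * K * K)"
      using e by (auto simp: eventually_at dist_norm intro!: exI[of _ e])
    show "((\<lambda>z. cmod (z - w) * (2 * K * K)) \<longlongrightarrow> 0) (at w within Om)"
      by (auto intro!: tendsto_eq_intros)
  qed
  then show ?thesis by (simp add: continuous_on_def)
qed

lemma R_functional_continuous:
  assumes "cfunctional \<phi>" "S \<subseteq> Om"
  shows "continuous_on S (\<lambda>z. \<phi> (R z x))"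
proof -
  have "bounded_linear \<phi>" using assms by (simp add: cfunctional_def)
  then show ?thesis
    by (intro bounded_linear.continuous_on[of \<phi>] continuous_intros continuous_on_subset[OF R_continuous assms(2)])
qed

lemma R_functional_holomorphic:
  assumes \<phi>: "cfunctional \<phi>"
  shows "(\<lambda>z. \<phi> (R z x)) holomorphic_on Om"
proof (rule holomorphic_onI)
  fix w assume w: "w \<in> Om"
  have \<phi>': "bounded_linear \<phi>" "\<And>c x. \<phi> (c *\<^sub>C x) = c * \<phi> x" using \<phi> by (auto simp: cfunctional_def)
  have "((\<lambda>z. \<phi> (R z (R w x))) \<longlongrightarrow> \<phi> (R w (R w x))) (at w within Om)"
    using R_functional_continuous[OF \<phi> order_refl, of "R w x"] w by (simp add: continuous_on_def)
  moreover have "\<forall>\<^sub>F z in at w within Om. \<phi> (R z (R w x)) = (\<phi> (R z x) - \<phi> (R w x)) / (z - w)"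
    unfolding eventually_at_filter
  proof (intro always_eventually allI impI)
    fix z assume z: "z \<noteq> w" "z \<in> Om"
    have "\<phi> (R z x) - \<phi> (R w x) = \<phi> ((z - w) *\<^sub>C R z (R w x))"
      using R_diff[OF z(2) w, of x] linear_diff[OF bounded_linear.linear[OF \<phi>'(1)]] by metis
    then show "\<phi> (R z (R w x)) = (\<phi> (R z x) - \<phi> (R w x)) / (z - w)" using z \<phi>'(2) by simp
  qed
  ultimately have "((\<lambda>z. (\<phi> (R z x) - \<phi> (R w x)) / (z - w)) \<longlongrightarrow> \<phi> (R w (R w x))) (at w within Om)"
    by (rule Lim_transform_eventually)
  then show "(\<lambda>z. \<phi> (R z x)) field_differentiable at w within Om"
    by (auto simp: field_differentiable_def has_field_derivative_iff)
qed

section \<open>Riesz projections of a pseudo-resolvent\<close>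

definition Q :: "real \<Rightarrow> real \<Rightarrow> real \<Rightarrow> 'a \<Rightarrow>\<^sub>L 'a" where
  "Q p q r = scaleC_blinfun (- 1 / (2 * of_real pi * \<i>)) (op_contour_integral (stadium_path p q r) R)"

text \<open>A bounded functional commutes with the integral in the Banach space of operators. Every
  identity for \<open>Q\<close> below is checked on the scalar integrals obtained in this
  way.\<close>

lemma functional_Q:
  assumes sub: "path_image (stadium_path p q r) \<subseteq> Om" and \<phi>: "cfunctional \<phi>"
  shows "\<phi> (Q p q r x) = - 1 / (2 * of_real pi * \<i>) * contour_integral (stadium_path p q r) (\<lambda>z. \<phi> (R z x))"
proof -
  define h where "h = (\<lambda>t. scaleC_blinfun (vector_derivative (stadium_path p q r) (at t within {0..1})) (R (stadium_path p q r t)))"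
  have \<phi>': "bounded_linear \<phi>" "\<And>c x. \<phi> (c *\<^sub>C x) = c * \<phi> x" using \<phi> by (auto simp: cfunctional_def)
  have bl: "bounded_linear (\<lambda>F :: 'a \<Rightarrow>\<^sub>L 'a. \<phi> (F x))"
    by (intro bounded_linear_compose[OF \<phi>'(1)] blinfun.bounded_linear_left)
  have "h integrable_on {0..1}"
    unfolding h_def by (rule stadium_op_integrable[OF continuous_on_subset[OF R_continuous sub]])
  from integral_linear[OF this bl]
  have "\<phi> (integral {0..1} h x) = integral {0..1} (\<lambda>t. \<phi> (h t x))" by (simp add: o_def)
  also have "\<dots> = contour_integral (stadium_path p q r) (\<lambda>z. \<phi> (R z x))"
    unfolding contour_integral_integral
    by (rule integral_spike[where S = "{0,1}"])
      (auto simp: h_def scaleC_blinfun.rep_eq \<phi>' mult.commute at_within_Icc_at)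
  finally show ?thesis
    by (simp add: Q_def scaleC_blinfun.rep_eq \<phi>' linear_neg[OF bounded_linear.linear[OF \<phi>'(1)]] op_contour_integral_def h_def)
qed

lemma Q_scaleC:
  assumes "path_image (stadium_path p q r) \<subseteq> Om"
  shows "Q p q r (c *\<^sub>C x) = c *\<^sub>C Q p q r x"
proof (rule cinner_eqI)
  fix y
  have "contour_integral (stadium_path p q r) (\<lambda>z. cinner (R z (c *\<^sub>C x)) y) =
    contour_integral (stadium_path p q r) (\<lambda>z. c * cinner (R z x) y)"
    by (rule contour_integral_eq) (use assms in \<open>auto simp: R_scaleC subset_eq cinner_scaleC_left\<close>)
  also have "\<dots> = c * contour_integral (stadium_path p q r) (\<lambda>z. cinner (R z x) y)"
    by (intro contour_integral_lmul contour_integral_stadium(1) R_functional_continuous cfunctional_cinner assms)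
  finally show "cinner (Q p q r (c *\<^sub>C x)) y = cinner (c *\<^sub>C Q p q r x) y"
    by (simp add: functional_Q[OF assms cfunctional_cinner] cinner_scaleC_left)
qed

lemma Q_R_commute:
  assumes sub: "path_image (stadium_path p q r) \<subseteq> Om" and w: "w \<in> Om"
  shows "Q p q r (R w x) = R w (Q p q r x)"
proof (rule cinner_eqI)
  fix y
  have "contour_integral (stadium_path p q r) (\<lambda>z. cinner (R z (R w x)) y) =
    contour_integral (stadium_path p q r) (\<lambda>z. cinner (R w (R z x)) y)"
    by (rule contour_integral_eq) (use sub w R_commute in auto)
  then show "cinner (Q p q r (R w x)) y = cinner (R w (Q p q r x)) y"
    by (simp add: functional_Q[OF sub cfunctional_cinner] functional_Q[OF sub cfunctional_R[OF cfunctional_cinner w]])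
qed

text \<open>The partial fraction \<open>R w (R z x) = (R z x - R w x) / (z - w)\<close> under the integral defining \<open>Q\<close>.\<close>

lemma R_Q_winding:
  assumes sub: "path_image (stadium_path p q r) \<subseteq> Om" and w: "w \<in> Om" "w \<notin> path_image (stadium_path p q r)"
    and \<phi>: "cfunctional \<phi>"
  shows "\<phi> (R w (Q p q r x)) = winding_number (stadium_path p q r) w * \<phi> (R w x) -
    1 / (2 * of_real pi * \<i>) * contour_integral (stadium_path p q r) (\<lambda>z. \<phi> (R z x) / (z - w))"
proof -
  let ?\<gamma> = "stadium_path p q r"
  have \<phi>': "bounded_linear \<phi>" "\<And>c x. \<phi> (c *\<^sub>C x) = c * \<phi> x" using \<phi> by (auto simp: cfunctional_def)
  have "\<phi> (R w (R z x)) = \<phi> (R z x) / (z - w) - \<phi> (R w x) * (1 / (z - w))" if "z \<in> path_image ?\<gamma>" for z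
  proof -
    have z: "z \<in> Om" "z \<noteq> w" using that sub w by auto
    have "\<phi> (R z x) - \<phi> (R w x) = \<phi> ((z - w) *\<^sub>C R w (R z x))"
      using R_diff[OF z(1) w(1), of x] R_commute[OF z(1) w(1), of x] linear_diff[OF bounded_linear.linear[OF \<phi>'(1)]] by metis
    then have "\<phi> (R w (R z x)) = (\<phi> (R z x) - \<phi> (R w x)) / (z - w)" using z \<phi>'(2) by simp
    then show ?thesis by (simp add: diff_divide_distrib)
  qed
  then have "contour_integral ?\<gamma> (\<lambda>z. \<phi> (R w (R z x))) =
    contour_integral ?\<gamma> (\<lambda>z. \<phi> (R z x) / (z - w) - \<phi> (R w x) * (1 / (z - w)))"
    by (intro contour_integral_eq) auto
  also have "\<dots> = contour_integral ?\<gamma> (\<lambda>z. \<phi> (R z x) / (z - w)) - contour_integral ?\<gamma> (\<lambda>z. \<phi> (R w x) * (1 / (z - w)))"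
    using w by (intro contour_integral_diff contour_integral_stadium(1) continuous_intros R_functional_continuous \<phi> sub) auto
  also have "contour_integral ?\<gamma> (\<lambda>z. \<phi> (R w x) * (1 / (z - w))) =
    \<phi> (R w x) * contour_integral ?\<gamma> (\<lambda>z. 1 / (z - w))"
    using w by (intro contour_integral_lmul contour_integral_stadium(1) continuous_intros) auto
  finally show ?thesis
    using functional_Q[OF sub cfunctional_R[OF \<phi> w(1)], of x] w(2)
    by (simp add: winding_number_valid_path field_simps)
qed

text \<open>Common source of idempotence (c = 1, C a larger open stadium) and of mutual annihilation
  (c = 0, C a half plane). Integrating \<open>R_Q_winding\<close> over the second contour leaves the
  winding term, since the Cauchy transform of the first contour is holomorphic on C and integrates
  to 0.\<close>

lemma Q_Q:
  assumes sub: "path_image (stadium_path p q r) \<subseteq> Om" and sub': "path_image (stadium_path p' q' r') \<subseteq> Om"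
    and C: "open C" "convex C" "path_image (stadium_path p' q' r') \<subseteq>
      C" "C \<inter> path_image (stadium_path p q r) = {}"
    and wn: "\<And>w. w \<in> path_image (stadium_path p' q' r') \<Longrightarrow> winding_number (stadium_path p q r) w = c"
  shows "Q p' q' r' (Q p q r x) = c *\<^sub>C Q p' q' r' x"
proof (rule cinner_eqI)
  fix y
  let ?\<gamma> = "stadium_path p q r" and ?\<gamma>' = "stadium_path p' q' r'"
  define f where "f = (\<lambda>z. cinner (R z x) y)"
  define G where "G = (\<lambda>w. contour_integral ?\<gamma> (\<lambda>z. f z / (z - w)))"
  have fc: "continuous_on (path_image ?\<gamma>) f" and fc': "continuous_on (path_image ?\<gamma>') f"
    unfolding f_def using sub sub' by (auto intro: R_functional_continuous cfunctional_cinner)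
  have "G holomorphic_on - path_image ?\<gamma>"
    unfolding G_def by (rule stadium_cauchy_transform_holomorphic[OF fc])
  then have G: "G holomorphic_on C" by (rule holomorphic_on_subset) (use C in auto)
  have Gint: "(G has_contour_integral 0) ?\<gamma>'"
    by (rule Cauchy_theorem_convex_simple[OF G C(2)]) (use C in auto)
  have "contour_integral ?\<gamma>' (\<lambda>w. cinner (R w (Q p q r x)) y) =
    contour_integral ?\<gamma>' (\<lambda>w. c * f w - 1 / (2 * of_real pi * \<i>) * G w)"
  proof (rule contour_integral_eq)
    fix w assume w: "w \<in> path_image ?\<gamma>'"
    have "w \<notin> path_image ?\<gamma>" using w C by blast
    then show "cinner (R w (Q p q r x)) y = c * f w - 1 / (2 * of_real pi * \<i>) * G w"
      using R_Q_winding[OF sub _ _ cfunctional_cinner, of w x y] w sub' wn[OF w] by (auto simp: f_def G_def)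
  qed
  also have "\<dots> = c * contour_integral ?\<gamma>' f - 1 / (2 * of_real pi * \<i>) * 0"
    by (intro contour_integral_unique has_contour_integral_diff has_contour_integral_lmul Gint
        has_contour_integral_integral contour_integral_stadium(1) fc')
  finally show "cinner (Q p' q' r' (Q p q r x)) y = cinner (c *\<^sub>C Q p' q' r' x) y"
    by (simp add: functional_Q[OF sub' cfunctional_cinner] cinner_scaleC_left f_def)
qed

lemma Q_radius:
  assumes "\<And>\<rho>. \<rho> \<in> closed_segment r r' \<Longrightarrow> path_image (stadium_path p q \<rho>) \<subseteq> Om"
  shows "Q p q r x = Q p q r' x"
proof (rule cinner_eqI)
  fix y
  have "path_image (stadium_path p q r) \<subseteq> Om" "path_image (stadium_path p q r') \<subseteq> Om"
    using assms by auto
  moreover have "contour_integral (stadium_path p q r) (\<lambda>z. cinner (R z x) y) =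
    contour_integral (stadium_path p q r') (\<lambda>z. cinner (R z x) y)"
    by (rule contour_integral_stadium_radius[OF open_Om R_functional_holomorphic[OF cfunctional_cinner] assms])
  ultimately show "cinner (Q p q r x) y = cinner (Q p q r' x) y"
    by (simp add: functional_Q[OF _ cfunctional_cinner])
qed

lemma Q_idempotent:
  assumes pq: "p \<le> q" and r: "0 < r" "r < r'"
    and sub: "\<And>\<rho>. \<rho> \<in> closed_segment r r' \<Longrightarrow> path_image (stadium_path p q \<rho>) \<subseteq> Om"
  shows "Q p q r (Q p q r x) = Q p q r x"
proof -
  have r': "r' > 0" using r by simp
  \<comment> \<open>A contour cannot be composed with itself in \<open>Q_Q\<close>. The inner factor
    is therefore taken over the larger radius, which does not change it by
    \<open>Q_radius\<close>.\<close>
  have "Q p q r (Q p q r' x) = 1 *\<^sub>C Q p q r x"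
  proof (rule Q_Q[where C = "open_stadium p q r'"])
    show inside: "path_image (stadium_path p q r) \<subseteq> open_stadium p q r'"
      unfolding mem_open_stadium subset_eq using stadium_dist_ex[OF pq r(1)] r by metis
    show "winding_number (stadium_path p q r') w = 1" if "w \<in> path_image (stadium_path p q r)" for w
      using subsetD[OF inside that] winding_number_stadium_inside[OF pq r'] unfolding mem_open_stadium
        by blast
    show "open_stadium p q r' \<inter> path_image (stadium_path p q r') = {}"
      using stadium_dist_le[OF pq r'] by (fastforce simp: mem_open_stadium)
  qed (use sub in \<open>auto simp: open_open_stadium convex_open_stadium\<close>)
  moreover have "Q p q r' x = Q p q r x" using Q_radius[of r r' p q x] sub by simp
  ultimately show ?thesis by simp
qed

lemma Q_orthogonal:
  assumes pq: "p \<le> q" "p' \<le> q'" and r: "0 < r" "0 < r'"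
    and sub: "path_image (stadium_path p q r) \<subseteq> Om" "path_image (stadium_path p' q' r') \<subseteq> Om"
    and sep: "q + r < p' - r' \<or> q' + r' < p - r"
  shows "Q p q r (Q p' q' r' x) = 0"
proof -
  have "Q p q r (Q p' q' r' x) = 0 *\<^sub>C Q p q r x"
  proof (rule Q_Q[where C = "if q + r < p' - r' then {z. Re z < p' - r'} else {z. q' + r' < Re z}"])
    show "convex (if q + r < p' - r' then {z. Re z < p' - r'} else {z. q' + r' < Re z})"
      by (simp add: convex_halfspace_Re_lt convex_halfspace_Re_gt)
    show "open (if q + r < p' - r' then {z. Re z < p' - r'} else {z. q' + r' < Re z})"
      by (simp add: open_halfspace_Re_lt open_halfspace_Re_gt)
    show "path_image (stadium_path p q r) \<subseteq>
      (if q + r < p' - r' then {z. Re z < p' - r'} else {z. q' + r' < Re z})"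
      using sep by (auto dest: stadium_path_Re[OF pq(1) r(1)])
    show "(if q + r < p' - r' then {z. Re z < p' - r'} else {z. q' + r' < Re z}) \<inter> path_image (stadium_path p' q' r') = {}"
      by (auto dest: stadium_path_Re[OF pq(2) r(2)])
    show "winding_number (stadium_path p' q' r') w = 0" if "w \<in> path_image (stadium_path p q r)" for w
      using winding_number_stadium_outside[OF pq(2) r(2)] stadium_path_Re[OF pq(1) r(1) that] sep
        by fastforce
  qed (use sub in auto)
  then show ?thesis by simp
qed

end

section \<open>A square sum estimate for self-adjoint resolvents\<close>

text \<open>Telescoping: the two terms added at step N + 1 are at most 4/(N + 1) - 4/(N + 2). The
  constant 5 makes the strengthened bound an equality at N = 0.\<close>

lemma sum_inverse_one_plus_square_le:
  assumes "finite (Z :: int set)"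
  shows "(\<Sum>k\<in>Z. 1 / (1 + (real_of_int k)\<^sup>2)) \<le> 5"
proof -
  have 1: "(\<Sum>k\<in>{- int N..int N}. 1 / (1 + (real_of_int k)\<^sup>2)) \<le> 5 - 4 / (real N + 1)" for N
  proof (induction N)
    case (Suc N)
    have eq: "{- int (Suc N)..int (Suc N)} = insert (- int (Suc N)) (insert (int (Suc N)) {- int N..int N})"
      by auto
    have "(\<Sum>k\<in>{- int (Suc N)..int (Suc N)}. 1 / (1 + (real_of_int k)\<^sup>2)) =
        2 / (1 + (real N + 1)\<^sup>2) + (\<Sum>k\<in>{- int N..int N}. 1 / (1 + (real_of_int k)\<^sup>2))"
      unfolding eq by (subst sum.insert; simp) (simp add: add.commute power2_eq_square algebra_simps)
    also have "\<dots> \<le> 2 / (1 + (real N + 1)\<^sup>2) + (5 - 4 / (real N + 1))" using Suc by simp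
    also have "2 / (1 + (real N + 1)\<^sup>2) \<le> 4 / (real N + 1) - 4 / (real (Suc N) + 1)"
    proof -
      have "4 / (real N + 1) - 4 / (real (Suc N) + 1) = 4 / ((real N + 1) * (real N + 2))"
        by (simp add: field_simps)
      moreover have fr: "2 / u \<le> 4 / v" if "u > 0" "v > 0" "2 * v \<le> 4 * u" for u v :: real
        using that by (simp add: field_simps)
      have "2 / (1 + (real N + 1)\<^sup>2) \<le> 4 / ((real N + 1) * (real N + 2))"
        by (rule fr) (auto simp: power2_eq_square algebra_simps intro!: add_pos_nonneg)
      ultimately show ?thesis by simp
    qed
    finally show ?case by simp
  qed simp
  obtain N where N: "Z \<subseteq> {- int N..int N}"
  proof
    show "Z \<subseteq> {- int (nat (Max (insert 0 (abs ` Z))))..int (nat (Max (insert 0 (abs ` Z))))}"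
    proof
      fix k assume "k \<in> Z"
      then have "\<bar>k\<bar> \<le> Max (insert 0 (abs ` Z))" using assms by (intro Max_ge) auto
      then show "k \<in> {- int (nat (Max (insert 0 (abs ` Z))))..int (nat (Max (insert 0 (abs ` Z))))}" by auto
    qed
  qed
  have "(\<Sum>k\<in>Z. 1 / (1 + (real_of_int k)\<^sup>2)) \<le> (\<Sum>k\<in>{- int N..int N}. 1 / (1 + (real_of_int k)\<^sup>2))"
    by (rule sum_mono2) (use N in \<open>auto simp: add_nonneg_nonneg\<close>)
  also have "\<dots> \<le> 5 - 4 / (real N + 1)" by (rule 1)
  also have "\<dots> \<le> 5" by simp
  finally show ?thesis .
qed

definition separated :: "real \<Rightarrow> real set \<Rightarrow> bool" where
  "separated d X \<longleftrightarrow> (\<forall>a\<in>X. \<forall>b\<in>X. a \<noteq> b \<longrightarrow> d \<le> \<bar>a - b\<bar>)"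

text \<open>Rounding (b - a)/d down is injective on a d-separated set, so the sum is compared with
  one over distinct integers. The bound depends neither on a nor on the size of X.\<close>

lemma separated_sum_le:
  assumes X: "finite X" "separated d X" and d: "d > 0" and r: "r > 0"
  shows "(\<Sum>b\<in>X. 1 / ((a - b)\<^sup>2 / 2 + 2 * r\<^sup>2)) \<le> 5 * (4 / d\<^sup>2 + 3 / (2 * r\<^sup>2))"
proof -
  define k where "k b = \<lfloor>(b - a) / d\<rfloor>" for b
  \<comment> \<open>The two summands match 1 + k^2 <= 2 t^2 + 3 with t = |a - b| / d: 4/d^2 against
    (a - b)^2 / 2 gives 2 t^2, and 3/(2 r^2) against 2 r^2 gives 3.\<close>
  define M where "M = 4 / d\<^sup>2 + 3 / (2 * r\<^sup>2)"
  have inj: "inj_on k X"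
  proof (rule inj_onI, rule ccontr)
    fix b c assume bc: "b \<in> X" "c \<in> X" "k b = k c" "b \<noteq> c"
    have "\<bar>(b - a) / d - (c - a) / d\<bar> < 1" using bc(3) unfolding k_def by linarith
    then have "\<bar>b - c\<bar> < d" using d by (simp add: diff_divide_distrib[symmetric] abs_divide)
    then show False using X(2)[unfolded separated_def, rule_format, OF bc(1,2,4)] by simp
  qed
  have tm: "1 / ((a - b)\<^sup>2 / 2 + 2 * r\<^sup>2) \<le> M * (1 / (1 + (real_of_int (k b))\<^sup>2))" for b
  proof -
    define t where "t = \<bar>(b - a) / d\<bar>"
    have "\<bar>real_of_int (k b)\<bar> \<le> t + 1" unfolding k_def t_def by linarith
    then have "(real_of_int (k b))\<^sup>2 \<le> (t + 1)\<^sup>2" by (metis abs_ge_zero power2_abs power_mono)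
    also have "\<dots> \<le> 2 * t\<^sup>2 + 2" using zero_le_power2[of "t - 1"]
      by (simp add: power2_eq_square algebra_simps)
    finally have "1 + (real_of_int (k b))\<^sup>2 \<le> 3 + 2 * (a - b)\<^sup>2 / d\<^sup>2"
      by (simp add: t_def power_divide power2_commute[of b a])
    also have "\<dots> \<le> 3 + 2 * (a - b)\<^sup>2 / d\<^sup>2 + (8 * r\<^sup>2 / d\<^sup>2 + 3 * (a - b)\<^sup>2 / (4 * r\<^sup>2))" by simp
    also have "\<dots> = M * ((a - b)\<^sup>2 / 2 + 2 * r\<^sup>2)"
      using r by (simp add: M_def distrib_left distrib_right)
    finally have 1: "1 + (real_of_int (k b))\<^sup>2 \<le> M * ((a - b)\<^sup>2 / 2 + 2 * r\<^sup>2)" .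
    have "0 < (a - b)\<^sup>2 / 2 + 2 * r\<^sup>2" using r by (intro add_nonneg_pos) auto
    moreover have "0 < 1 + (real_of_int (k b))\<^sup>2" by (intro add_pos_nonneg) auto
    moreover have "1 / u \<le> M * (1 / v)" if "u > 0" "v > 0" "v \<le> M * u" for u v
      using that by (simp add: field_simps)
    ultimately show ?thesis using 1 by blast
  qed
  have "(\<Sum>b\<in>X. 1 / ((a - b)\<^sup>2 / 2 + 2 * r\<^sup>2)) \<le> (\<Sum>b\<in>X. M * (1 / (1 + (real_of_int (k b))\<^sup>2)))"
    by (rule sum_mono) (rule tm)
  also have "\<dots> = M * (\<Sum>j\<in>k ` X. 1 / (1 + (real_of_int j)\<^sup>2))"
    by (simp add: sum_distrib_left sum.reindex[OF inj])
  also have "\<dots> \<le> M * 5"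
    using X by (intro mult_left_mono sum_inverse_one_plus_square_le) (auto simp: M_def)
  finally show ?thesis by (simp add: M_def mult.commute)
qed

section \<open>Almost orthogonality of self-adjoint resolvents along a horizontal line\<close>

lemma resolvent_adjoint:
  fixes T :: "'a::complex_hilbert_space \<Rightarrow> 'a"
  assumes T: "self_adjoint_operator D T" and z: "z \<in> resolvent_set D T" "cnj z \<in> resolvent_set D T"
  shows "cinner (resolvent D T z u) v = cinner u (resolvent D T (cnj z) v)"
proof -
  have lo: "linear_operator D T" using T by (simp add: self_adjoint_operator_def)
  note 1 = resolvent_props[OF lo z(1)] and 2 = resolvent_props[OF lo z(2)]
  define x y where "x = resolvent D T z u" and "y = resolvent D T (cnj z) v"
  have x: "x \<in> D" "T x - z *\<^sub>C x = u" and y: "y \<in> D" "T y - cnj z *\<^sub>C y = v"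
    using 1 2 by (auto simp: x_def y_def)
  have "cinner x (T y - cnj z *\<^sub>C y) = cinner (T x - z *\<^sub>C x) y"
    using self_adjoint_symmetric[OF T x(1) y(1)]
    by (simp add: cinner_diff_left cinner_diff_right cinner_scaleC_left cinner_scaleC_right)
  then show ?thesis using x y by (simp add: x_def y_def)
qed

lemma resolvent_commute:
  assumes "linear_operator D A" "z \<in> resolvent_set D A" "w \<in> resolvent_set D A"
  shows "resolvent D A z (resolvent D A w x) = resolvent D A w (resolvent D A z x)"
proof (cases "z = w")
  case False
  have "(z - w) *\<^sub>C resolvent D A z (resolvent D A w x) =
    - ((w - z) *\<^sub>C resolvent D A w (resolvent D A z x))"
    using resolvent_identity[OF assms, of x] resolvent_identity[OF assms(1,3,2), of x]
      by (metis minus_diff_eq)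
  also have "\<dots> = (z - w) *\<^sub>C resolvent D A w (resolvent D A z x)" by (metis minus_diff_eq scaleC_simps(4))
  finally show ?thesis by (rule scaleC_left_cancel[rotated]) (use False in simp)
qed simp

text \<open>The resolvent commutes with its adjoint, that is, it is normal.\<close>

lemma resolvent_norm_cnj:
  fixes T :: "'a::complex_hilbert_space \<Rightarrow> 'a"
  assumes T: "self_adjoint_operator D T" and z: "z \<in> resolvent_set D T" "cnj z \<in> resolvent_set D T"
  shows "norm (resolvent D T (cnj z) x) = norm (resolvent D T z x)"
proof -
  have lo: "linear_operator D T" using T by (simp add: self_adjoint_operator_def)
  have z': "cnj (cnj z) \<in> resolvent_set D T" using z by simp
  have "(norm (resolvent D T (cnj z) x))\<^sup>2 = Re (cinner x (resolvent D T z (resolvent D T (cnj z) x)))"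
    by (simp add: norm_power2_eq_cinner resolvent_adjoint[OF T z(2) z'])
  also have "\<dots> = Re (cinner (resolvent D T z x) (resolvent D T z x))"
    by (simp add: resolvent_commute[OF lo z] resolvent_adjoint[OF T z])
  finally show ?thesis by (simp add: norm_power2_eq_cinner[symmetric])
qed

text \<open>The product vector y is sent to the two single-resolvent vectors by T minus either
  point. Pythagoras gives r^2 |y|^2 in each square, and the triangle inequality |a - b| |y| <= u + v
  gives the rest. The decay in a - b is the almost orthogonality that the square sum needs.\<close>

lemma resolvent_pair_bound:
  fixes T :: "'a::complex_hilbert_space \<Rightarrow> 'a"
  assumes T: "self_adjoint_operator D T" and z: "Complex a r \<in> resolvent_set D T" and w: "Complex b r \<in> resolvent_set D T"
  shows "((a - b)\<^sup>2 / 2 + 2 * r\<^sup>2) * (norm (resolvent D T (Complex a r) (resolvent D T (Complex b r) x)))\<^sup>2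
    \<le> (norm (resolvent D T (Complex a r) x))\<^sup>2 + (norm (resolvent D T (Complex b r) x))\<^sup>2"
proof -
  have lo: "linear_operator D T" using T by (simp add: self_adjoint_operator_def)
  define y where "y = resolvent D T (Complex a r) (resolvent D T (Complex b r) x)"
  have y: "y \<in> D" "T y - Complex a r *\<^sub>C y = resolvent D T (Complex b r) x"
    using resolvent_props[OF lo z] by (auto simp: y_def)
  have y2: "T y - Complex b r *\<^sub>C y = resolvent D T (Complex a r) x"
    unfolding y_def resolvent_commute[OF lo z w] using resolvent_props[OF lo w] by auto
  define u v where "u = norm (T y - of_real a *\<^sub>C y)" and "v = norm (T y - of_real b *\<^sub>C y)"
  have 1: "(norm (resolvent D T (Complex b r) x))\<^sup>2 = u\<^sup>2 + r\<^sup>2 * (norm y)\<^sup>2"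
    "(norm (resolvent D T (Complex a r) x))\<^sup>2 = v\<^sup>2 + r\<^sup>2 * (norm y)\<^sup>2"
    using norm_shift_power2[OF T y(1), of "Complex a r"] norm_shift_power2[OF T y(1), of "Complex b r"] y(2) y2
    by (auto simp: u_def v_def)
  have "\<bar>a - b\<bar> * norm y = norm ((of_real (a - b)) *\<^sub>C y)" by (simp add: norm_scaleC del: of_real_diff)
  also have "(of_real (a - b)) *\<^sub>C y = (T y - of_real b *\<^sub>C y) - (T y - of_real a *\<^sub>C y)"
    by (simp add: scaleC_diff_left)
  also have "norm \<dots> \<le> v + u" unfolding u_def v_def by (rule norm_triangle_ineq4)
  finally have "(\<bar>a - b\<bar> * norm y)\<^sup>2 \<le> (v + u)\<^sup>2" by (rule power_mono) simp
  also have "\<dots> \<le> 2 * (u\<^sup>2 + v\<^sup>2)" using zero_le_power2[of "u - v"]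
    by (simp add: power2_eq_square algebra_simps)
  finally have "(a - b)\<^sup>2 * (norm y)\<^sup>2 \<le> 2 * (u\<^sup>2 + v\<^sup>2)" by (simp add: power_mult_distrib)
  then show ?thesis unfolding 1 y_def[symmetric] by (simp add: algebra_simps)
qed

text \<open>Cotlar--Stein in the commuting positive case: with \<open>W = \<Sum>R\<^sub>a\<^sup>*R\<^sub>a\<close> the previous lemma gives \<open>W\<^sup>2 \<le> K W\<close>,
  so \<open>W \<le> K\<close>.\<close>

lemma resolvent_square_sum:
  fixes T :: "'a::complex_hilbert_space \<Rightarrow> 'a"
  assumes T: "self_adjoint_operator D T" and res: "\<And>z. Im z \<noteq> 0 \<Longrightarrow> z \<in> resolvent_set D T"
    and X: "finite X" "separated d X" and d: "d > 0" and r: "r > 0"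
  shows "(\<Sum>a\<in>X. (norm (resolvent D T (Complex a r) x))\<^sup>2) \<le> 10 * (4 / d\<^sup>2 + 3 / (2 * r\<^sup>2)) * (norm x)\<^sup>2"
proof -
  have lo: "linear_operator D T" using T by (simp add: self_adjoint_operator_def)
  define R where "R a = blinfun_apply (resolvent D T (Complex a r))" for a
  define R' where "R' a = blinfun_apply (resolvent D T (cnj (Complex a r)))" for a
  define K where "K = 5 * (4 / d\<^sup>2 + 3 / (2 * r\<^sup>2))"
  define s where "s = (\<Sum>a\<in>X. (norm (R a x))\<^sup>2)"
  define W where "W = (\<Sum>a\<in>X. R' a (R a x))"
  have z: "Complex a r \<in> resolvent_set D T" "cnj (Complex a r) \<in> resolvent_set D T" for a
    using r by (auto intro!: res)
  have adj: "cinner (R' a u) v = cinner u (R a v)" for a u v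
    using resolvent_adjoint[OF T z(2)[of a]] z(1)[of a] by (simp add: R_def R'_def)
  have adj2: "cinner u (R' a v) = cinner (R a u) v" for a u v by (metis adj cinner_commute)
  have comm: "R a (R b u) = R b (R a u)" "R a (R' b u) = R' b (R a u)" for a b u
    using resolvent_commute[OF lo] z by (auto simp: R_def R'_def)
  have s0: "s \<ge> 0" by (simp add: s_def sum_nonneg)
  have "cinner W x = of_real s"
    by (simp add: W_def s_def cinner_sum_left adj cinner_self)
  then have sle: "s \<le> norm W * norm x"
    using cinner_cauchy_schwarz[of W x] s0 by simp
  have "cinner W W = (\<Sum>b\<in>X. \<Sum>a\<in>X. of_real ((norm (R a (R b x)))\<^sup>2))"
  proof -
    have "cinner (R' a (R a x)) (R' b (R b x)) = of_real ((norm (R a (R b x)))\<^sup>2)" for a b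
    proof -
      have "cinner (R' a (R a x)) (R' b (R b x)) = cinner (R a x) (R' b (R a (R b x)))"
        by (simp only: adj comm(2))
      also have "\<dots> = cinner (R b (R a x)) (R a (R b x))" by (rule adj2)
      also have "R b (R a x) = R a (R b x)" by (rule comm(1))
      finally show ?thesis by (simp only: cinner_self)
    qed
    then show ?thesis by (simp add: W_def cinner_sum_left cinner_sum_right)
  qed
  then have "(norm W)\<^sup>2 = (\<Sum>b\<in>X. \<Sum>a\<in>X. (norm (R a (R b x)))\<^sup>2)"
    by (simp add: norm_power2_eq_cinner Re_sum flip: of_real_sum)
  \<comment> \<open>Schur's test: the pair bound is split so that each half carries one vector and a
    kernel symmetric in a and b. Exchanging the sums identifies the halves, and the inner sum is
    then uniformly bounded.\<close>
  also have "\<dots> \<le> (\<Sum>b\<in>X. \<Sum>a\<in>X. (norm (R a x))\<^sup>2 * (1 / ((a - b)\<^sup>2 / 2 + 2 * r\<^sup>2)) + (norm (R b x))\<^sup>2 * (1 / ((b - a)\<^sup>2 / 2 + 2 * r\<^sup>2)))"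
  proof (intro sum_mono)
    fix a b
    have c: "0 < (a - b)\<^sup>2 / 2 + 2 * r\<^sup>2" using r by (intro add_nonneg_pos) auto
    have "(norm (R a (R b x)))\<^sup>2 \<le> ((norm (R a x))\<^sup>2 + (norm (R b x))\<^sup>2) / ((a - b)\<^sup>2 / 2 + 2 * r\<^sup>2)"
      using resolvent_pair_bound[OF T z(1) z(1), of a b x] c unfolding R_def
        by (simp add: pos_le_divide_eq mult.commute)
    then show "(norm (R a (R b x)))\<^sup>2 \<le>
      (norm (R a x))\<^sup>2 * (1 / ((a - b)\<^sup>2 / 2 + 2 * r\<^sup>2)) + (norm (R b x))\<^sup>2 * (1 / ((b - a)\<^sup>2 / 2 + 2 * r\<^sup>2))"
      by (simp add: add_divide_distrib power2_commute[of b a])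
  qed
  also have "\<dots> = (\<Sum>b\<in>X. \<Sum>a\<in>X. (norm (R a x))\<^sup>2 * (1 / ((a - b)\<^sup>2 / 2 + 2 * r\<^sup>2))) + (\<Sum>b\<in>X. \<Sum>a\<in>X. (norm (R b x))\<^sup>2 * (1 / ((b - a)\<^sup>2 / 2 + 2 * r\<^sup>2)))"
    by (simp add: sum.distrib)
  also have "(\<Sum>b\<in>X. \<Sum>a\<in>X. (norm (R a x))\<^sup>2 * (1 / ((a - b)\<^sup>2 / 2 + 2 * r\<^sup>2))) =
    (\<Sum>b\<in>X. \<Sum>a\<in>X. (norm (R b x))\<^sup>2 * (1 / ((b - a)\<^sup>2 / 2 + 2 * r\<^sup>2)))"
    by (rule sum.swap)
  also have "\<dots> + \<dots> = 2 * (\<Sum>b\<in>X. (norm (R b x))\<^sup>2 * (\<Sum>a\<in>X. 1 / ((b - a)\<^sup>2 / 2 + 2 * r\<^sup>2)))"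
    by (simp add: sum_distrib_left)
  also have "\<dots> \<le> 2 * (\<Sum>b\<in>X. (norm (R b x))\<^sup>2 * K)"
    unfolding K_def by (intro mult_left_mono sum_mono separated_sum_le[OF X d r]) auto
  also have "\<dots> = 2 * K * s" by (simp add: s_def sum_distrib_left mult_ac)
  finally have W2: "(norm W)\<^sup>2 \<le> 2 * K * s" .
  have "s\<^sup>2 \<le> (norm W * norm x)\<^sup>2" using sle s0 by (intro power_mono)
  also have "\<dots> \<le> 2 * K * s * (norm x)\<^sup>2" unfolding power_mult_distrib using W2
    by (intro mult_right_mono) auto
  finally have "s * s \<le> s * (2 * K * (norm x)\<^sup>2)" by (simp add: power2_eq_square mult_ac)
  moreover have "0 \<le> 2 * K * (norm x)\<^sup>2" by (simp add: K_def)
  ultimately have "s \<le> 2 * K * (norm x)\<^sup>2" using s0 by (cases "s = 0") auto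
  then show ?thesis by (simp add: s_def K_def R_def)
qed

section \<open>Contour integrals bounded by values at separated sample points\<close>

lemma norm_contour_integral_horizontal_le:
  assumes "h \<ge> 0" and "continuous_on (closed_segment (Complex p y) (Complex (p + real N * h) y)) f"
    and "\<And>m s. m < N \<Longrightarrow> s \<in> {p + real m * h..p + real (Suc m) * h} \<Longrightarrow> cmod (f (Complex s y)) \<le> M m"
  shows "cmod (contour_integral (linepath (Complex p y) (Complex (p + real N * h) y)) f) \<le> h * (\<Sum>m<N. M m)"
  using assms(2,3)
proof (induction N)
  case 0
  have p: "p + real 0 * h = p" by simp
  show ?case unfolding p contour_integral_trivial by simp
next
  case (Suc N)
  let ?a = "Complex p y" and ?c = "Complex (p + real N * h) y" and ?b = "Complex (p + real (Suc N) * h) y"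
  have seg: "z \<in> closed_segment (Complex u y) (Complex v y) \<longleftrightarrow> Im z = y \<and> u \<le> Re z \<and> Re z \<le> v" if "u \<le> v"
    for z u v
    using that by (auto simp: closed_segment_same_Im closed_segment_eq_real_ivl)
  have le: "p \<le> p + real N * h" "p + real N * h \<le> p + real (Suc N) * h" "p \<le> p + real (Suc N) * h"
    using assms(1) by (auto simp: algebra_simps)
  have sub: "closed_segment ?a ?c \<subseteq> closed_segment ?a ?b" "closed_segment ?c ?b \<subseteq> closed_segment ?a ?b"
    using le by (auto simp: seg)
  have "?c \<in> closed_segment ?a ?b" using le by (simp add: seg)
  from contour_integral_split_linepath[OF Suc.prems(1) this]
  have "contour_integral (linepath ?a ?b) f =
    contour_integral (linepath ?a ?c) f + contour_integral (linepath ?c ?b) f" .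
  also have "cmod \<dots> \<le> h * (\<Sum>m<N. M m) + M N * h"
  proof (rule norm_triangle_mono)
    show "cmod (contour_integral (linepath ?a ?c) f) \<le> h * (\<Sum>m<N. M m)"
      by (rule Suc.IH) (use Suc.prems sub in \<open>auto intro: continuous_on_subset\<close>)
    have "cmod (contour_integral (linepath ?c ?b) f) \<le> M N * cmod (?b - ?c)"
    proof (rule contour_integral_bound_linepath)
      show "f contour_integrable_on linepath ?c ?b"
        using Suc.prems sub by (intro contour_integrable_continuous_linepath) (auto intro: continuous_on_subset)
      fix z assume "z \<in> closed_segment ?c ?b"
      then have z: "Im z = y" "Re z \<in> {p + real N * h..p + real (Suc N) * h}" using le by (auto simp: seg)
      have "z = Complex (Re z) y" using z by (simp add: complex_eq_iff)
      then show "cmod (f z) \<le> M N" using Suc.prems(2)[OF _ z(2)] by simp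
    next
      have "cmod (f ?c) \<le> M N" by (rule Suc.prems(2)) (use assms(1) in \<open>auto simp: algebra_simps\<close>)
      then show "0 \<le> M N" by (rule order_trans[OF norm_ge_zero])
    qed
    also have "?b - ?c = of_real h" by (simp add: complex_eq_iff algebra_simps)
    finally show "cmod (contour_integral (linepath ?c ?b) f) \<le> M N * h" using assms(1) by simp
  qed
  finally show ?case by (simp add: algebra_simps)
qed

text \<open>Each segment is cut into pieces of length at most \<open>2 d\<close>; the sample points are the left ends of the pieces.\<close>

lemma stadium_sample_points:
  assumes pq: "p \<le> q" and r: "r > 0" and d: "d > 0"
  obtains X where "finite X" "X \<subseteq> {p..q}" "separated d X"
    "\<And>f M. \<lbrakk>continuous_on (path_image (stadium_path p q r)) f; \<And>a. a \<in> X \<Longrightarrow> 0 \<le> M a;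
      \<And>z a. z \<in> path_image (stadium_path p q r) \<Longrightarrow> a \<in> X \<Longrightarrow> cmod (z - Complex a r) \<le> 2 * d + 2 * r \<Longrightarrow>
        cmod (f z) \<le> M a\<rbrakk>
      \<Longrightarrow> cmod (contour_integral (stadium_path p q r) f) \<le> (4 * d + 2 * pi * r) * (\<Sum>a\<in>X. M a)"
proof -
  \<comment> \<open>Rounding down gives pieces of length h >= d as soon as there are two of them,
    which is what separation needs; h <= 2 d always. The maximum with 1 covers segments shorter than
    d, including single points.\<close>
  define N where "N = max 1 (nat \<lfloor>(q - p) / d\<rfloor>)"
  define h where "h = (q - p) / real N"
  define a where "a m = p + real m * h" for m
  have N: "N \<ge> 1" by (simp add: N_def)
  have Nh: "real N * h = q - p" using N by (simp add: h_def)
  have h0: "h \<ge> 0" using pq by (simp add: h_def)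
  have "q - p < 2 * d * real N"
  proof -
    have "(q - p) / d < real_of_int \<lfloor>(q - p) / d\<rfloor> + 1" by linarith
    also have "\<dots> \<le> 2 * real N" unfolding N_def by linarith
    finally show ?thesis using d by (simp add: field_simps)
  qed
  then have h2: "h \<le> 2 * d" using N by (simp add: h_def field_simps)
  have hd: "h \<ge> d" if "N > 1"
  proof -
    have "real N = real_of_int \<lfloor>(q - p) / d\<rfloor>" using that unfolding N_def by linarith
    then have "real N \<le> (q - p) / d" by linarith
    then show ?thesis using d N by (simp add: h_def field_simps)
  qed
  have sep: "d \<le> \<bar>a m - a n\<bar>" if "m < N" "n < N" "m \<noteq> n" for m n
  proof -
    have "N > 1" using that by linarith
    have "1 \<le> \<bar>real m - real n\<bar>" using that(3) by linarith
    then have "1 * h \<le> \<bar>real m - real n\<bar> * h" by (rule mult_right_mono) (rule h0)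
    also have "\<dots> = \<bar>a m - a n\<bar>" using h0 by (simp add: a_def abs_mult left_diff_distrib[symmetric])
    finally show ?thesis using hd[OF \<open>N > 1\<close>] by simp
  qed
  have inj: "inj_on a {..<N}" using sep d by (force simp: inj_on_def)
  have aN: "a N = q" "a 0 = p" using Nh by (auto simp: a_def)
  have mem: "a m \<in> {p..q}" if "m \<le> N" for m
    using that h0 Nh mult_right_mono[of "real m" "real N" h] by (auto simp: a_def)
  show thesis
  proof (rule that[of "a ` {..<N}"])
    show "a ` {..<N} \<subseteq> {p..q}" using mem by auto
    show "separated d (a ` {..<N})" using sep by (auto simp: separated_def)
    fix f M
    let ?\<gamma> = "stadium_path p q r"
    assume f: "continuous_on (path_image ?\<gamma>) f" and M0: "\<And>x. x \<in> a ` {..<N} \<Longrightarrow> 0 \<le> M x"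
      and M: "\<And>z x. z \<in> path_image ?\<gamma> \<Longrightarrow> x \<in> a ` {..<N} \<Longrightarrow> cmod (z - Complex x r) \<le> 2 * d + 2 * r \<Longrightarrow>
        cmod (f z) \<le> M x"
    define S where "S = (\<Sum>m<N. M (a m))"
    have MS: "M (a m) \<le> S" "0 \<le> M (a m)" if "m < N" for m
      using that M0 unfolding S_def by (auto intro!: member_le_sum)
    \<comment> \<open>The lower side is charged to the sample points on the upper one. This accounts
      for the 2 r in the distance 2 d + 2 r; the 2 d is the bound on h.\<close>
    have line: "cmod (contour_integral (linepath (Complex p y) (Complex q y)) f) \<le> 2 * d * S"
      if y: "y = r \<or> y = - r" for y
    proof -
      have im: "closed_segment (Complex p y) (Complex q y) \<subseteq> path_image ?\<gamma>"
        using y by (auto simp: path_image_stadium_path closed_segment_commute)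
      have "cmod (contour_integral (linepath (Complex p y) (Complex (p + real N * h) y)) f) \<le>
        h * (\<Sum>m<N. M (a m))"
      proof (rule norm_contour_integral_horizontal_le[OF h0])
        show "continuous_on (closed_segment (Complex p y) (Complex (p + real N * h) y)) f"
          using im Nh by (auto intro: continuous_on_subset[OF f])
        fix m s assume m: "m < N" and s: "s \<in> {p + real m * h..p + real (Suc m) * h}"
        have s': "s \<in> {a m..a (Suc m)}" "a (Suc m) = a m + h" using s by (auto simp: a_def algebra_simps)
        then have "s \<in> {p..q}" using mem[of m] mem[of "Suc m"] m by auto
        then have z: "Complex s y \<in> path_image ?\<gamma>"
          using im by (auto simp: closed_segment_same_Im closed_segment_eq_real_ivl subset_eq)
        have "cmod (Complex s y - Complex (a m) r) \<le> \<bar>s - a m\<bar> + \<bar>y - r\<bar>"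
          using cmod_le[of "Complex s y - Complex (a m) r"] by simp
        also have "\<dots> \<le> 2 * d + 2 * r" using s' h2 y r by auto
        finally show "cmod (f (Complex s y)) \<le> M (a m)" using M[OF z] m by auto
      qed
      then have "cmod (contour_integral (linepath (Complex p y) (Complex q y)) f) \<le> h * S" using Nh
        by (simp add: S_def)
      also have "\<dots> \<le> 2 * d * S" using h2 MS[of 0] N by (intro mult_right_mono) auto
      finally show ?thesis .
    qed
    have top: "cmod (contour_integral (linepath (Complex q r) (Complex p r)) f) \<le> 2 * d * S"
    proof -
      have "contour_integral (linepath (Complex q r) (Complex p r)) f =
        - contour_integral (linepath (Complex p r) (Complex q r)) f"
        by (metis contour_integral_reversepath reversepath_linepath valid_path_linepath)
      then show ?thesis using line[of r] by simp
    qed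
    \<comment> \<open>Each half circle is charged to a single sample point within h of its centre:
      the first one on the left, and the last one, \<open>a (N - 1)\<close>, on the right, since q
      itself is not a sample point unless h = 0.\<close>
    have arc: "cmod (contour_integral (part_circlepath (of_real c) r s t) f) \<le> pi * r * S"
      if st: "t - s = pi" and im: "path_image (part_circlepath (of_real c) r s t) \<subseteq> path_image ?\<gamma>"
        and m: "m < N" "\<bar>c - a m\<bar> \<le> h" and ci: "f contour_integrable_on part_circlepath (of_real c) r s t"
          for c s t m
    proof -
      have "cmod (contour_integral (part_circlepath (of_real c) r s t) f) \<le> M (a m) * r * \<bar>t - s\<bar>"
      proof (rule contour_integral_bound_part_circlepath[OF ci])
        fix z assume z: "z \<in> path_image (part_circlepath (of_real c) r s t)"
        then have "cmod (z - of_real c) = r"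
          using path_image_part_circlepath_subset'[of r "of_real c" s t] r
            by (auto simp: dist_norm norm_minus_commute)
        moreover have "cmod (of_real c - Complex (a m) r) \<le> \<bar>c - a m\<bar> + r"
          using cmod_le[of "of_real c - Complex (a m) r"] r by simp
        ultimately have "cmod (z - Complex (a m) r) \<le> 2 * d + 2 * r"
          using norm_triangle_ineq[of "z - of_real c" "of_real c - Complex (a m) r"] m h2 by simp
        then show "cmod (f z) \<le> M (a m)" using M[of z "a m"] z im m by auto
      qed (use MS m r in auto)
      also have "\<dots> \<le> S * r * \<bar>t - s\<bar>" using MS m r by (intro mult_right_mono) auto
      finally show ?thesis using st by (simp add: mult_ac)
    qed
    have "cmod (contour_integral (part_circlepath (of_real q) r (- pi/2) (pi/2)) f) \<le> pi * r * S"
    proof (rule arc[where m = "N - 1"])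
      have "a N = a (N - 1) + h" using N by (simp add: a_def of_nat_diff algebra_simps)
      then show "\<bar>q - a (N - 1)\<bar> \<le> h" using aN h0 by simp
    qed (use N contour_integral_stadium(4)[OF f] in \<open>auto simp: path_image_stadium_path\<close>)
    moreover have "cmod (contour_integral (part_circlepath (of_real p) r (pi/2) (3*pi/2)) f) \<le> pi * r * S"
      by (rule arc[where m = 0]) (use N h0 aN contour_integral_stadium(6)[OF f] in \<open>auto simp: path_image_stadium_path\<close>)
    ultimately have "cmod (contour_integral ?\<gamma> f) \<le> 2 * d * S + pi * r * S + 2 * d * S + pi * r * S"
      unfolding contour_integral_stadium(2)[OF f] using line[of "-r"] top
      by (intro norm_triangle_mono) auto
    then show "cmod (contour_integral ?\<gamma> f) \<le> (4 * d + 2 * pi * r) * (\<Sum>x\<in>a ` {..<N}. M x)"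
      by (simp add: sum.reindex[OF inj] S_def algebra_simps)
  qed auto
qed

section \<open>Separated segments\<close>

locale separated_segments =
  fixes J :: "int set" and \<alpha> \<beta> :: "int \<Rightarrow> real" and d :: real
  assumes J: "J = \<nat> \<or> J = \<int>" and le: "j \<in> J \<Longrightarrow> \<alpha> j \<le> \<beta> j"
    and gap: "j \<in> J \<Longrightarrow> d \<le> \<alpha> (j + 1) - \<beta> j" and d: "d > 0"
begin

text \<open>The gap hypothesis concerns neighbours only; upward closure keeps the induction from i
  to j inside J.\<close>

lemma J_upward: "i \<in> J \<Longrightarrow> i < j \<Longrightarrow> j \<in> J"
  using J by (auto simp: Nats_altdef1 Ints_def)

lemma gap_less:
  assumes i: "i \<in> J" and ij: "i < j"
  shows "\<beta> i + d * real_of_int (j - i) \<le> \<alpha> j"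
  using ij
proof (induction j rule: int_gr_induct)
  case base
  then show ?case using gap[OF i] by simp
next
  case (step j)
  have "j \<in> J" using J_upward[OF i step(1)] .
  then show ?case using step gap[of j] le[of j] by (simp add: algebra_simps)
qed

lemma gap_less_d:
  assumes "i \<in> J" "i < j"
  shows "\<beta> i + d \<le> \<alpha> j"
proof -
  have "d * 1 \<le> d * real_of_int (j - i)" using d assms(2) by (intro mult_left_mono) auto
  then show ?thesis using gap_less[OF assms] by simp
qed

text \<open>The growth linear in |i - j|, and not just the lower bound d, is what shows that only
  finitely many segments come near a given point.\<close>

lemma segment_gap:
  assumes "i \<in> J" "j \<in> J" "i \<noteq> j" "s \<in> {\<alpha> i..\<beta> i}" "t \<in> {\<alpha> j..\<beta> j}"
  shows "d * \<bar>real_of_int (i - j)\<bar> \<le> \<bar>s - t\<bar>"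
proof (cases "i < j")
  case True
  have "d * real_of_int (j - i) \<le> t - s" using gap_less[OF assms(1) True] assms by auto
  then show ?thesis using True by (simp add: abs_if)
next
  case False
  then have "j < i" using assms by simp
  have "d * real_of_int (i - j) \<le> s - t" using gap_less[OF assms(2) \<open>j < i\<close>] assms by auto
  then show ?thesis using \<open>j < i\<close> by (simp add: abs_if)
qed

lemma segment_gap_d:
  assumes "i \<in> J" "j \<in> J" "i \<noteq> j" "s \<in> {\<alpha> i..\<beta> i}" "t \<in> {\<alpha> j..\<beta> j}"
  shows "d \<le> \<bar>s - t\<bar>"
proof -
  have "d * 1 \<le> d * \<bar>real_of_int (i - j)\<bar>" using d assms(3) by (intro mult_left_mono) auto
  then show ?thesis using segment_gap[OF assms] by simp
qed

text \<open>A pointwise form of dist(z, \<Delta>) >= e for the union \<Delta> of the segments, which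
  avoids an infimum over infinitely many of them.\<close>

definition dist_ge :: "complex \<Rightarrow> real \<Rightarrow> bool" where
  "dist_ge z e \<longleftrightarrow> (\<forall>j\<in>J. \<forall>s\<in>{\<alpha> j..\<beta> j}. e \<le> cmod (z - of_real s))"

text \<open>A contour point is r away from its own segment and hence at least d - r away from every
  other one; r <= d/2 makes this at least r.\<close>

lemma stadium_dist_ge:
  assumes j: "j \<in> J" and r: "r > 0" "r \<le> d / 2" and z: "z \<in> path_image (stadium_path (\<alpha> j) (\<beta> j) r)"
  shows "dist_ge z r"
  unfolding dist_ge_def
proof (intro ballI)
  fix i s assume i: "i \<in> J" "s \<in> {\<alpha> i..\<beta> i}"
  show "r \<le> cmod (z - of_real s)"
  proof (cases "i = j")
    case True
    then show ?thesis using stadium_dist_le[OF le[OF j] r(1) z] i by simp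
  next
    case False
    obtain t where t: "t \<in> {\<alpha> j..\<beta> j}" "cmod (z - of_real t) = r"
      using stadium_dist_ex[OF le[OF j] r(1) z] by blast
    have "d \<le> cmod (of_real t - of_real s)" using segment_gap_d[OF i(1) j False i(2) t(1)]
      by (simp add: abs_minus_commute flip: of_real_diff)
    also have "\<dots> \<le> cmod (z - of_real s) + r"
      using norm_triangle_ineq4[of "z - of_real s" "z - of_real t"] t(2) by simp
    finally show ?thesis using r by linarith
  qed
qed

lemma mem_cnbhd: "j \<in> J \<Longrightarrow> z \<in> cnbhd b {\<alpha> j..\<beta> j} \<longleftrightarrow> (\<exists>s\<in>{\<alpha> j..\<beta> j}. cmod (z - of_real s) \<le> b)"
proof -
  assume j: "j \<in> J"
  have c: "closed (complex_of_real ` {\<alpha> j..\<beta> j})"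
    by (intro compact_imp_closed compact_continuous_image continuous_intros) auto
  have ne: "complex_of_real ` {\<alpha> j..\<beta> j} \<noteq> {}" using le[OF j] by auto
  obtain w where w: "w \<in> complex_of_real ` {\<alpha> j..\<beta> j}" "infdist z (complex_of_real ` {\<alpha> j..\<beta> j}) = dist z w"
    using infdist_attains_inf[OF c ne] by blast
  show "z \<in> cnbhd b {\<alpha> j..\<beta> j} \<longleftrightarrow> (\<exists>s\<in>{\<alpha> j..\<beta> j}. cmod (z - of_real s) \<le> b)"
  proof
    assume "z \<in> cnbhd b {\<alpha> j..\<beta> j}"
    then show "\<exists>s\<in>{\<alpha> j..\<beta> j}. cmod (z - of_real s) \<le> b" using w by (auto simp: cnbhd_def dist_norm)
  next
    assume "\<exists>s\<in>{\<alpha> j..\<beta> j}. cmod (z - of_real s) \<le> b"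
    then show "z \<in> cnbhd b {\<alpha> j..\<beta> j}"
      by (auto simp: cnbhd_def dist_norm intro: infdist_le2)
  qed
qed

lemma cnbhd_disjoint:
  assumes "b < d / 2"
  shows "disjoint_family_on (\<lambda>j. cnbhd b {\<alpha> j..\<beta> j}) J"
  unfolding disjoint_family_on_def
proof (intro ballI impI, rule ccontr)
  fix i j assume ij: "i \<in> J" "j \<in> J" "i \<noteq> j" "cnbhd b {\<alpha> i..\<beta> i} \<inter> cnbhd b {\<alpha> j..\<beta> j} \<noteq> {}"
  then obtain z where "z \<in> cnbhd b {\<alpha> i..\<beta> i}" "z \<in> cnbhd b {\<alpha> j..\<beta> j}" by blast
  then obtain s t where z: "s \<in> {\<alpha> i..\<beta> i}" "cmod (z - of_real s) \<le>
    b" "t \<in> {\<alpha> j..\<beta> j}" "cmod (z - of_real t) \<le> b"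
    unfolding mem_cnbhd[OF ij(1)] mem_cnbhd[OF ij(2)] by blast
  have "\<bar>s - t\<bar> = cmod (of_real s - of_real t)" by (simp flip: of_real_diff)
  also have "\<dots> \<le> 2 * b" using norm_triangle_ineq4[of "z - of_real t" "z - of_real s"] z by simp
  finally show False using segment_gap_d[OF ij(1-3) z(1,3)] assms by simp
qed

text \<open>Each segment separately is farther than b, but infinitely many could have distances
  tending to b. Only finitely many come within b + 1, so the minimum of their distances and b + 1 is
  still greater than b.\<close>

lemma dist_ge_outside:
  assumes z: "\<And>j. j \<in> J \<Longrightarrow> z \<notin> cnbhd b {\<alpha> j..\<beta> j}"
  shows "\<exists>e>b. dist_ge z e"
proof -
  define near where "near = {j\<in>J. z \<in> cnbhd (b + 1) {\<alpha> j..\<beta> j}}"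
  have fin: "finite near"
  proof (cases "near = {}")
    case False
    then obtain i s where i: "i \<in> J" "s \<in> {\<alpha> i..\<beta> i}" "cmod (z - of_real s) \<le> b + 1"
      by (auto simp: near_def mem_cnbhd)
    define N where "N = \<lceil>2 * (b + 1) / d\<rceil>"
    have "j \<in> {i - N..i + N}" if j: "j \<in> near" for j
    proof (cases "i = j")
      case True
      have "0 \<le> b + 1" using i(3) by (rule order_trans[OF norm_ge_zero])
      then have "0 \<le> 2 * (b + 1) / d" using d by simp
      then have "0 \<le> N" unfolding N_def by linarith
      then show ?thesis using True by simp
    next
      case False
      obtain t where t: "j \<in> J" "t \<in> {\<alpha> j..\<beta> j}" "cmod (z - of_real t) \<le> b + 1"
        using j by (auto simp: near_def mem_cnbhd)
      have "d * \<bar>real_of_int (i - j)\<bar> \<le> \<bar>s - t\<bar>" by (rule segment_gap[OF i(1) t(1) False i(2) t(2)])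
      also have "\<dots> = cmod (of_real s - of_real t)" by (simp flip: of_real_diff)
      also have "\<dots> \<le> 2 * (b + 1)" using norm_triangle_ineq4[of "z - of_real t" "z - of_real s"] i t by simp
      finally have "\<bar>real_of_int (i - j)\<bar> \<le> 2 * (b + 1) / d" using d by (simp add: field_simps)
      then have "\<bar>i - j\<bar> \<le> N" unfolding N_def by linarith
      then show ?thesis by auto
    qed
    then have "near \<subseteq> {i - N..i + N}" by blast
    then show ?thesis by (rule finite_subset) simp
  qed simp
  define g where "g j = infdist z (complex_of_real ` {\<alpha> j..\<beta> j})" for j
  define e where "e = Min (insert (b + 1) (g ` near))"
  have "b < e" unfolding e_def using fin z
    by (subst Min_gr_iff) (auto simp: near_def g_def cnbhd_def not_le)
  moreover have "e \<le> cmod (z - of_real s)" if j: "j \<in> J" and s: "s \<in> {\<alpha> j..\<beta> j}" for j s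
  proof (cases "j \<in> near")
    case True
    have "e \<le> g j" unfolding e_def using fin True by (intro Min_le) auto
    also have "\<dots> \<le> cmod (z - of_real s)" unfolding g_def using s by (simp add: infdist_le flip: dist_norm)
    finally show ?thesis .
  next
    case False
    have "e \<le> b + 1" unfolding e_def using fin by (intro Min_le) auto
    moreover have "\<not> cmod (z - of_real s) \<le> b + 1" using False j s by (auto simp: near_def mem_cnbhd)
    ultimately show ?thesis by linarith
  qed
  ultimately show ?thesis by (auto simp: dist_ge_def)
qed

end

section \<open>Families of projections with bounded signed sums\<close>

text \<open>The finite partial sums of f form a Cauchy net, because two of them beyond a common
  finite set differ by sums over tails of g; completeness provides the limit.\<close>

lemma summable_on_square_bound:
  fixes f :: "'i \<Rightarrow> 'b::banach" and g :: "'i \<Rightarrow> real"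
  assumes g: "g summable_on A" and C: "C > 0"
    and fg: "\<And>F. finite F \<Longrightarrow> F \<subseteq> A \<Longrightarrow> (norm (sum f F))\<^sup>2 \<le> C * sum g F"
  shows "f summable_on A"
proof -
  obtain s where s: "(sum g \<longlongrightarrow> s) (finite_subsets_at_top A)"
    using g by (auto simp: summable_on_def has_sum_def)
  have "cauchy_filter (filtermap (sum f) (finite_subsets_at_top A))"
    unfolding cauchy_filter_metric_filtermap
  proof (intro allI impI)
    fix e :: real assume e: "e > 0"
    define \<delta> where "\<delta> = (e/2)\<^sup>2 / C"
    have \<delta>: "\<delta> > 0" using e C by (simp add: \<delta>_def)
    have "\<forall>\<^sub>F F in finite_subsets_at_top A. dist (sum g F) s < \<delta> / 2"
      using tendstoD[OF s, of "\<delta>/2"] \<delta> by simp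
    then obtain X where "finite X \<and> X \<subseteq> A \<and> (\<forall>F. finite F \<and> X \<subseteq> F \<and> F \<subseteq> A \<longrightarrow> dist (sum g F) s < \<delta> / 2)"
      unfolding eventually_finite_subsets_at_top by (rule exE)
    then have X: "finite X" "X \<subseteq> A" "\<And>F. finite F \<Longrightarrow> X \<subseteq> F \<Longrightarrow> F \<subseteq> A \<Longrightarrow> dist (sum g F) s < \<delta> / 2"
      by auto
    have near: "dist (sum f F) (sum f X) < e / 2" if F: "finite F" "X \<subseteq> F" "F \<subseteq> A" for F
    proof -
      have diff: "sum f F - sum f X = sum f (F - X)" "sum g F - sum g X = sum g (F - X)"
        using F by (simp_all add: sum_diff)
      have "sum g (F - X) < \<delta>"
        using X(3)[OF F] X(3)[OF X(1) order_refl X(2)] diff(2) unfolding dist_real_def by linarith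
      then have "C * sum g (F - X) < (e/2)\<^sup>2" using C by (simp add: \<delta>_def field_simps)
      moreover have "(norm (sum f (F - X)))\<^sup>2 \<le> C * sum g (F - X)" using F by (intro fg) auto
      ultimately have "(norm (sum f (F - X)))\<^sup>2 < (e/2)\<^sup>2" by linarith
      then have "norm (sum f (F - X)) < e/2" by (rule power2_less_imp_less) (use e in simp)
      then show ?thesis by (simp add: dist_norm diff)
    qed
    show "\<exists>P. eventually P (finite_subsets_at_top A) \<and> (\<forall>F G. P F \<and> P G \<longrightarrow> dist (sum f F) (sum f G) < e)"
    proof (intro exI conjI allI impI)
      show "\<forall>\<^sub>F F in finite_subsets_at_top A. finite F \<and> X \<subseteq> F \<and> F \<subseteq> A"
        unfolding eventually_finite_subsets_at_top using X(1,2) by (intro exI[of _ X]) auto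
      fix F G assume "(finite F \<and> X \<subseteq> F \<and> F \<subseteq> A) \<and> (finite G \<and> X \<subseteq> G \<and> G \<subseteq> A)"
      then have "dist (sum f F) (sum f X) < e/2" "dist (sum f G) (sum f X) < e/2" using near by auto
      then show "dist (sum f F) (sum f G) < e" by (rule dist_triangle_half_l)
    qed
  qed
  from cauchy_filter_complete_converges[OF this complete_UNIV]
  obtain L where "filtermap (sum f) (finite_subsets_at_top A) \<le> nhds L"
    by (auto simp: filtermap_bot_iff)
  then have "(sum f \<longlongrightarrow> L) (finite_subsets_at_top A)" by (simp add: filterlim_def)
  then show ?thesis by (auto simp: summable_on_def has_sum_def)
qed

text \<open>Signs are chosen greedily so that each new cross term is at most 0. This replaces
  averaging over all signs, where the cross terms cancel.\<close>

lemma signed_sum_norm_le: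
  fixes v :: "'i \<Rightarrow> 'a::complex_hilbert_space"
  assumes "finite F"
  shows "\<exists>\<epsilon>. (\<forall>j. \<epsilon> j \<in> {1, -1}) \<and> (norm (\<Sum>j\<in>F. \<epsilon> j *\<^sub>R v j))\<^sup>2 \<le> (\<Sum>j\<in>F. (norm (v j))\<^sup>2)"
  using assms
proof (induction F)
  case empty
  show ?case by (intro exI[of _ "\<lambda>_. 1"]) auto
next
  case (insert k F)
  then obtain \<epsilon> where \<epsilon>: "\<forall>j. \<epsilon> j \<in> {1, -1}" and le: "(norm (\<Sum>j\<in>F. \<epsilon> j *\<^sub>R v j))\<^sup>2 \<le> (\<Sum>j\<in>F. (norm (v j))\<^sup>2)"
    by blast
  define w where "w = (\<Sum>j\<in>F. \<epsilon> j *\<^sub>R v j)"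
  define t :: real where "t = (if Re (cinner (v k) w) \<le> 0 then 1 else -1)"
  have "(\<Sum>j\<in>insert k F. (\<epsilon>(k := t)) j *\<^sub>R v j) = t *\<^sub>R v k + w"
    using insert(1,2) by (simp add: w_def) (rule sum.cong, auto)
  moreover have "(norm (t *\<^sub>R v k + w))\<^sup>2 \<le> (norm (v k))\<^sup>2 + (norm w)\<^sup>2"
    unfolding norm_add_power2 by (auto simp: t_def)
  ultimately show ?case
    using \<epsilon> le insert(1,2) by (intro exI[of _ "\<epsilon>(k := t)"]) (auto simp: w_def t_def)
qed

text \<open>The opposite greedy choice keeps the cross terms nonnegative. With a uniform bound on
  signed sums, the two lemmas make |sum of \<open>Q j x\<close>|^2 and the sum of
  |\<open>Q j x\<close>|^2 comparable up to constants.\<close>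

lemma signed_sum_norm_ge:
  fixes v :: "'i \<Rightarrow> 'a::complex_hilbert_space"
  assumes "finite F"
  shows "\<exists>\<epsilon>. (\<forall>j. \<epsilon> j \<in> {1, -1}) \<and> (\<Sum>j\<in>F. (norm (v j))\<^sup>2) \<le> (norm (\<Sum>j\<in>F. \<epsilon> j *\<^sub>R v j))\<^sup>2"
  using assms
proof (induction F)
  case empty
  show ?case by (intro exI[of _ "\<lambda>_. 1"]) auto
next
  case (insert k F)
  then obtain \<epsilon> where \<epsilon>: "\<forall>j. \<epsilon> j \<in> {1, -1}" and le: "(\<Sum>j\<in>F. (norm (v j))\<^sup>2) \<le> (norm (\<Sum>j\<in>F. \<epsilon> j *\<^sub>R v j))\<^sup>2"
    by blast
  define w where "w = (\<Sum>j\<in>F. \<epsilon> j *\<^sub>R v j)"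
  define t :: real where "t = (if Re (cinner (v k) w) \<ge> 0 then 1 else -1)"
  have "(\<Sum>j\<in>insert k F. (\<epsilon>(k := t)) j *\<^sub>R v j) = t *\<^sub>R v k + w"
    using insert(1,2) by (simp add: w_def) (rule sum.cong, auto)
  moreover have "(norm (v k))\<^sup>2 + (norm w)\<^sup>2 \<le> (norm (t *\<^sub>R v k + w))\<^sup>2"
    unfolding norm_add_power2 by (auto simp: t_def)
  ultimately show ?case
    using \<epsilon> le insert(1,2) by (intro exI[of _ "\<epsilon>(k := t)"]) (auto simp: w_def t_def)
qed

text \<open>An abstract criterion for unconditional bases: mutually annihilating projections with
  uniformly bounded signed finite sums, among which no nonzero vector is annihilated by all.\<close>

locale projection_family =
  fixes J :: "int set" and Q :: "int \<Rightarrow> 'a::complex_hilbert_space \<Rightarrow>\<^sub>L 'a" and C :: real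
  assumes Q_scaleC: "j \<in> J \<Longrightarrow> Q j (c *\<^sub>C x) = c *\<^sub>C Q j x"
    and Q_idem: "j \<in> J \<Longrightarrow> Q j (Q j x) = Q j x"
    and Q_orth: "i \<in> J \<Longrightarrow> j \<in> J \<Longrightarrow> i \<noteq> j \<Longrightarrow> Q i (Q j x) = 0"
    and Q_bound: "finite F \<Longrightarrow> F \<subseteq> J \<Longrightarrow> (\<And>j. \<epsilon> j \<in> {1, -1}) \<Longrightarrow> norm (\<Sum>j\<in>F. \<epsilon> j *\<^sub>R Q j x) \<le> C * norm x"
    and Q_complete: "(\<And>j. j \<in> J \<Longrightarrow> Q j u = 0) \<Longrightarrow> u = 0"
begin

lemma mem_range_Q: "j \<in> J \<Longrightarrow> y \<in> range (Q j) \<longleftrightarrow> Q j y = y"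
proof
  assume j: "j \<in> J" and "y \<in> range (Q j)"
  then obtain v where "y = Q j v" by blast
  then show "Q j y = y" using Q_idem[OF j] by simp
next
  assume "Q j y = y"
  then show "y \<in> range (Q j)" by (rule range_eqI[OF sym])
qed

lemma csubspace_range_Q:
  assumes j: "j \<in> J"
  shows "csubspace (range (Q j))"
proof -
  have "0 \<in> range (Q j)" using j by (simp add: mem_range_Q blinfun.zero_right)
  then show ?thesis
    unfolding csubspace_def using j by (simp add: mem_range_Q blinfun.add_right Q_scaleC)
qed

lemma closed_range_Q:
  assumes j: "j \<in> J"
  shows "closed (range (Q j))"
proof -
  have "range (Q j) = {y. Q j y = y}" using mem_range_Q[OF j] by blast
  moreover have "closed {y. Q j y = y}" by (intro closed_Collect_eq continuous_intros)
  ultimately show ?thesis by simp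
qed

text \<open>The signed sum operator squares to the plain one, because the signs square to 1.
  Applying it to the signed vector w, whose norm is controlled by the choice of signs, costs only
  the factor C.\<close>

lemma norm_sum_Q_square_le:
  assumes F: "finite F" "F \<subseteq> J"
  shows "(norm (\<Sum>j\<in>F. Q j x))\<^sup>2 \<le> (C\<^sup>2 + 1) * (\<Sum>j\<in>F. (norm (Q j x))\<^sup>2)"
proof -
  obtain \<epsilon> where \<epsilon>: "\<forall>j. \<epsilon> j \<in> {1, -1}"
    and le: "(norm (\<Sum>j\<in>F. \<epsilon> j *\<^sub>R Q j x))\<^sup>2 \<le> (\<Sum>j\<in>F. (norm (Q j x))\<^sup>2)"
    using signed_sum_norm_le[OF F(1), of "\<lambda>j. Q j x"] by blast
  define w where "w = (\<Sum>j\<in>F. \<epsilon> j *\<^sub>R Q j x)"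
  have "Q i w = \<epsilon> i *\<^sub>R Q i x" if i: "i \<in> F" for i
  proof -
    have "Q i w = (\<Sum>j\<in>F. \<epsilon> j *\<^sub>R Q i (Q j x))"
      by (simp add: w_def blinfun.sum_right blinfun.scaleR_right)
    also have "\<dots> = (\<Sum>j\<in>F. if j = i then \<epsilon> i *\<^sub>R Q i x else 0)"
      using F i by (intro sum.cong) (auto simp: Q_idem Q_orth subset_eq)
    finally show ?thesis using F i by simp
  qed
  moreover have "\<epsilon> i * \<epsilon> i = 1" for i using \<epsilon>[rule_format, of i] by auto
  ultimately have "(\<Sum>i\<in>F. \<epsilon> i *\<^sub>R Q i w) = (\<Sum>i\<in>F. Q i x)" by (intro sum.cong) auto
  then have "norm (\<Sum>i\<in>F. Q i x) \<le> C * norm w" using Q_bound[OF F, of \<epsilon> w] \<epsilon> by simp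
  then have "(norm (\<Sum>i\<in>F. Q i x))\<^sup>2 \<le> (C * norm w)\<^sup>2" by (rule power_mono) simp
  also have "\<dots> = C\<^sup>2 * (norm w)\<^sup>2" by (simp add: power_mult_distrib)
  also have "\<dots> \<le> C\<^sup>2 * (\<Sum>j\<in>F. (norm (Q j x))\<^sup>2)" using le by (intro mult_left_mono) (auto simp: w_def)
  \<comment> \<open>The added 1 makes the constant strictly positive whatever C is, as the
    summability criterion requires.\<close>
  also have "\<dots> \<le> (C\<^sup>2 + 1) * (\<Sum>j\<in>F. (norm (Q j x))\<^sup>2)" by (intro mult_right_mono sum_nonneg) auto
  finally show ?thesis .
qed

lemma sum_norm_Q_square_le:
  assumes F: "finite F" "F \<subseteq> J"
  shows "(\<Sum>j\<in>F. (norm (Q j x))\<^sup>2) \<le> (C * norm x)\<^sup>2"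
proof -
  obtain \<epsilon> where \<epsilon>: "\<forall>j. \<epsilon> j \<in> {1, -1}"
    and le: "(\<Sum>j\<in>F. (norm (Q j x))\<^sup>2) \<le> (norm (\<Sum>j\<in>F. \<epsilon> j *\<^sub>R Q j x))\<^sup>2"
    using signed_sum_norm_ge[OF F(1), of "\<lambda>j. Q j x"] by blast
  have "norm (\<Sum>j\<in>F. \<epsilon> j *\<^sub>R Q j x) \<le> C * norm x" using Q_bound[OF F] \<epsilon> by blast
  then have "(norm (\<Sum>j\<in>F. \<epsilon> j *\<^sub>R Q j x))\<^sup>2 \<le> (C * norm x)\<^sup>2" by (rule power_mono) simp
  then show ?thesis using le by linarith
qed

lemma Q_summable: "(\<lambda>j. Q j x) summable_on J"
proof (rule summable_on_square_bound)
  show "(\<lambda>j. (norm (Q j x))\<^sup>2) summable_on J"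
    by (rule nonneg_bdd_above_summable_on) (auto intro!: bdd_aboveI2 sum_norm_Q_square_le)
  show "0 < C\<^sup>2 + 1" by (intro add_nonneg_pos) auto
qed (rule norm_sum_Q_square_le)

text \<open>Continuity of \<open>Q k\<close> reads off the k-th coefficient from any convergent
  expansion. The filter is left general because both the net of finite subsets and the sequence of
  symmetric partial sums occur.\<close>

lemma Q_has_sum_component:
  assumes k: "k \<in> J" and f: "\<And>j. j \<in> J \<Longrightarrow> f j \<in> range (Q j)"
    and lim: "((\<lambda>n. \<Sum>j\<in>X n. f j) \<longlongrightarrow> x) G" and G: "G \<noteq> bot"
    and X: "\<forall>\<^sub>F n in G. finite (X n) \<and> X n \<subseteq> J \<and> k \<in> X n"
  shows "Q k x = f k"
proof -
  have bl: "bounded_linear (blinfun_apply (Q k))" by (rule blinfun.bounded_linear_right)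
  have 1: "((\<lambda>n. Q k (\<Sum>j\<in>X n. f j)) \<longlongrightarrow> Q k x) G"
    by (rule bounded_linear.tendsto[OF bl lim])
  have "\<forall>\<^sub>F n in G. f k = Q k (\<Sum>j\<in>X n. f j)"
    using X
  proof eventually_elim
    case (elim n)
    have "Q k (\<Sum>j\<in>X n. f j) = (\<Sum>j\<in>X n. Q k (f j))" by (rule linear_sum[OF bounded_linear.linear[OF bl]])
    also have "\<dots> = (\<Sum>j\<in>X n. if j = k then f k else 0)"
    proof (rule sum.cong)
      fix j assume "j \<in> X n"
      then have j: "j \<in> J" using elim by blast
      then have "Q j (f j) = f j" using f mem_range_Q by blast
      then show "Q k (f j) = (if j = k then f k else 0)" using Q_orth[OF k j, of "f j"] by auto
    qed simp
    finally show ?case using elim by simp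
  qed
  then have "\<forall>\<^sub>F n in G. Q k (\<Sum>j\<in>X n. f j) = f k" by (rule eventually_mono) (rule sym)
  then have 2: "((\<lambda>n. Q k (\<Sum>j\<in>X n. f j)) \<longlongrightarrow> f k) G" by (rule tendsto_eventually)
  show ?thesis by (rule tendsto_unique[OF G 1 2])
qed

lemma Q_has_sum: "((\<lambda>j. Q j x) has_sum x) J"
proof -
  obtain s where s: "((\<lambda>j. Q j x) has_sum s) J" using Q_summable by (auto simp: summable_on_def)
  have "Q k s = Q k x" if k: "k \<in> J" for k
  proof (rule Q_has_sum_component[OF k, where f = "\<lambda>j. Q j x" and X = "\<lambda>F. F" and G =
    "finite_subsets_at_top J"])
    show "\<forall>\<^sub>F F in finite_subsets_at_top J. finite F \<and> F \<subseteq> J \<and> k \<in> F"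
      unfolding eventually_finite_subsets_at_top using k by (intro exI[of _ "{k}"]) auto
  qed (use s in \<open>auto simp: has_sum_def\<close>)
  then have "Q k (x - s) = 0" if "k \<in> J" for k using that by (simp add: blinfun.diff_right)
  then have "x - s = 0" by (rule Q_complete)
  then show ?thesis using s by simp
qed

lemma filterlim_symmetric_intervals:
  "filterlim (\<lambda>n. J \<inter> {- int n..int n}) (finite_subsets_at_top J) sequentially"
proof (subst filterlim_finite_subsets_at_top, intro allI impI)
  fix X assume X: "finite X \<and> X \<subseteq> J"
  define N where "N = nat (Max (insert 0 (abs ` X)))"
  have "X \<subseteq> {- int n..int n}" if n: "n \<ge> N" for n
  proof
    fix k assume "k \<in> X"
    then have "\<bar>k\<bar> \<le> Max (insert 0 (abs ` X))" using X by (intro Max_ge) auto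
    then show "k \<in> {- int n..int n}" using n by (auto simp: N_def)
  qed
  then show "\<forall>\<^sub>F n in sequentially. finite (J \<inter> {- int n..int n}) \<and> X \<subseteq>
    J \<inter> {- int n..int n} \<and> J \<inter> {- int n..int n} \<subseteq> J"
    unfolding eventually_sequentially using X by (intro exI[of _ N]) auto
qed

lemma represents_imp:
  assumes "represents J (\<lambda>j. range (Q j)) x f" "k \<in> J"
  shows "f k = Q k x"
proof -
  have f: "\<And>j. j \<in> J \<Longrightarrow> f j \<in> range (Q j)" and lim: "(\<lambda>n. \<Sum>j\<in>J \<inter> {- int n..int n}. f j) \<longlonglongrightarrow> x"
    using assms(1) by (auto simp: represents_def)
  have "Q k x = f k"
  proof (rule Q_has_sum_component[OF assms(2) f lim])
    have "\<forall>\<^sub>F n in sequentially. finite (J \<inter> {- int n..int n}) \<and> {k} \<subseteq>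
      J \<inter> {- int n..int n} \<and> J \<inter> {- int n..int n} \<subseteq> J"
      using filterlim_symmetric_intervals assms(2) unfolding filterlim_finite_subsets_at_top by blast
    then show "\<forall>\<^sub>F n in sequentially. finite (J \<inter> {- int n..int n}) \<and> J \<inter> {- int n..int n} \<subseteq>
      J \<and> k \<in> J \<inter> {- int n..int n}"
      by eventually_elim auto
  qed auto
  then show ?thesis by simp
qed

theorem unconditional_basis: "unconditional_subspace_basis J (\<lambda>j. range (Q j))"
  unfolding unconditional_subspace_basis_def subspace_basis_def
proof (intro conjI ballI allI impI csubspace_range_Q closed_range_Q)
  fix x
  \<comment> \<open>\<open>restrict\<close> supplies the value \<open>undefined\<close> outside J
    that \<open>PiE\<close> prescribes, so the family is unique as a function on all
    integers.\<close>
  have "represents J (\<lambda>j. range (Q j)) x (restrict (\<lambda>j. Q j x) J)"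
    unfolding represents_def
  proof
    have "(\<lambda>n. \<Sum>j\<in>J \<inter> {- int n..int n}. Q j x) \<longlonglongrightarrow> x"
      using filterlim_compose[OF Q_has_sum[unfolded has_sum_def] filterlim_symmetric_intervals] .
    then show "(\<lambda>n. \<Sum>j\<in>J \<inter> {- int n..int n}. restrict (\<lambda>j. Q j x) J j) \<longlonglongrightarrow> x" by simp
  qed auto
  moreover have "f = restrict (\<lambda>j. Q j x) J" if f: "represents J (\<lambda>j. range (Q j)) x f" for f
  proof (rule PiE_ext)
    show "f \<in> Pi\<^sub>E J (\<lambda>j. range (Q j))" using f by (simp add: represents_def)
  qed (use represents_imp[OF f] in auto)
  ultimately show "\<exists>!f. represents J (\<lambda>j. range (Q j)) x f" by blast
next
  fix x f and \<sigma> :: "nat \<Rightarrow> int"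
  assume f: "represents J (\<lambda>j. range (Q j)) x f" and \<sigma>: "bij_betw \<sigma> UNIV J"
  have "(f has_sum x) J"
    using Q_has_sum[of x] represents_imp[OF f] by (subst has_sum_cong[where g = "\<lambda>j. Q j x"]) auto
  then have "((\<lambda>k. f (\<sigma> k)) has_sum x) UNIV" by (subst has_sum_reindex_bij_betw[OF \<sigma>])
  then show "(\<lambda>k. f (\<sigma> k)) sums x" by (rule has_sum_imp_sums)
qed auto

end

section \<open>The perturbed operator\<close>

locale perturbed_operator = separated_segments +
  fixes D :: "'a::complex_hilbert_space set" and T B A :: "'a \<Rightarrow> 'a" and b :: real
  assumes T: "self_adjoint_operator D T"
    and spec: "op_spectrum D T \<subseteq> (\<Union>j\<in>J. complex_of_real ` {\<alpha> j..\<beta> j})"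
    and B: "bounded_clinear B" and B_bound: "norm (B x) \<le> b * norm x"
    and b: "0 \<le> b" "b < d / 2" and A_def: "A = (\<lambda>x. T x + B x)"
begin

lemma T_linear: "linear_operator D T"
  using T by (simp add: self_adjoint_operator_def)

lemma T_bounded_below:
  assumes "dist_ge z e" "x \<in> D"
  shows "e * norm x \<le> norm (T x - z *\<^sub>C x)"
proof (rule self_adjoint_resolvent_bound[OF T _ _ assms(2)])
  show "op_spectrum D T \<subseteq> complex_of_real ` (\<Union>j\<in>J. {\<alpha> j..\<beta> j})" using spec by blast
qed (use assms in \<open>auto simp: dist_ge_def\<close>)

lemma T_resolvent_set:
  assumes "dist_ge z e" "e > 0"
  shows "z \<in> resolvent_set D T"
proof (rule ccontr)
  assume "z \<notin> resolvent_set D T"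
  then obtain j s where "j \<in> J" "s \<in> {\<alpha> j..\<beta> j}" "z = of_real s" using spec by (auto simp: op_spectrum_def)
  then show False using assms by (force simp: dist_ge_def)
qed

lemma A_linear: "linear_operator D A"
  and A_resolvent_set: "dist_ge z e \<Longrightarrow> b < e \<Longrightarrow> z \<in> resolvent_set D A"
  and A_bounded_below: "dist_ge z e \<Longrightarrow> b < e \<Longrightarrow> x \<in> D \<Longrightarrow> (e - b) * norm x \<le> norm (A x - z *\<^sub>C x)"
proof -
  have *: "linear_operator D A" "dist_ge z e \<Longrightarrow> b < e \<Longrightarrow> z \<in> resolvent_set D A"
    "dist_ge z e \<Longrightarrow> b < e \<Longrightarrow> x \<in> D \<Longrightarrow> (e - b) * norm x \<le> norm (A x - z *\<^sub>C x)"
    if "dist_ge w e'" "b < e'" for z e x w e'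
    unfolding A_def
    using resolvent_set_perturbed[OF T_linear B B_bound b(1) _ T_resolvent_set T_bounded_below] that b
      by auto
  \<comment> \<open>The perturbation lemma yields linearity of A only together with some point at
    distance more than b from the segments; i (b + 1) is one.\<close>
  have "dist_ge (\<i> * of_real (b + 1)) (b + 1)"
    unfolding dist_ge_def
  proof (intro ballI)
    fix s :: real
    show "b + 1 \<le> cmod (\<i> * of_real (b + 1) - of_real s)"
      using abs_Im_le_cmod[of "\<i> * of_real (b + 1) - of_real s"] b by simp
  qed
  from * [OF this] show "linear_operator D A" "dist_ge z e \<Longrightarrow> b < e \<Longrightarrow> z \<in> resolvent_set D A"
    "dist_ge z e \<Longrightarrow> b < e \<Longrightarrow> x \<in> D \<Longrightarrow> (e - b) * norm x \<le> norm (A x - z *\<^sub>C x)" by auto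
qed

lemma dist_ge_Im: "dist_ge z \<bar>Im z\<bar>"
  unfolding dist_ge_def
proof (intro ballI)
  fix s :: real
  show "\<bar>Im z\<bar> \<le> cmod (z - of_real s)" using abs_Im_le_cmod[of "z - of_real s"] by simp
qed

text \<open>The points at distance more than c from all segments. The witness e > c provides a
  margin uniform over infinitely many segments, which makes the set open. \<open>Om 0\<close>
  consists of resolvent points of T, \<open>Om b\<close> of resolvent points of A.\<close>

definition Om :: "real \<Rightarrow> complex set" where
  "Om c = {z. \<exists>e>c. dist_ge z e}"

lemma open_Om: "open (Om c)"
  unfolding open_dist
proof
  fix z assume "z \<in> Om c"
  then obtain e where e: "e > c" "dist_ge z e" by (auto simp: Om_def)
  have "w \<in> Om c" if w: "dist w z < (e - c) / 2" for w
    unfolding Om_def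
  proof (intro CollectI exI conjI)
    show "c < (e + c) / 2" using e by simp
    show "dist_ge w ((e + c) / 2)"
      unfolding dist_ge_def
    proof (intro ballI)
      fix j s assume "j \<in> J" "s \<in> {\<alpha> j..\<beta> j}"
      then have "e \<le> cmod (z - of_real s)" using e by (auto simp: dist_ge_def)
      also have "\<dots> \<le> cmod (z - w) + cmod (w - of_real s)"
        using norm_triangle_ineq[of "z - w" "w - of_real s"] by simp
      finally show "(e + c) / 2 \<le> cmod (w - of_real s)" using w
        by (simp add: dist_norm norm_minus_commute field_simps)
    qed
  qed
  then show "\<exists>\<epsilon>>0. \<forall>w. dist w z < \<epsilon> \<longrightarrow> w \<in> Om c" using e by (intro exI[of _ "(e - c)/2"]) auto
qed

lemma Om_T: "z \<in> Om 0 \<Longrightarrow> z \<in> resolvent_set D T"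
  using T_resolvent_set by (auto simp: Om_def)

lemma Om_A: "z \<in> Om b \<Longrightarrow> z \<in> resolvent_set D A"
  using A_resolvent_set by (auto simp: Om_def)

lemma Om_mono: "Om b \<subseteq> Om 0"
  using b unfolding Om_def by (auto intro: order_le_less_trans)

lemma cnj_Om: "z \<in> Om 0 \<Longrightarrow> cnj z \<in> Om 0"
proof -
  assume z: "z \<in> Om 0"
  have "cmod (cnj z - of_real s) = cmod (z - of_real s)" for s
    by (metis complex_cnj_complex_of_real complex_cnj_diff complex_mod_cnj)
  then show ?thesis using z by (simp add: Om_def dist_ge_def)
qed

sublocale RT: pseudo_resolvent "Om 0" "resolvent D T"
proof (unfold_locales)
  fix z w c and x :: 'a assume z: "z \<in> Om 0"
  show "resolvent D T z (c *\<^sub>C x) = c *\<^sub>C resolvent D T z x"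
    by (rule resolvent_scaleC[OF T_linear Om_T[OF z]])
  assume w: "w \<in> Om 0"
  show "resolvent D T z x - resolvent D T w x = (z - w) *\<^sub>C resolvent D T z (resolvent D T w x)"
    by (rule resolvent_identity[OF T_linear Om_T[OF z] Om_T[OF w]])
qed (rule open_Om)

sublocale RA: pseudo_resolvent "Om b" "resolvent D A"
proof (unfold_locales)
  fix z w c and x :: 'a assume z: "z \<in> Om b"
  show "resolvent D A z (c *\<^sub>C x) = c *\<^sub>C resolvent D A z x"
    by (rule resolvent_scaleC[OF A_linear Om_A[OF z]])
  assume w: "w \<in> Om b"
  show "resolvent D A z x - resolvent D A w x = (z - w) *\<^sub>C resolvent D A z (resolvent D A w x)"
    by (rule resolvent_identity[OF A_linear Om_A[OF z] Om_A[OF w]])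
qed (rule open_Om)

lemma op_spectrum_A: "op_spectrum D A \<subseteq> (\<Union>j\<in>J. cnbhd b {\<alpha> j..\<beta> j})"
proof
  fix z assume z: "z \<in> op_spectrum D A"
  show "z \<in> (\<Union>j\<in>J. cnbhd b {\<alpha> j..\<beta> j})"
  proof (rule ccontr)
    assume "z \<notin> (\<Union>j\<in>J. cnbhd b {\<alpha> j..\<beta> j})"
    then have "\<exists>e>b. dist_ge z e" by (intro dist_ge_outside) auto
    then show False using z A_resolvent_set by (auto simp: op_spectrum_def)
  qed
qed

text \<open>Both orders of the second resolvent identity are needed: the first has the resolvent of
  T outermost, ready to be moved to y as an adjoint, and the second bounds the resolvent of A at x
  by that of T at x.\<close>

lemma resolvent_A_T:
  assumes z: "z \<in> Om b"
  shows "resolvent D A z x = resolvent D T z x - resolvent D T z (B (resolvent D A z x))"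
    and "resolvent D A z x = resolvent D T z x - resolvent D A z (B (resolvent D T z x))"
proof -
  have z0: "z \<in> Om 0" using z Om_mono by blast
  note RA = resolvent_props[OF A_linear Om_A[OF z]] and RT = resolvent_props[OF T_linear Om_T[OF z0]]
  define u where "u = resolvent D A z x"
  have AT: "A w = T w + B w" for w by (simp add: A_def)
  have "A u - z *\<^sub>C u = x" using RA(2)[of x] by (simp add: u_def)
  then have u: "u \<in> D" "T u - z *\<^sub>C u = x - B u"
    using RA(1)[of x] by (auto simp: u_def AT algebra_simps)
  show "resolvent D A z x = resolvent D T z x - resolvent D T z (B (resolvent D A z x))"
    using RT(3)[OF u(1)] unfolding u(2) by (simp add: blinfun.diff_right u_def)
  define v where "v = resolvent D T z x"
  have "T v - z *\<^sub>C v = x" using RT(2)[of x] by (simp add: v_def)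
  then have v: "v \<in> D" "A v - z *\<^sub>C v = x + B v"
    using RT(1)[of x] by (auto simp: v_def AT algebra_simps)
  show "resolvent D A z x = resolvent D T z x - resolvent D A z (B (resolvent D T z x))"
    using RA(3)[OF v(1)] unfolding v(2) by (simp add: blinfun.add_right v_def algebra_simps)
qed

lemma norm_resolvent_A_le:
  assumes "dist_ge z e" "b < e"
  shows "norm (resolvent D A z) \<le> 1 / (e - b)"
  by (rule resolvent_norm[OF A_linear A_resolvent_set[OF assms] _ A_bounded_below[OF assms]]) (use assms in auto)

lemma norm_resolvent_T_le:
  assumes "dist_ge z e" "0 < e"
  shows "norm (resolvent D T z) \<le> 1 / e"
  by (rule resolvent_norm[OF T_linear T_resolvent_set[OF assms] assms(2) T_bounded_below[OF assms(1)]])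

text \<open>The outer resolvent of T moves to y as its adjoint, which by normality has the same norm
  on y. The resolvent of A is then traded for that of T at the cost of the factor 1 + b / (r - b).
  Each vector now meets a resolvent of T alone, as the square sums require.\<close>

lemma resolvent_difference_bound:
  assumes "dist_ge z r" "b < r"
  shows "cmod (cinner (resolvent D A z x) y - cinner (resolvent D T z x) y)
    \<le> b * (1 + b / (r - b)) * (norm (resolvent D T z x) * norm (resolvent D T z y))"
proof -
  have r0: "0 < r" using assms b by simp
  have z: "z \<in> Om b" using assms by (auto simp: Om_def)
  then have z0: "z \<in> Om 0" using Om_mono by blast
  have "norm (resolvent D A z x) \<le>
    norm (resolvent D T z x) + norm (resolvent D A z (B (resolvent D T z x)))"
    by (subst resolvent_A_T(2)[OF z]) (rule norm_triangle_ineq4)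
  also have "norm (resolvent D A z (B (resolvent D T z x))) \<le> 1 / (r - b) * (b * norm (resolvent D T z x))"
    using assms by (intro order_trans[OF norm_blinfun] mult_mono norm_resolvent_A_le B_bound) auto
  finally have 1: "norm (resolvent D A z x) \<le> (1 + b / (r - b)) * norm (resolvent D T z x)"
    by (simp add: algebra_simps)
  have "cinner (resolvent D A z x) y - cinner (resolvent D T z x) y =
    - cinner (resolvent D T z (B (resolvent D A z x))) y"
    by (subst resolvent_A_T(1)[OF z]) (simp add: cinner_diff_left)
  also have "\<dots> = - cinner (B (resolvent D A z x)) (resolvent D T (cnj z) y)"
    by (simp add: resolvent_adjoint[OF T Om_T[OF z0] Om_T[OF cnj_Om[OF z0]]])
  also have "cmod \<dots> \<le> norm (B (resolvent D A z x)) * norm (resolvent D T z y)"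
    using cinner_cauchy_schwarz[of "B (resolvent D A z x)" "resolvent D T (cnj z) y"]
    by (simp add: resolvent_norm_cnj[OF T Om_T[OF z0] Om_T[OF cnj_Om[OF z0]]])
  also have "\<dots> \<le> b * ((1 + b / (r - b)) * norm (resolvent D T z x)) * norm (resolvent D T z y)"
    using 1 b by (intro mult_right_mono order_trans[OF B_bound] mult_left_mono) auto
  finally show ?thesis by (simp add: mult_ac)
qed

end

section \<open>Riesz projections of T and of A on a fixed radius\<close>

locale riesz_contours = perturbed_operator +
  fixes r :: real
  assumes r: "b < r" "r < d / 2"
begin

abbreviation "\<Gamma> j \<equiv> stadium_path (\<alpha> j) (\<beta> j) r"
text \<open>The projections of T and of A use the same contours, so their difference is a single
  integral of the difference of the resolvents.\<close>

definition "P j = RT.Q (\<alpha> j) (\<beta> j) r"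
definition "Q j = RA.Q (\<alpha> j) (\<beta> j) r"

lemma r_pos: "0 < r"
  using r b by simp

lemma Q_eq: "Q j = riesz_projection D A (\<Gamma> j)"
  by (simp add: Q_def RA.Q_def riesz_projection_def)

lemma \<Gamma>_dist_ge: "j \<in> J \<Longrightarrow> z \<in> path_image (\<Gamma> j) \<Longrightarrow> dist_ge z r"
  using stadium_dist_ge r r_pos by simp

lemma \<Gamma>_Om: "j \<in> J \<Longrightarrow> path_image (\<Gamma> j) \<subseteq> Om b" "j \<in> J \<Longrightarrow> path_image (\<Gamma> j) \<subseteq> Om 0"
  using \<Gamma>_dist_ge r r_pos by (auto simp: Om_def)

text \<open>The upper radius is the midpoint between r and d/2. Idempotence needs a second, larger
  contour, and the strict inequality r < d/2 provides it.\<close>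

lemma wider_contours:
  assumes "j \<in> J" "\<rho> \<in> closed_segment r ((r + d / 2) / 2)"
  shows "path_image (stadium_path (\<alpha> j) (\<beta> j) \<rho>) \<subseteq> Om b"
proof -
  have "r \<le> \<rho>" "\<rho> \<le> d / 2" using assms r by (auto simp: closed_segment_eq_real_ivl split: if_splits)
  then have "dist_ge z \<rho> \<and> b < \<rho>" if "z \<in> path_image (stadium_path (\<alpha> j) (\<beta> j) \<rho>)" for z
    using stadium_dist_ge[OF assms(1) _ _ that] r r_pos by simp
  then show ?thesis by (auto simp: Om_def)
qed

lemma P_idem:
  assumes "j \<in> J"
  shows "P j (P j x) = P j x"
  unfolding P_def
proof (rule RT.Q_idempotent[OF le[OF assms] r_pos])
  show "r < (r + d / 2) / 2" using r by simp
  show "path_image (stadium_path (\<alpha> j) (\<beta> j) \<rho>) \<subseteq> Om 0" if "\<rho> \<in> closed_segment r ((r + d / 2) / 2)" for \<rho>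
    using wider_contours[OF assms that] Om_mono by (rule subset_trans)
qed

lemma Q_idem:
  assumes "j \<in> J"
  shows "Q j (Q j x) = Q j x"
  unfolding Q_def
proof (rule RA.Q_idempotent[OF le[OF assms] r_pos])
  show "r < (r + d / 2) / 2" using r by simp
qed (rule wider_contours[OF assms])

lemma separated_ends:
  assumes "i \<in> J" "j \<in> J" "i \<noteq> j"
  shows "\<beta> i + r < \<alpha> j - r \<or> \<beta> j + r < \<alpha> i - r"
proof (cases "i < j")
  case True
  then show ?thesis using gap_less_d[OF assms(1) True] r by simp
next
  case False
  then show ?thesis using gap_less_d[OF assms(2), of i] r assms by simp
qed

lemma P_orth: "i \<in> J \<Longrightarrow> j \<in> J \<Longrightarrow> i \<noteq> j \<Longrightarrow> P i (P j x) = 0"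
  unfolding P_def by (intro RT.Q_orthogonal le r_pos \<Gamma>_Om separated_ends)

lemma Q_orth: "i \<in> J \<Longrightarrow> j \<in> J \<Longrightarrow> i \<noteq> j \<Longrightarrow> Q i (Q j x) = 0"
  unfolding Q_def by (intro RA.Q_orthogonal le r_pos \<Gamma>_Om separated_ends)

text \<open>Taking adjoints of the resolvent conjugates z, and the stadium is symmetric with
  reversed orientation; the resulting sign cancels the one from conjugating 1 / (2 pi i).\<close>

lemma P_self_adjoint:
  assumes j: "j \<in> J"
  shows "cinner (P j x) y = cinner x (P j y)"
proof -
  define f where "f = (\<lambda>z. cinner (resolvent D T z x) y)"
  define g where "g = (\<lambda>z. cinner (resolvent D T z y) x)"
  have gf: "(cnj \<circ> g \<circ> cnj) z = f z" if "z \<in> path_image (\<Gamma> j)" for z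
  proof -
    have z: "z \<in> Om 0" using that \<Gamma>_Om[OF j] by blast
    have "cnj (cinner (resolvent D T (cnj z) y) x) = cinner x (resolvent D T (cnj z) y)"
      by (rule cinner_commute[symmetric])
    then show ?thesis
      by (simp add: f_def g_def resolvent_adjoint[OF T Om_T[OF z] Om_T[OF cnj_Om[OF z]]])
  qed
  have gc: "continuous_on (path_image (\<Gamma> j)) g" and fc: "continuous_on (path_image (\<Gamma> j)) f"
    unfolding f_def g_def by (intro RT.R_functional_continuous cfunctional_cinner \<Gamma>_Om j)+
  have "contour_integral (\<Gamma> j) f = contour_integral (\<Gamma> j) (cnj \<circ> g \<circ> cnj)"
    by (rule contour_integral_eq) (rule gf[symmetric])
  also have "\<dots> = - cnj (contour_integral (\<Gamma> j) g)"
    by (rule contour_integral_stadium_cnj[OF gc continuous_on_eq[OF fc gf[symmetric]]])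
  finally have "cinner (P j x) y = cnj (cinner (P j y) x)"
    unfolding P_def by (simp add: RT.functional_Q[OF \<Gamma>_Om(2)[OF j] cfunctional_cinner] f_def g_def)
  then show ?thesis using cinner_commute[of x "P j y"] by simp
qed

text \<open>The finite sum E of the \<open>P j x\<close> satisfies <E, x> = |E|^2 = s, so
  Cauchy-Schwarz gives s^2 <= s |x|^2.\<close>

lemma P_bessel:
  assumes F: "finite F" "F \<subseteq> J"
  shows "(\<Sum>j\<in>F. (norm (P j x))\<^sup>2) \<le> (norm x)\<^sup>2"
proof -
  define s where "s = (\<Sum>j\<in>F. (norm (P j x))\<^sup>2)"
  define E where "E = (\<Sum>j\<in>F. P j x)"
  have PP: "cinner (P j x) x = of_real ((norm (P j x))\<^sup>2)" if "j \<in> F" for j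
  proof -
    have j: "j \<in> J" using that F by blast
    have "cinner (P j x) x = cinner (P j (P j x)) x" using P_idem[OF j] by simp
    also have "\<dots> = cinner (P j x) (P j x)" by (rule P_self_adjoint[OF j])
    finally show ?thesis by (simp only: cinner_self)
  qed
  have Ex: "cinner E x = of_real s"
    unfolding E_def s_def cinner_sum_left of_real_sum by (rule sum.cong) (auto simp: PP)
  have "cinner E E = (\<Sum>i\<in>F. \<Sum>j\<in>F. cinner (P j x) (P i x))"
    by (simp add: E_def cinner_sum_left cinner_sum_right)
  also have "\<dots> = (\<Sum>i\<in>F. \<Sum>j\<in>F. if j = i then of_real ((norm (P i x))\<^sup>2) else 0)"
  proof (intro sum.cong refl)
    fix i j assume ij: "i \<in> F" "j \<in> F"
    then have J: "i \<in> J" "j \<in> J" using F by auto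
    show "cinner (P j x) (P i x) = (if j = i then of_real ((norm (P i x))\<^sup>2) else 0)"
    proof (cases "j = i")
      case False
      have "cinner (P j x) (P i x) = cinner (P i (P j x)) x" by (rule P_self_adjoint[OF J(1), symmetric])
      then show ?thesis using False P_orth[OF J(1,2)] by simp
    qed (simp add: cinner_self)
  qed
  also have "\<dots> = of_real s" using F(1) by (simp add: s_def)
  finally have EE: "(norm E)\<^sup>2 = s" by (simp add: norm_power2_eq_cinner)
  have s0: "s \<ge> 0" by (simp add: s_def sum_nonneg)
  have "s \<le> norm E * norm x" using cinner_cauchy_schwarz[of E x] Ex s0 by simp
  then have "s\<^sup>2 \<le> (norm E * norm x)\<^sup>2" using s0 by (intro power_mono)
  then have "s * s \<le> s * (norm x)\<^sup>2" by (simp add: power_mult_distrib EE power2_eq_square[of s])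
  then have "s \<le> (norm x)\<^sup>2" using s0 by (cases "s = 0") auto
  then show ?thesis by (simp add: s_def)
qed

lemma P_sum_bound:
  assumes F: "finite F" "F \<subseteq> J"
  shows "(\<Sum>j\<in>F. cmod (cinner (P j x) y)) \<le> (norm x)\<^sup>2 + (norm y)\<^sup>2"
proof -
  have "cmod (cinner (P j x) y) \<le> (norm (P j x))\<^sup>2 + (norm (P j y))\<^sup>2" if "j \<in> F" for j
  proof -
    have j: "j \<in> J" using that F by blast
    have "cinner (P j x) y = cinner (P j (P j x)) y" using P_idem[OF j] by simp
    also have "\<dots> = cinner (P j x) (P j y)" by (rule P_self_adjoint[OF j])
    finally have "cmod (cinner (P j x) y) \<le> norm (P j x) * norm (P j y)"
      using cinner_cauchy_schwarz by metis
    also have "\<dots> \<le> (norm (P j x))\<^sup>2 + (norm (P j y))\<^sup>2"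
      using sum_squares_bound[of "norm (P j x)" "norm (P j y)"]
        mult_nonneg_nonneg[OF norm_ge_zero norm_ge_zero, of "P j x" "P j y"] by linarith
    finally show ?thesis .
  qed
  then have "(\<Sum>j\<in>F. cmod (cinner (P j x) y)) \<le> (\<Sum>j\<in>F. (norm (P j x))\<^sup>2 + (norm (P j y))\<^sup>2)"
    by (rule sum_mono)
  also have "\<dots> \<le> (norm x)\<^sup>2 + (norm y)\<^sup>2"
    unfolding sum.distrib using P_bessel[OF F] by (intro add_mono)
  finally show ?thesis .
qed

end

section \<open>Comparison of the perturbed with the unperturbed projections\<close>

context riesz_contours
begin

text \<open>The resolvent of T has norm at most 1/r at every contour point, so moving by 2 d + 2 r
  changes its action by a factor that depends neither on j nor on the contour length.\<close>

lemma resolvent_T_near: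
  assumes z: "dist_ge z r" and a: "cmod (z - Complex a r) \<le> 2 * d + 2 * r"
  shows "norm (resolvent D T z x) \<le> (1 + (2 * d + 2 * r) / r) * norm (resolvent D T (Complex a r) x)"
proof -
  have "dist_ge (Complex a r) r" using dist_ge_Im[of "Complex a r"] r_pos by simp
  then have w: "Complex a r \<in> Om 0" and z0: "z \<in> Om 0" using z r_pos by (auto simp: Om_def)
  have "cmod (z - Complex a r) * norm (resolvent D T z) \<le> (2 * d + 2 * r) * (1 / r)"
    using a norm_resolvent_T_le[OF z r_pos] d r_pos by (intro mult_mono) auto
  then have "(1 + cmod (z - Complex a r) * norm (resolvent D T z)) * norm (resolvent D T (Complex a r) x)
    \<le> (1 + (2 * d + 2 * r) / r) * norm (resolvent D T (Complex a r) x)"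
    by (intro mult_right_mono) auto
  then show ?thesis using RT.R_apply_near[OF z0 w, of x] by linarith
qed

text \<open>A long segment carries many sample points, so the number of terms per j is unbounded.
  Only the union of all sample points matters: it is d-separated, and the square sum estimate is
  applied to it once for x and once for y.\<close>

lemma Q_P_sum_bound:
  "\<exists>K\<ge>0. \<forall>F x y. finite F \<longrightarrow> F \<subseteq> J \<longrightarrow>
    (\<Sum>j\<in>F. cmod (cinner (Q j x) y - cinner (P j x) y)) \<le> K * ((norm x)\<^sup>2 + (norm y)\<^sup>2)"
proof -
  \<comment> \<open>\<open>K1\<close> combines the form bound with the passage to sample points,
    squared because both x and y are moved; \<open>K2\<close> is the contour length charged to one
    sample point; \<open>K3\<close> is the constant of the square sum estimate.\<close>
  define K1 where "K1 = b * (1 + b / (r - b)) * (1 + (2 * d + 2 * r) / r)\<^sup>2"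
  define K2 where "K2 = 4 * d + 2 * pi * r"
  define K3 where "K3 = 10 * (4 / d\<^sup>2 + 3 / (2 * r\<^sup>2))"
  have K: "K1 \<ge> 0" "K2 \<ge> 0" "K3 \<ge> 0" using b r d r_pos by (auto simp: K1_def K2_def K3_def)
  define G where "G a x = (norm (resolvent D T (Complex a r) x))\<^sup>2" for a x
  define covers where "covers j X \<longleftrightarrow> (\<forall>f M. continuous_on (path_image (\<Gamma> j)) f \<longrightarrow> (\<forall>a\<in>X. 0 \<le> M a) \<longrightarrow>
      (\<forall>z\<in>path_image (\<Gamma> j). \<forall>a\<in>X. cmod (z - Complex a r) \<le> 2 * d + 2 * r \<longrightarrow> cmod (f z) \<le> M a)
      \<longrightarrow> cmod (contour_integral (\<Gamma> j) f) \<le> K2 * (\<Sum>a\<in>X. M a))" for j X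
  have "\<exists>X. finite X \<and> X \<subseteq> {\<alpha> j..\<beta> j} \<and> separated d X \<and> covers j X" if j: "j \<in> J" for j
  proof (rule stadium_sample_points[OF le[OF j] r_pos d])
    fix X assume X: "finite X" "X \<subseteq> {\<alpha> j..\<beta> j}" "separated d X"
      "\<And>f M. \<lbrakk>continuous_on (path_image (\<Gamma> j)) f; \<And>a. a \<in> X \<Longrightarrow> 0 \<le> M a;
        \<And>z a. z \<in> path_image (\<Gamma> j) \<Longrightarrow> a \<in> X \<Longrightarrow> cmod (z - Complex a r) \<le> 2 * d + 2 * r \<Longrightarrow> cmod (f z) \<le> M a\<rbrakk>
        \<Longrightarrow> cmod (contour_integral (\<Gamma> j) f) \<le> (4 * d + 2 * pi * r) * (\<Sum>a\<in>X. M a)"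
    have "covers j X" unfolding covers_def K2_def by (intro allI impI X(4)) auto
    with X(1-3) show ?thesis by blast
  qed
  then obtain X where X: "\<And>j. j \<in> J \<Longrightarrow> finite (X j)" "\<And>j. j \<in> J \<Longrightarrow> X j \<subseteq> {\<alpha> j..\<beta> j}"
    "\<And>j. j \<in> J \<Longrightarrow> separated d (X j)" "\<And>j. j \<in> J \<Longrightarrow> covers j (X j)"
    by metis
  have single: "cmod (cinner (Q j x) y - cinner (P j x) y) \<le> K2 * (\<Sum>a\<in>X j. K1 * (G a x + G a y))"
    if j: "j \<in> J" for j x y
  proof -
    define fA fT where "fA = (\<lambda>z. cinner (resolvent D A z x) y)" and "fT =
      (\<lambda>z. cinner (resolvent D T z x) y)"
    have cont: "continuous_on (path_image (\<Gamma> j)) fA" "continuous_on (path_image (\<Gamma> j)) fT"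
      unfolding fA_def fT_def
      by (intro RA.R_functional_continuous RT.R_functional_continuous cfunctional_cinner \<Gamma>_Om j)+
    have "cinner (Q j x) y - cinner (P j x) y =
      - 1 / (2 * of_real pi * \<i>) * contour_integral (\<Gamma> j) (\<lambda>z. fA z - fT z)"
      unfolding Q_def P_def RA.functional_Q[OF \<Gamma>_Om(1)[OF j] cfunctional_cinner]
        RT.functional_Q[OF \<Gamma>_Om(2)[OF j] cfunctional_cinner]
      by (subst contour_integral_diff) (auto simp: contour_integral_stadium(1) cont fA_def[symmetric] fT_def[symmetric] algebra_simps)
    then have "cmod (cinner (Q j x) y - cinner (P j x) y) =
      cmod (contour_integral (\<Gamma> j) (\<lambda>z. fA z - fT z)) / (2 * pi)"
      by (simp add: norm_mult norm_divide)
    also have "\<dots> \<le> cmod (contour_integral (\<Gamma> j) (\<lambda>z. fA z - fT z)) / 1"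
      using pi_ge_two by (intro divide_left_mono) auto
    also have "\<dots> \<le> K2 * (\<Sum>a\<in>X j. K1 * (G a x + G a y))"
      unfolding div_by_1
    proof (rule X(4)[OF j, unfolded covers_def, rule_format])
      show "continuous_on (path_image (\<Gamma> j)) (\<lambda>z. fA z - fT z)" by (intro continuous_intros cont)
      show "0 \<le> K1 * (G a x + G a y)" for a using K by (simp add: G_def)
      fix z a assume z: "z \<in> path_image (\<Gamma> j)" and a: "cmod (z - Complex a r) \<le> 2 * d + 2 * r"
      let ?u = "norm (resolvent D T (Complex a r) x)" and ?v = "norm (resolvent D T (Complex a r) y)"
      let ?c = "1 + (2 * d + 2 * r) / r"
      have c0: "0 \<le> ?c" using d r_pos by simp
      have k0: "0 \<le> b * (1 + b / (r - b))" using b r by simp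
      have zd: "dist_ge z r" using \<Gamma>_dist_ge[OF j z] .
      have "cmod (fA z - fT z) \<le>
        b * (1 + b / (r - b)) * (norm (resolvent D T z x) * norm (resolvent D T z y))"
        unfolding fA_def fT_def by (rule resolvent_difference_bound[OF zd r(1)])
      also have "\<dots> \<le> b * (1 + b / (r - b)) * ((?c * ?u) * (?c * ?v))"
        using c0 by (intro mult_left_mono[OF _ k0] mult_mono resolvent_T_near[OF zd a]) auto
      also have "\<dots> = K1 * (?u * ?v)" by (simp add: K1_def power2_eq_square mult_ac)
      also have "\<dots> \<le> K1 * (G a x + G a y)"
        using sum_squares_bound[of ?u ?v] mult_nonneg_nonneg[OF norm_ge_zero norm_ge_zero, of "resolvent D T (Complex a r) x" "resolvent D T (Complex a r) y"]
        unfolding G_def by (intro mult_left_mono K) linarith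
      finally show "cmod (fA z - fT z) \<le> K1 * (G a x + G a y)" .
    qed
    finally show ?thesis .
  qed
  show ?thesis
  proof (intro exI[of _ "K2 * (K1 * K3)"] conjI allI impI)
    show "0 \<le> K2 * (K1 * K3)" using K by simp
    fix F x y assume F: "finite F" "F \<subseteq> J"
    define Y where "Y = (\<Union>j\<in>F. X j)"
    \<comment> \<open>Sample points lie in their segments, and different segments are d apart, so
      separation within each segment extends to the whole union.\<close>
    have far: "d \<le> \<bar>s - t\<bar>" if "i \<in> F" "j \<in> F" "i \<noteq> j" "s \<in> X i" "t \<in> X j" for i j s t
      using segment_gap_d[of i j s t] X(2)[of i] X(2)[of j] that F by blast
    have disj: "X i \<inter> X j = {}" if "i \<in> F" "j \<in> F" "i \<noteq> j" for i j
      using far[OF that] d by fastforce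
    have Y: "finite Y" "separated d Y"
    proof -
      show "finite Y" using F X(1) by (auto simp: Y_def)
      show "separated d Y"
        unfolding separated_def
      proof (intro ballI impI)
        fix s t assume st: "s \<in> Y" "t \<in> Y" "s \<noteq> t"
        then obtain i j where ij: "i \<in> F" "s \<in> X i" "j \<in> F" "t \<in> X j" by (auto simp: Y_def)
        show "d \<le> \<bar>s - t\<bar>"
        proof (cases "i = j")
          case True
          then show ?thesis using X(3)[of i] ij F st by (auto simp: separated_def)
        next
          case False
          then show ?thesis using far ij by blast
        qed
      qed
    qed
    have res: "z \<in> resolvent_set D T" if "Im z \<noteq> 0" for z
      using T_resolvent_set[OF dist_ge_Im] that by simp
    have GY: "(\<Sum>a\<in>Y. G a u) \<le> K3 * (norm u)\<^sup>2" for u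
      unfolding G_def K3_def by (rule resolvent_square_sum[OF T res Y d r_pos])
    have "(\<Sum>j\<in>F. cmod (cinner (Q j x) y - cinner (P j x) y)) \<le> (\<Sum>j\<in>F. K2 * (\<Sum>a\<in>X j. K1 * (G a x + G a y)))"
      using F by (intro sum_mono single) auto
    also have "\<dots> = K2 * (\<Sum>a\<in>Y. K1 * (G a x + G a y))"
      unfolding Y_def sum_distrib_left[symmetric]
      by (subst sum.UNION_disjoint) (use F X(1) disj in \<open>auto simp: sum_distrib_left\<close>)
    also have "\<dots> = K2 * (K1 * ((\<Sum>a\<in>Y. G a x) + (\<Sum>a\<in>Y. G a y)))"
      by (simp add: sum_distrib_left[symmetric] sum.distrib)
    also have "\<dots> \<le> K2 * (K1 * (K3 * (norm x)\<^sup>2 + K3 * (norm y)\<^sup>2))"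
      using K by (intro mult_left_mono add_mono GY) auto
    finally show "(\<Sum>j\<in>F. cmod (cinner (Q j x) y - cinner (P j x) y)) \<le>
      K2 * (K1 * K3) * ((norm x)\<^sup>2 + (norm y)\<^sup>2)"
      by (simp add: algebra_simps)
  qed
qed

lemma Q_signed_bound:
  "\<exists>C. \<forall>F \<epsilon> x. finite F \<longrightarrow> F \<subseteq> J \<longrightarrow> (\<forall>j. \<epsilon> j \<in> {1, -1}) \<longrightarrow> norm (\<Sum>j\<in>F. \<epsilon> j *\<^sub>R Q j x) \<le> C * norm x"
proof -
  obtain K where K: "K \<ge> 0" "\<And>F x y. finite F \<Longrightarrow> F \<subseteq> J \<Longrightarrow>
    (\<Sum>j\<in>F. cmod (cinner (Q j x) y - cinner (P j x) y)) \<le> K * ((norm x)\<^sup>2 + (norm y)\<^sup>2)"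
    using Q_P_sum_bound by blast
  have "norm (\<Sum>j\<in>F. \<epsilon> j *\<^sub>R Q j x) \<le> 2 * (K + 1) * norm x"
    if F: "finite F" "F \<subseteq> J" and \<epsilon>: "\<forall>j. \<epsilon> j \<in> {1, -1}" for F x and \<epsilon> :: "int \<Rightarrow> real"
  proof -
    define v where "v = (\<Sum>j\<in>F. \<epsilon> j *\<^sub>R Q j x)"
    have bd: "cmod (cinner v y) \<le> (K + 1) * ((norm x)\<^sup>2 + (norm y)\<^sup>2)" for y
    proof -
      have "cinner v y = (\<Sum>j\<in>F. of_real (\<epsilon> j) * cinner (Q j x) y)"
        by (simp add: v_def cinner_sum_left scaleR_scaleC[where 'a = 'a] cinner_scaleC_left)
      also have "cmod \<dots> \<le> (\<Sum>j\<in>F. cmod (cinner (Q j x) y))"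
      proof (rule sum_norm_le)
        fix j
        have "\<bar>\<epsilon> j\<bar> = 1" using \<epsilon>[rule_format, of j] by auto
        then show "cmod (of_real (\<epsilon> j) * cinner (Q j x) y) \<le> cmod (cinner (Q j x) y)"
          by (simp add: norm_mult)
      qed
      also have "\<dots> \<le> (\<Sum>j\<in>F. cmod (cinner (Q j x) y - cinner (P j x) y) + cmod (cinner (P j x) y))"
      proof (rule sum_mono)
        fix j
        show "cmod (cinner (Q j x) y) \<le>
          cmod (cinner (Q j x) y - cinner (P j x) y) + cmod (cinner (P j x) y)"
          using norm_triangle_ineq[of "cinner (Q j x) y - cinner (P j x) y" "cinner (P j x) y"] by simp
      qed
      also have "\<dots> \<le> K * ((norm x)\<^sup>2 + (norm y)\<^sup>2) + ((norm x)\<^sup>2 + (norm y)\<^sup>2)"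
        unfolding sum.distrib by (intro add_mono K(2) P_sum_bound F)
      finally show ?thesis by (simp add: algebra_simps)
    qed
    have "norm v \<le> 2 * (K + 1) * norm x"
    proof (cases "v = 0")
      case False
      \<comment> \<open>The bound in |x|^2 + |y|^2 is made homogeneous by testing against v rescaled
        to the length of x; both squares are then |x|^2.\<close>
      define t where "t = norm x / norm v"
      have "cmod (cinner v (of_real t *\<^sub>C v)) = norm x * norm v"
        using False by (simp add: cinner_scaleC_right cinner_self norm_mult norm_power t_def power2_eq_square)
      moreover have "norm (of_real t *\<^sub>C v) = norm x" using False
        by (simp add: norm_scaleC t_def norm_divide)
      ultimately have "norm x * norm v \<le> norm x * (2 * (K + 1) * norm x)"
        using bd[of "of_real t *\<^sub>C v"] by (simp add: power2_eq_square algebra_simps)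
      moreover have "v = 0" if "x = 0" using that by (simp add: v_def blinfun.zero_right)
      ultimately show ?thesis using False by (cases "x = 0") auto
    qed (use K in simp)
    then show ?thesis by (simp add: v_def)
  qed
  then show ?thesis by blast
qed

section \<open>Completeness and invariance of the perturbed spectral subspaces\<close>

lemma dist_ge_or_open_stadium:
  "dist_ge w r \<or> (\<exists>j\<in>J. w \<in> open_stadium (\<alpha> j) (\<beta> j) r)"
proof (cases "dist_ge w r")
  case False
  then obtain j s where "j \<in> J" "s \<in> {\<alpha> j..\<beta> j}" "\<not> r \<le> cmod (w - of_real s)"
    unfolding dist_ge_def by blast
  then have "j \<in> J" "w \<in> open_stadium (\<alpha> j) (\<beta> j) r" unfolding mem_open_stadium not_le by blast+
  then show ?thesis by blast
qed simp

lemma open_stadium_unique: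
  assumes "i \<in> J" "j \<in> J" "w \<in> open_stadium (\<alpha> i) (\<beta> i) r" "w \<in> open_stadium (\<alpha> j) (\<beta> j) r"
  shows "i = j"
proof (rule ccontr)
  assume ne: "i \<noteq> j"
  obtain s t where s: "s \<in> {\<alpha> i..\<beta> i}" "cmod (w - of_real s) < r" and t: "t \<in> {\<alpha> j..\<beta> j}" "cmod (w - of_real t) < r"
    using assms(3,4) by (auto simp: mem_open_stadium)
  have "\<bar>s - t\<bar> = cmod (of_real s - of_real t)" by (simp flip: of_real_diff)
  also have "\<dots> < 2 * r" using norm_triangle_ineq4[of "w - of_real t" "w - of_real s"] s t by simp
  finally show False using segment_gap_d[OF assms(1,2) ne s(1) t(1)] r by simp
qed

text \<open>For the maximum principle: on the boundary of a stadium the resolvent bound with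
  distance r holds. Other segments are at least d - r > r away.\<close>

lemma frontier_open_stadium:
  assumes j: "j \<in> J" and w: "w \<in> frontier (open_stadium (\<alpha> j) (\<beta> j) r)"
  shows "dist_ge w r"
proof -
  have w1: "w \<in> closure (open_stadium (\<alpha> j) (\<beta> j) r)" "w \<notin> open_stadium (\<alpha> j) (\<beta> j) r"
    using w open_open_stadium by (auto simp: frontier_def interior_open)
  have "open_stadium (\<alpha> j) (\<beta> j) r \<subseteq> cnbhd r {\<alpha> j..\<beta> j}"
  proof
    fix z assume "z \<in> open_stadium (\<alpha> j) (\<beta> j) r"
    then obtain s where s: "s \<in> {\<alpha> j..\<beta> j}" "cmod (z - of_real s) < r" unfolding mem_open_stadium by blast
    show "z \<in> cnbhd r {\<alpha> j..\<beta> j}" unfolding mem_cnbhd[OF j] by (intro bexI[of _ s] less_imp_le s)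
  qed
  moreover have "closed (cnbhd r {\<alpha> j..\<beta> j})"
    unfolding cnbhd_def by (intro closed_Collect_le continuous_intros)
  ultimately have "w \<in> cnbhd r {\<alpha> j..\<beta> j}" using w1(1) closure_minimal by blast
  then obtain t where t: "t \<in> {\<alpha> j..\<beta> j}" "cmod (w - of_real t) \<le> r" by (auto simp: mem_cnbhd[OF j])
  show ?thesis
    unfolding dist_ge_def
  proof (intro ballI)
    fix i s assume i: "i \<in> J" "s \<in> {\<alpha> i..\<beta> i}"
    show "r \<le> cmod (w - of_real s)"
    proof (cases "i = j")
      case True
      then show ?thesis using w1(2) i by (force simp: mem_open_stadium)
    next
      case False
      have "d \<le> cmod (of_real s - of_real t)" using segment_gap_d[OF i(1) j False i(2) t(1)]
        by (simp flip: of_real_diff)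
      also have "\<dots> \<le> cmod (w - of_real t) + cmod (w - of_real s)"
        using norm_triangle_ineq4[of "w - of_real t" "w - of_real s"] by simp
      finally show ?thesis using t(2) r by linarith
    qed
  qed
qed

text \<open>If all \<open>Q j u\<close> vanish, the resolvent of \<open>A\<close> applied to \<open>u\<close> extends to an entire function, given inside
  \<open>\<Gamma> j\<close> by the Cauchy transform; it is bounded by the maximum principle and decays along the imaginary axis.\<close>

lemma Q_complete:
  assumes u: "\<And>j. j \<in> J \<Longrightarrow> Q j u = 0"
  shows "u = 0"
proof -
  have zero: "cinner (resolvent D A w u) y = 0" if w: "w = \<i> * of_real (b + 1)" for w y
  proof -
    define f where "f = (\<lambda>z. cinner (resolvent D A z u) y)"
    define g where "g j w = 1 / (2 * of_real pi * \<i>) * contour_integral (\<Gamma> j) (\<lambda>z. f z / (z - w))" for j w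
    \<comment> \<open>Outside \<open>Om b\<close> a point lies in an open stadium, and in only one,
      so the choice is determined there. Where both formulas make sense they agree by
      \<open>fg\<close>.\<close>
    define F where "F w = (if w \<in> Om b then f w else g (SOME j. j \<in> J \<and> w \<in> open_stadium (\<alpha> j) (\<beta> j) r) w)"
      for w
    have f_bound: "cmod (f z) \<le> 1 / (e - b) * (norm u * norm y)" if "dist_ge z e" "b < e" for z e
    proof -
      have "cmod (f z) \<le> norm (resolvent D A z u) * norm y" unfolding f_def by (rule cinner_cauchy_schwarz)
      also have "\<dots> \<le> (1 / (e - b) * norm u) * norm y"
        using that by (intro mult_right_mono order_trans[OF norm_blinfun] norm_resolvent_A_le) auto
      finally show ?thesis by (simp add: mult_ac)
    qed
    \<comment> \<open>In \<open>R_Q_winding\<close> the left side vanishes since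
      \<open>Q j u\<close> = 0, and the winding number is 1; what remains is that the resolvent
      equals the Cauchy transform.\<close>
    have fg: "f w = g j w" if j: "j \<in> J" and w: "w \<in> Om b" "w \<in> open_stadium (\<alpha> j) (\<beta> j) r" for j w
    proof -
      obtain s where s: "s \<in> {\<alpha> j..\<beta> j}" "cmod (w - of_real s) < r" using w(2)
        by (auto simp: mem_open_stadium)
      have "w \<notin> path_image (\<Gamma> j)" using stadium_dist_le[OF le[OF j] r_pos _ s(1)] s(2) by fastforce
      moreover have "winding_number (\<Gamma> j) w = 1"
        by (rule winding_number_stadium_inside[OF le[OF j] r_pos s])
      ultimately show ?thesis
        using RA.R_Q_winding[OF \<Gamma>_Om(1)[OF j] w(1) _ cfunctional_cinner, of u y] u[OF j]
        by (simp add: Q_def[symmetric] f_def g_def blinfun.zero_right)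
    qed
    have Ff: "F w = f w" if "w \<in> Om b" for w using that by (simp add: F_def)
    have Fg: "F w = g j w" if j: "j \<in> J" and w: "w \<in> open_stadium (\<alpha> j) (\<beta> j) r" for j w
    proof (cases "w \<in> Om b")
      case False
      have "(SOME i. i \<in> J \<and> w \<in> open_stadium (\<alpha> i) (\<beta> i) r) = j"
        by (rule some_equality) (use j w open_stadium_unique in blast)+
      then show ?thesis using False by (simp add: F_def)
    qed (simp add: Ff fg j w)
    have hol: "F holomorphic_on UNIV"
    proof -
      have "F field_differentiable at w" for w
      proof (cases "dist_ge w r")
        case True
        then have w: "w \<in> Om b" using r by (auto simp: Om_def)
        have "f holomorphic_on Om b" unfolding f_def
          by (rule RA.R_functional_holomorphic[OF cfunctional_cinner])
        then have "F holomorphic_on Om b" by (rule holomorphic_transform) (rule Ff[symmetric])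
        then show ?thesis using w open_Om by (auto simp: holomorphic_on_open field_differentiable_def)
      next
        case False
        then obtain j where j: "j \<in> J" "w \<in> open_stadium (\<alpha> j) (\<beta> j) r" using dist_ge_or_open_stadium
          by blast
        have "continuous_on (path_image (\<Gamma> j)) f"
          unfolding f_def by (intro RA.R_functional_continuous cfunctional_cinner \<Gamma>_Om j)
        then have "(\<lambda>w. contour_integral (\<Gamma> j) (\<lambda>z. f z / (z - w))) holomorphic_on - path_image (\<Gamma> j)"
          by (rule stadium_cauchy_transform_holomorphic)
        moreover have "open_stadium (\<alpha> j) (\<beta> j) r \<subseteq> - path_image (\<Gamma> j)"
          using stadium_dist_le[OF le[OF j(1)] r_pos] by (fastforce simp: mem_open_stadium)
        ultimately have "(\<lambda>w. contour_integral (\<Gamma> j) (\<lambda>z. f z / (z - w))) holomorphic_on open_stadium (\<alpha> j) (\<beta> j) r"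
          by (rule holomorphic_on_subset)
        then have "g j holomorphic_on open_stadium (\<alpha> j) (\<beta> j) r"
          unfolding g_def by (intro holomorphic_intros)
        then have "F holomorphic_on open_stadium (\<alpha> j) (\<beta> j) r"
          by (rule holomorphic_transform) (rule Fg[OF j(1), symmetric])
        then show ?thesis using j(2) open_open_stadium
          by (auto simp: holomorphic_on_open field_differentiable_def)
      qed
      then show ?thesis by (simp add: holomorphic_on_def)
    qed
    \<comment> \<open>The bound at distance r, the same for every j because all contours have the
      same radius. A radius depending on j would not give boundedness on the whole plane.\<close>
    define M where "M = 1 / (r - b) * (norm u * norm y)"
    have F_out: "cmod (F w) \<le> M" if "dist_ge w r" for w
    proof -
      have "w \<in> Om b" using that r by (auto simp: Om_def)
      then show ?thesis using f_bound[OF that r(1)] by (simp add: Ff M_def)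
    qed
    have "cmod (F w) \<le> M" for w
    proof (cases "dist_ge w r")
      case False
      then obtain j where j: "j \<in> J" "w \<in> open_stadium (\<alpha> j) (\<beta> j) r" using dist_ge_or_open_stadium by blast
      show ?thesis
      proof (rule maximum_modulus_frontier[OF _ _ _ _ j(2)])
        show "F holomorphic_on interior (open_stadium (\<alpha> j) (\<beta> j) r)" using hol holomorphic_on_subset
          by blast
        show "continuous_on (closure (open_stadium (\<alpha> j) (\<beta> j) r)) F"
          using holomorphic_on_imp_continuous_on[OF hol] continuous_on_subset by blast
        show "bounded (open_stadium (\<alpha> j) (\<beta> j) r)"
        proof (rule boundedI)
          fix z assume "z \<in> open_stadium (\<alpha> j) (\<beta> j) r"
          then obtain s where s: "s \<in> {\<alpha> j..\<beta> j}" "cmod (z - of_real s) < r"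
            by (auto simp: mem_open_stadium)
          have "cmod z \<le> cmod (z - of_real s) + cmod (of_real s)"
            using norm_triangle_ineq[of "z - of_real s" "of_real s"] by simp
          then show "cmod z \<le> r + (\<bar>\<alpha> j\<bar> + \<bar>\<beta> j\<bar>)" using s by auto
        qed
        show "cmod (F z) \<le> M" if "z \<in> frontier (open_stadium (\<alpha> j) (\<beta> j) r)" for z
          by (rule F_out[OF frontier_open_stadium[OF j(1) that]])
      qed
    qed (rule F_out)
    then have "bounded (range F)" by (auto intro: boundedI)
    with Liouville_theorem[OF hol] obtain c where c: "\<And>w. F w = c" unfolding constant_on_def by blast
    have decay: "cmod c \<le> 1 / t * (norm u * norm y)" if t: "t > 0" for t
    proof -
      have "dist_ge (\<i> * of_real (t + b)) (t + b)" using dist_ge_Im[of "\<i> * of_real (t + b)"] t b by simp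
      moreover from this have "\<i> * of_real (t + b) \<in> Om b" using t unfolding Om_def
        by (intro CollectI exI[of _ "t + b"]) auto
      ultimately show ?thesis using f_bound[of "\<i> * of_real (t + b)" "t + b"] t Ff c by fastforce
    qed
    have "cmod c \<le> 0"
    proof (rule field_le_epsilon)
      fix e :: real assume e: "e > 0"
      define N where "N = norm u * norm y"
      have N: "N \<ge> 0" by (simp add: N_def)
      \<comment> \<open>Using N + 1 instead of N keeps the height t positive even if u or y is
        0.\<close>
      have "0 < (N + 1) / e" using e N by simp
      from decay[OF this] have "cmod c \<le> 1 / ((N + 1) / e) * N" by (simp only: N_def)
      also have "\<dots> = e * (N / (N + 1))" using e by simp
      also have "\<dots> \<le> e * 1" using e N by (intro mult_left_mono) auto
      finally show "cmod c \<le> 0 + e" by simp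
    qed
    then have "c = 0" by simp
    moreover have "\<i> * of_real (b + 1) \<in> Om b"
      using dist_ge_Im[of "\<i> * of_real (b + 1)"] b unfolding Om_def
        by (intro CollectI exI[of _ "b + 1"]) auto
    ultimately show ?thesis using Ff c by (simp add: f_def w)
  qed
  define w where "w = \<i> * complex_of_real (b + 1)"
  have wO: "w \<in> Om b"
    using dist_ge_Im[of w] b unfolding Om_def w_def by (intro CollectI exI[of _ "b + 1"]) auto
  have "resolvent D A w u = 0" by (rule cinner_eqI) (simp add: zero[OF w_def])
  moreover have "A 0 - w *\<^sub>C 0 = 0"
  proof -
    have "0 \<in> D" using A_linear by (simp add: linear_operator_def csubspace_def)
    then show ?thesis using linear_operator_shift(2)[OF A_linear, of 0 0 w] by simp
  qed
  ultimately show ?thesis using resolvent_right[OF A_linear Om_A[OF wO], of u] by simp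
qed

text \<open>\<open>Q j\<close> is compared with the bounded resolvent at one contour point z instead
  of the unbounded A. For x in the range and in D, y = (A - z) x has R y = x = Q x = R (Q y);
  applying A - z gives Q y = y, and A x = y + z x stays in the range.\<close>

lemma range_Q_invariant:
  assumes j: "j \<in> J" and closed: "csubspace (range (Q j))" "closed (range (Q j))"
  shows "invariant_subspace D A (range (Q j))"
  unfolding invariant_subspace_def
proof (intro conjI closed subsetI)
  fix v assume "v \<in> A ` (range (Q j) \<inter> D)"
  then obtain x where x: "x \<in> range (Q j)" "x \<in> D" "v = A x" by blast
  obtain z where z: "z \<in> path_image (\<Gamma> j)" using path_image_nonempty[of "\<Gamma> j"] by blast
  then have zO: "z \<in> Om b" using \<Gamma>_Om j by blast
  note R = resolvent_props[OF A_linear Om_A[OF zO]]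
  define y where "y = A x - z *\<^sub>C x"
  have Qx: "Q j x = x" using x(1) Q_idem[OF j] by auto
  have Ry: "resolvent D A z y = x" using R(3)[OF x(2)] by (simp add: y_def)
  have "resolvent D A z (Q j y) = Q j (resolvent D A z y)"
    unfolding Q_def by (rule RA.Q_R_commute[OF \<Gamma>_Om(1)[OF j] zO, symmetric])
  then have "resolvent D A z (Q j y) = x" using Ry Qx by simp
  then have "Q j y = y" using R(2)[of "Q j y"] by (simp add: y_def)
  then have "y \<in> range (Q j)" by (rule range_eqI[OF sym])
  moreover have "z *\<^sub>C x \<in> range (Q j)" using closed(1) x(1) unfolding csubspace_def by blast
  ultimately have "y + z *\<^sub>C x \<in> range (Q j)" using closed(1) unfolding csubspace_def by blast
  then show "v \<in> range (Q j)" by (simp add: y_def x)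
qed

theorem riesz_basis:
  "(\<forall>j\<in>J. invariant_subspace D A (range (Q j))) \<and> unconditional_subspace_basis J (\<lambda>j. range (Q j))"
proof -
  obtain C where C: "\<And>F \<epsilon> x. finite F \<Longrightarrow> F \<subseteq> J \<Longrightarrow> (\<And>j. \<epsilon> j \<in> {1, -1}) \<Longrightarrow>
    norm (\<Sum>j\<in>F. \<epsilon> j *\<^sub>R Q j x) \<le> C * norm x"
    using Q_signed_bound by blast
  interpret projection_family J Q C
  proof
    show "Q j (c *\<^sub>C x) = c *\<^sub>C Q j x" if "j \<in> J" for j c x
      unfolding Q_def by (rule RA.Q_scaleC[OF \<Gamma>_Om(1)[OF that]])
  qed (fact Q_idem Q_orth C Q_complete)+
  show ?thesis using unconditional_basis range_Q_invariant csubspace_range_Q closed_range_Q by blast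
qed

end

theorem theorem1:
  fixes D :: "'a::complex_hilbert_space set"
    and T B A :: "'a \<Rightarrow> 'a"
    and J :: "int set"
    and \<alpha> \<beta> :: "int \<Rightarrow> real"
    and b d :: real
  assumes "J = \<nat> \<or> J = \<int>"
    and "self_adjoint_operator D T"
    and "\<forall>j\<in>J. \<alpha> j \<le> \<beta> j"
    and "\<forall>j\<in>J. \<alpha> (j + 1) > \<beta> j"
    and "op_spectrum D T \<subseteq> (\<Union>j\<in>J. complex_of_real ` {\<alpha> j..\<beta> j})"
    and "(INF j\<in>J. \<alpha> (j + 1) - \<beta> j) = d" and "d > 0"
    and "bounded_clinear B"
    and "b = onorm B" and "b < d / 2"
    and "A = (\<lambda>x. T x + B x)"
  shows "op_spectrum D A \<subseteq> (\<Union>j\<in>J. cnbhd b {\<alpha> j..\<beta> j}) \<and>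
    disjoint_family_on (\<lambda>j. cnbhd b {\<alpha> j..\<beta> j}) J \<and>
    (\<forall>b'. b < b' \<and> b' < d / 2 \<longrightarrow>
      (let Q = (\<lambda>j. riesz_projection D A (stadium_path (\<alpha> j) (\<beta> j) b'));
           L = (\<lambda>j. range (blinfun_apply (Q j)))
       in (\<forall>j\<in>J. invariant_subspace D A (L j)) \<and> unconditional_subspace_basis J L))"
proof -
  have B: "bounded_linear B" using assms(8) by (simp add: bounded_clinear_def)
  interpret perturbed_operator J \<alpha> \<beta> d D T B A b
  proof
    \<comment> \<open>An infimum of reals bounds its set from below only if that set is bounded
      below at all; positivity of the gaps supplies the bound 0.\<close>
    have bdd: "bdd_below ((\<lambda>j. \<alpha> (j + 1) - \<beta> j) ` J)"
      using assms(4) by (intro bdd_belowI2[where m = 0]) (auto simp: less_imp_le)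
    show "d \<le> \<alpha> (j + 1) - \<beta> j" if "j \<in> J" for j
      unfolding assms(6)[symmetric] by (rule cINF_lower[OF bdd that])
    show "norm (B x) \<le> b * norm x" for x
      unfolding assms(9) by (rule onorm[OF B])
    show "0 \<le> b" unfolding assms(9) by (rule onorm_pos_le[OF B])
  qed (use assms in auto)
  show ?thesis
  proof (intro conjI allI impI)
    show "op_spectrum D A \<subseteq> (\<Union>j\<in>J. cnbhd b {\<alpha> j..\<beta> j})" by (rule op_spectrum_A)
    show "disjoint_family_on (\<lambda>j. cnbhd b {\<alpha> j..\<beta> j}) J" by (rule cnbhd_disjoint[OF b(2)])
    fix b' assume b': "b < b' \<and> b' < d / 2"
    interpret riesz_contours J \<alpha> \<beta> d D T B A b b'
      by unfold_locales (use b' in auto)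
    show "let Q = (\<lambda>j. riesz_projection D A (stadium_path (\<alpha> j) (\<beta> j) b'));
           L = (\<lambda>j. range (blinfun_apply (Q j)))
       in (\<forall>j\<in>J. invariant_subspace D A (L j)) \<and> unconditional_subspace_basis J L"
      using riesz_basis unfolding Q_eq by (simp add: Let_def)
  qed
qed

end
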